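(* There exists an absolute constant $c>0$ such that the following holds. Let $\mathbb{F}$ be a field of characteristic $p$, where $p$ is an odd prime, and let $\omega$ be a non-degenerate symmetric or skew-symmetric bilinear form on $\mathbb{F}^2$. Let $S\subseteq\mathbb{F}^2$ be a set of $N$ points not contained in a single line. Then $$|\omega(S)|\geq c\min\left(N^{2/3},p\right),\qquad \omega(S)=\{\omega(s,s'): s,s'\in S\}.$$ Moreover, if $S$ has a subset $S'$ of $N'<p$ points lying on pairwise distinct lines through the origin, then $|\omega(S)|\geq cN'$. *)

theory Defs
  imports Complex_Main "HOL-Computational_Algebra.Primes" "HOL-Algebra.Multiplicative_Group"
    "HOL-Algebra.Module"
begin

text \<open>The vector space \<open>F\<^sup>2\<close>. The multiplicative fields of the module record are irrelevant.\<close>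

definition plane :: "'a ring \<Rightarrow> ('a, 'a \<times> 'a) module" where
  "plane F = \<lparr>carrier = carrier F \<times> carrier F,
    mult = undefined, one = undefined,
    zero = (\<zero>\<^bsub>F\<^esub>, \<zero>\<^bsub>F\<^esub>),
    add = (\<lambda>(x, y) (x', y'). (x \<oplus>\<^bsub>F\<^esub> x', y \<oplus>\<^bsub>F\<^esub> y')),
    smult = (\<lambda>t (x, y). (t \<otimes>\<^bsub>F\<^esub> x, t \<otimes>\<^bsub>F\<^esub> y))\<rparr>"

lemma module_plane:
  assumes "field F"
  shows "module F (plane F)"
proof -
  interpret field F by fact
  have "abelian_group (plane F)"
  proof (rule abelian_groupI)
    fix u assume "u \<in> carrier (plane F)"
    then show "\<exists>v\<in>carrier (plane F). v \<oplus>\<^bsub>plane F\<^esub> u = \<zero>\<^bsub>plane F\<^esub>"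
      by (intro bexI[of _ "(\<ominus>\<^bsub>F\<^esub> fst u, \<ominus>\<^bsub>F\<^esub> snd u)"]) (auto simp: plane_def l_neg)
  qed (auto simp: plane_def a_ac)
  then show ?thesis
    by (intro moduleI) (auto simp: plane_def l_distr r_distr m_assoc is_cring)
qed

text \<open>The additive order of \<open>1\<close> is \<open>0\<close> if it is infinite, so this is the usual convention.\<close>

definition characteristic :: "'a ring \<Rightarrow> nat" where
  "characteristic F = group.ord (add_monoid F) \<one>\<^bsub>F\<^esub>"

definition plane_lines :: "'a ring \<Rightarrow> ('a \<times> 'a) set set" where
  "plane_lines F = {{a \<oplus>\<^bsub>plane F\<^esub> (t \<odot>\<^bsub>plane F\<^esub> d) | t. t \<in> carrier F} | a d.
     a \<in> carrier (plane F) \<and> d \<in> carrier (plane F) \<and> d \<noteq> \<zero>\<^bsub>plane F\<^esub>}"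

definition lines_through_origin :: "'a ring \<Rightarrow> ('a \<times> 'a) set set" where
  "lines_through_origin F = {l \<in> plane_lines F. \<zero>\<^bsub>plane F\<^esub> \<in> l}"

definition on_distinct_lines_through_origin :: "'a ring \<Rightarrow> ('a \<times> 'a) set \<Rightarrow> bool" where
  "on_distinct_lines_through_origin F T \<longleftrightarrow>
    (\<exists>l. inj_on l T \<and> (\<forall>s\<in>T. l s \<in> lines_through_origin F \<and> s \<in> l s))"

definition bilinear_form :: "'a ring \<Rightarrow> ('a \<times> 'a \<Rightarrow> 'a \<times> 'a \<Rightarrow> 'a) \<Rightarrow> bool" where
  "bilinear_form F \<omega> \<longleftrightarrow>
    (\<forall>u\<in>carrier (plane F). \<forall>v\<in>carrier (plane F). \<omega> u v \<in> carrier F) \<and>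
    (\<forall>u\<in>carrier (plane F). \<forall>v\<in>carrier (plane F). \<forall>w\<in>carrier (plane F).
      \<omega> (u \<oplus>\<^bsub>plane F\<^esub> v) w = \<omega> u w \<oplus>\<^bsub>F\<^esub> \<omega> v w \<and>
      \<omega> w (u \<oplus>\<^bsub>plane F\<^esub> v) = \<omega> w u \<oplus>\<^bsub>F\<^esub> \<omega> w v) \<and>
    (\<forall>t\<in>carrier F. \<forall>u\<in>carrier (plane F). \<forall>v\<in>carrier (plane F).
      \<omega> (t \<odot>\<^bsub>plane F\<^esub> u) v = t \<otimes>\<^bsub>F\<^esub> \<omega> u v \<and>
      \<omega> u (t \<odot>\<^bsub>plane F\<^esub> v) = t \<otimes>\<^bsub>F\<^esub> \<omega> u v)"

definition nondegenerate_form :: "'a ring \<Rightarrow> ('a \<times> 'a \<Rightarrow> 'a \<times> 'a \<Rightarrow> 'a) \<Rightarrow> bool" where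
  "nondegenerate_form F \<omega> \<longleftrightarrow>
    (\<forall>u\<in>carrier (plane F).
      (\<forall>v\<in>carrier (plane F). \<omega> u v = \<zero>\<^bsub>F\<^esub>) \<longrightarrow> u = \<zero>\<^bsub>plane F\<^esub>) \<and>
    (\<forall>v\<in>carrier (plane F).
      (\<forall>u\<in>carrier (plane F). \<omega> u v = \<zero>\<^bsub>F\<^esub>) \<longrightarrow> v = \<zero>\<^bsub>plane F\<^esub>)"

definition symmetric_form :: "'a ring \<Rightarrow> ('a \<times> 'a \<Rightarrow> 'a \<times> 'a \<Rightarrow> 'a) \<Rightarrow> bool" where
  "symmetric_form F \<omega> \<longleftrightarrow>
    (\<forall>u\<in>carrier (plane F). \<forall>v\<in>carrier (plane F). \<omega> u v = \<omega> v u)"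

definition skew_symmetric_form :: "'a ring \<Rightarrow> ('a \<times> 'a \<Rightarrow> 'a \<times> 'a \<Rightarrow> 'a) \<Rightarrow> bool" where
  "skew_symmetric_form F \<omega> \<longleftrightarrow>
    (\<forall>u\<in>carrier (plane F). \<forall>v\<in>carrier (plane F). \<omega> u v = \<ominus>\<^bsub>F\<^esub> \<omega> v u)"

definition form_values :: "('a \<times> 'a \<Rightarrow> 'a \<times> 'a \<Rightarrow> 'a) \<Rightarrow> ('a \<times> 'a) set \<Rightarrow> 'a set" where
  "form_values \<omega> S = {\<omega> s s' | s s'. s \<in> S \<and> s' \<in> S}"

definition form_values_bound :: "real \<Rightarrow> 'a ring \<Rightarrow> bool" where
  "form_values_bound c F \<longleftrightarrow>
    (\<forall>p \<omega> S.
      prime p \<and> odd p \<and> characteristic F = p \<and>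
      bilinear_form F \<omega> \<and> nondegenerate_form F \<omega> \<and>
      (symmetric_form F \<omega> \<or> skew_symmetric_form F \<omega>) \<and>
      finite S \<and> S \<subseteq> carrier (plane F) \<and> \<not> (\<exists>l\<in>plane_lines F. S \<subseteq> l) \<longrightarrow>
        c * min (real (card S) powr (2/3)) (real p) \<le> real (card (form_values \<omega> S)) \<and>
        (\<forall>S'. S' \<subseteq> S \<and> card S' < p \<and> on_distinct_lines_through_origin F S' \<longrightarrow>
          c * real (card S') \<le> real (card (form_values \<omega> S))))"

text \<open>
  HOL cannot quantify over types below an existential quantifier, and in
  \<open>\<exists>c>0. \<forall>F :: 'a ring. field F \<longrightarrow> form_values_bound c F\<close> the number \<open>c\<close> could depend on the
  type \<open>'a\<close>. To have one number that serves the fields on all types, it is named by a closed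
  term: a positive number that works for every field whose carrier is a set of natural numbers
  (that is, up to isomorphism, for every countable field). If there is no such number, this is
  an unspecified real about which nothing can be proved. The main statement is that this number
  is positive and works for every field on every type.
\<close>

definition absolute_constant :: real where
  "absolute_constant =
    (SOME c. 0 < c \<and> (\<forall>F :: nat ring. field F \<longrightarrow> form_values_bound c F))"

end

theory Submission
  imports Defs "HOL-Computational_Algebra.Polynomial" "HOL-Algebra.Algebraic_Closure_Type"
    "HOL-Algebra.Generated_Fields" "HOL-Algebra.Weak_Morphisms" "HOL-Analysis.Convex"
    "HOL-Library.Countable_Set" "HOL-Library.Function_Algebras"
begin

text \<open>For the second bound, the fibres of \<open>\<omega>(s, -)\<close> are parallel lines in a direction determined by
  that of \<open>s\<close>, and Cauchy--Schwarz applies. The first bound counts the solutions of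
  \<open>\<omega>(s, s') = \<omega>(t, t')\<close>. These are incidences of points and planes in projective space and, after a
  generic change of coordinates over an infinite field, meetings of lines with directions
  \<open>(\<beta>\<^sup>2, \<beta>, 1)\<close> in affine space. If there were too many, one could prune to two families in
  which every line meets many lines of the other family. Let \<open>f\<close> be a nonzero polynomial of least
  degree that vanishes on all of the lines; this degree is below \<open>p\<close> and below the number of
  meetings on each line. Where two lines meet, \<open>t \<mapsto> f\<^sub>1 t\<^sup>2 + f\<^sub>2 t + f\<^sub>3\<close>, the first derivative of
  \<open>f\<close> in the direction of the line of slope \<open>t\<close>, has two roots that are also roots of the second
  derivative in that direction. So the remainder of the latter modulo the former vanishes at the
  meetings, hence on all lines. Differentiating the remainder along the surface gives a
  differential equation on a line whose solution says that the tangent planes along the line vary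
  linearly. The neighbours of the line then come from collinear points, of which there are few.\<close>

hide_const (open) Polynomials.degree Divisibility.prime

section \<open>Polynomials\<close>

subsection \<open>Derivations and ring homomorphisms\<close>

locale derivation = additive D for D :: "'r::comm_ring_1 \<Rightarrow> 'r" +
  assumes mult: "D (x * y) = D x * y + x * D y"
begin

lemma of_nat_mult: "D (of_nat n * x) = of_nat n * D x"
  by (induction n) (auto simp: zero add algebra_simps)

end

lemma derivation_add:
  assumes "derivation D" "derivation D'"
  shows "derivation (\<lambda>x. D x + D' x)"
proof -
  interpret D: derivation D by fact
  interpret D': derivation D' by fact
  show ?thesis
    by unfold_locales (simp_all add: D.add D'.add D.mult D'.mult algebra_simps)
qed

lemma derivation_scale:
  assumes "derivation D"
  shows "derivation (\<lambda>x. k * D x)"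
proof -
  interpret derivation D by fact
  show ?thesis
    by unfold_locales (simp_all add: add mult algebra_simps)
qed

lemma derivation_pderiv: "derivation (pderiv :: 'a::idom poly \<Rightarrow> _)"
  by unfold_locales (simp_all add: pderiv_add pderiv_mult algebra_simps)

lemma derivation_map_poly:
  assumes "derivation D"
  shows "derivation (map_poly D)"
proof -
  interpret derivation D by fact
  show ?thesis
    by unfold_locales
      (simp_all add: poly_eq_iff coeff_map_poly zero add sum mult coeff_mult sum.distrib)
qed

lemma pderiv_map_poly_derivation:
  assumes "derivation (D :: 'a::idom \<Rightarrow> 'a)"
  shows "pderiv (map_poly D p) = map_poly D (pderiv p)"
proof -
  interpret derivation D by fact
  show ?thesis
    by (simp only: poly_eq_iff coeff_pderiv coeff_map_poly zero of_nat_mult) simp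
qed

lemma map_poly_derivation_commute:
  assumes "derivation D" "derivation D'" "\<And>x. D (D' x) = D' (D x)"
  shows "map_poly D (map_poly D' p) = map_poly D' (map_poly D p)"
proof -
  interpret D: derivation D by fact
  interpret D': derivation D' by fact
  show ?thesis
    by (simp add: poly_eq_iff coeff_map_poly D.zero D'.zero assms(3))
qed

locale comm_ring_hom = additive h for h :: "'r::comm_ring_1 \<Rightarrow> 's::comm_ring_1" +
  assumes one: "h 1 = 1" and mult: "h (x * y) = h x * h y"
begin

lemma power: "h (x ^ n) = h x ^ n"
  by (induction n) (auto simp: one mult)

lemma numeral: "h (numeral k) = numeral k"
proof -
  have "h (of_nat n) = of_nat n" for n
    by (induction n) (auto simp: zero add one)
  from this[of "numeral k"] show ?thesis
    by simp
qed

lemmas simps = zero one add diff minus mult power numeral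

end

lemma comm_ring_hom_poly_map_poly:
  assumes "comm_ring_hom h"
  shows "comm_ring_hom (\<lambda>p. poly (map_poly h p) c)"
proof -
  interpret comm_ring_hom h by fact
  have "map_poly h (p + q) = map_poly h p + map_poly h q"
    "map_poly h (p * q) = map_poly h p * map_poly h q" "map_poly h 1 = 1" for p q
    by (auto simp: poly_eq_iff coeff_map_poly simps sum coeff_mult)
  then show ?thesis
    by unfold_locales auto
qed

lemma comm_ring_hom_pcompose: "comm_ring_hom (\<lambda>p. pcompose p q)"
  by unfold_locales (simp_all add: pcompose_add pcompose_mult one_pCons)

lemma poly_poly_map_poly:
  assumes "comm_ring_hom h"
  shows "poly (poly (map_poly h p) c) u = poly (map_poly (\<lambda>x. poly (h x) u) p) (poly c u)"
proof -
  interpret comm_ring_hom h by fact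
  show ?thesis
    by (induction p) (auto simp: map_poly_pCons simps)
qed

lemma pderiv_poly_map_poly:
  fixes h :: "'r::idom \<Rightarrow> 'a::idom poly"
  assumes "comm_ring_hom h"
  shows "pderiv (poly (map_poly h p) c)
    = poly (map_poly (\<lambda>x. pderiv (h x)) p) c + pderiv c * poly (map_poly h (pderiv p)) c"
proof -
  interpret eval: comm_ring_hom "\<lambda>p. poly (map_poly h p) c"
    using assms by (rule comm_ring_hom_poly_map_poly)
  interpret comm_ring_hom h by fact
  show ?thesis
    by (induction p)
      (simp_all add: map_poly_pCons pderiv_add pderiv_mult pderiv_pCons simps eval.add algebra_simps)
qed

subsection \<open>Polynomials in three variables\<close>

type_synonym 'k poly3 = "'k poly poly poly"

definition const3 :: "'k::field \<Rightarrow> 'k poly3" where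
  "const3 k = [:[:[:k:]:]:]"

definition dz :: "'k::field poly3 \<Rightarrow> 'k poly3" where "dz = pderiv"
definition dy :: "'k::field poly3 \<Rightarrow> 'k poly3" where "dy = map_poly pderiv"
definition dx :: "'k::field poly3 \<Rightarrow> 'k poly3" where "dx = map_poly (map_poly pderiv)"

interpretation dx: derivation dx
  unfolding dx_def by (intro derivation_map_poly derivation_pderiv)

interpretation dy: derivation dy
  unfolding dy_def by (intro derivation_map_poly derivation_pderiv)

interpretation dz: derivation dz
  unfolding dz_def by (rule derivation_pderiv)

lemma dx_dy: "dx (dy h) = dy (dx h)" and dx_dz: "dx (dz h) = dz (dx h)" and dy_dz: "dy (dz h) = dz (dy h)"
  by (simp_all add: dx_def dy_def dz_def derivation_map_poly derivation_pderiv
      pderiv_map_poly_derivation map_poly_derivation_commute)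

lemma partial_const3 [simp]: "dx (const3 k) = 0" "dy (const3 k) = 0" "dz (const3 k) = 0"
  by (simp_all add: dx_def dy_def dz_def const3_def map_poly_pCons pderiv_pCons)

lemma const3_add: "const3 (a + b) = const3 a + const3 b"
  and const3_mult: "const3 (a * b) = const3 a * const3 b"
  by (simp_all add: const3_def)

definition eval3 :: "'k::field \<Rightarrow> 'k \<Rightarrow> 'k \<Rightarrow> 'k poly3 \<Rightarrow> 'k" where
  "eval3 x y z h = poly (map_poly (\<lambda>g. poly (map_poly (\<lambda>e. poly e x) g) y) h) z"

definition subst3 :: "'k::field poly \<Rightarrow> 'k poly \<Rightarrow> 'k poly \<Rightarrow> 'k poly3 \<Rightarrow> 'k poly" where
  "subst3 px py pz h = poly (map_poly (\<lambda>g. poly (map_poly (\<lambda>e. pcompose e px) g) py) h) pz"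

interpretation subst3: comm_ring_hom "subst3 px py pz" for px py pz
  unfolding subst3_def by (intro comm_ring_hom_poly_map_poly comm_ring_hom_pcompose)

lemma poly_subst3: "poly (subst3 px py pz h) u = eval3 (poly px u) (poly py u) (poly pz u) h"
  by (simp add: subst3_def eval3_def poly_poly_map_poly comm_ring_hom_poly_map_poly
      comm_ring_hom_pcompose poly_pcompose)

lemma subst3_const3 [simp]: "subst3 px py pz (const3 k) = [:k:]"
  by (simp add: subst3_def const3_def map_poly_pCons)

lemma pderiv_subst3:
  "pderiv (subst3 px py pz h) = pderiv px * subst3 px py pz (dx h) + pderiv py * subst3 px py pz (dy h)
     + pderiv pz * subst3 px py pz (dz h)"
proof -
  have smult_map: "poly (map_poly (\<lambda>x. s * f x) p) c = s * poly (map_poly f p) c"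
    if "f 0 = 0" for s c :: "'a poly" and f :: "'b::zero \<Rightarrow> 'a poly" and p
    using that by (induction p) (simp_all add: map_poly_pCons algebra_simps)
  have add_map: "poly (map_poly (\<lambda>x. f x + g x) p) c = poly (map_poly f p) c + poly (map_poly g p) c"
    if "f 0 = 0" "g 0 = 0" for f g :: "'b::zero \<Rightarrow> 'a poly" and p c
    using that by (induction p) (simp_all add: map_poly_pCons algebra_simps)
  define sx where "sx = (\<lambda>e. pcompose e px)"
  define sy where "sy = (\<lambda>g. poly (map_poly sx g) py)"
  have sx: "comm_ring_hom sx"
    unfolding sx_def by (rule comm_ring_hom_pcompose)
  then have sy: "comm_ring_hom sy"
    unfolding sy_def by (rule comm_ring_hom_poly_map_poly)
  interpret sx: comm_ring_hom sx by (rule sx)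
  interpret sy: comm_ring_hom sy by (rule sy)
  have "pderiv (sy g) = pderiv px * sy (map_poly pderiv g) + pderiv py * sy (pderiv g)" for g
    unfolding sy_def pderiv_poly_map_poly[OF sx]
    by (simp add: sx_def pderiv_pcompose mult.commute[of _ "pderiv px"] smult_map map_poly_map_poly o_def)
  then show ?thesis
    unfolding subst3_def sx_def[symmetric] sy_def[symmetric] pderiv_poly_map_poly[OF sy]
    by (simp add: add_map smult_map sy.zero dx_def dy_def dz_def map_poly_map_poly o_def)
qed

subsection \<open>Total degree\<close>

inductive total_degree_le :: "'k::field poly3 \<Rightarrow> nat \<Rightarrow> bool" where
  const: "total_degree_le (const3 k) n"
| x: "total_degree_le [:[:[:0, 1:]:]:] (Suc n)"
| y: "total_degree_le [:[:0, 1:]:] (Suc n)"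
| z: "total_degree_le [:0, 1:] (Suc n)"
| add: "total_degree_le g n \<Longrightarrow> total_degree_le h n \<Longrightarrow> total_degree_le (g + h) n"
| mult: "total_degree_le g m \<Longrightarrow> total_degree_le h n \<Longrightarrow> total_degree_le (g * h) (m + n)"

lemma total_degree_le_mono: "total_degree_le g m \<Longrightarrow> m \<le> n \<Longrightarrow> total_degree_le g n"
proof (induction arbitrary: n rule: total_degree_le.induct)
  case (mult g m1 h m2)
  from mult.prems have "total_degree_le (g * h) (m1 + (n - m1))"
    by (intro total_degree_le.mult mult) auto
  then show ?case
    using mult.prems by simp
next
  case (x m n) then show ?case by (cases n) (auto intro: total_degree_le.intros)
next
  case (y m n) then show ?case by (cases n) (auto intro: total_degree_le.intros)
next
  case (z m n) then show ?case by (cases n) (auto intro: total_degree_le.intros)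
qed (auto intro: total_degree_le.intros)

lemma total_degree_le_0 [simp]: "total_degree_le 0 n"
  using total_degree_le.const[of 0] by (simp add: const3_def)

lemma total_degree_le_1 [simp]: "total_degree_le 1 n"
  using total_degree_le.const[of 1] by (simp add: const3_def one_pCons)

lemma total_degree_le_const3_mult: "total_degree_le h n \<Longrightarrow> total_degree_le (const3 k * h) n"
  using total_degree_le.mult[OF total_degree_le.const[of k 0], of h n] by simp

lemma total_degree_le_numeral_mult: "total_degree_le g n \<Longrightarrow> total_degree_le (numeral k * g) n"
  using total_degree_le_const3_mult[of g n "numeral k"] by (simp add: const3_def numeral_poly)

lemma total_degree_le_diff:
  assumes "total_degree_le g n" "total_degree_le h n"
  shows "total_degree_le (g - h) n"
proof -
  have "const3 (-1) = (-1 :: 'a poly3)"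
    by (simp add: const3_def one_pCons)
  then show ?thesis
    using total_degree_le.add[OF assms(1) total_degree_le_const3_mult[OF assms(2), of "-1"]] by simp
qed

lemma total_degree_le_sum: "(\<And>i. i \<in> I \<Longrightarrow> total_degree_le (g i) n) \<Longrightarrow> total_degree_le (sum g I) n"
  by (induction I rule: infinite_finite_induct) (auto intro: total_degree_le.add)

lemma total_degree_le_power: "total_degree_le g n \<Longrightarrow> total_degree_le (g ^ k) (k * n)"
  by (induction k) (auto intro: total_degree_le.mult)

lemma total_degree_le_derivation:
  fixes D :: "'k::field poly3 \<Rightarrow> 'k poly3"
  assumes D: "derivation D" "\<And>k. D (const3 k) = 0"
    and vars: "\<And>n. total_degree_le (D [:[:[:0, 1:]:]:]) n" "\<And>n. total_degree_le (D [:[:0, 1:]:]) n"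
      "\<And>n. total_degree_le (D [:0, 1:]) n"
    and g: "total_degree_le g n"
  shows "total_degree_le (D g) (n - 1)"
proof -
  interpret D: derivation D by fact
  from g have "(n = 0 \<longrightarrow> D g = 0) \<and> total_degree_le (D g) (n - 1)"
  proof induction
    case (mult g m h n)
    have "total_degree_le (D g * h) (m + n - 1)"
      using mult total_degree_le.mult[of "D g" "m - 1" h n] by (cases "m = 0") auto
    moreover have "total_degree_le (g * D h) (m + n - 1)"
      using mult total_degree_le.mult[of g m "D h" "n - 1"] by (cases "n = 0") auto
    ultimately show ?case
      using mult.IH by (auto simp: D.mult intro: total_degree_le.add)
  qed (auto simp: D.add D(2) vars intro: total_degree_le.intros)
  then show ?thesis ..
qed

lemma total_degree_le_partial:
  assumes "total_degree_le g n"
  shows "total_degree_le (dx g) (n - 1)" "total_degree_le (dy g) (n - 1)" "total_degree_le (dz g) (n - 1)"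
proof -
  have variables:
    "dx [:[:[:0, 1:]:]:] = (1 :: 'a poly3)" "dx [:[:0, 1:]:] = (0 :: 'a poly3)"
    "dx [:0, 1:] = (0 :: 'a poly3)"
    "dy [:[:[:0, 1:]:]:] = (0 :: 'a poly3)" "dy [:[:0, 1:]:] = (1 :: 'a poly3)"
    "dy [:0, 1:] = (0 :: 'a poly3)"
    "dz [:[:[:0, 1:]:]:] = (0 :: 'a poly3)" "dz [:[:0, 1:]:] = (0 :: 'a poly3)"
    "dz [:0, 1:] = (1 :: 'a poly3)"
    by (simp_all add: dx_def dy_def dz_def map_poly_pCons pderiv_pCons one_pCons)
  show "total_degree_le (dx g) (n - 1)"
    by (rule total_degree_le_derivation[OF dx.derivation_axioms _ _ _ _ assms]) (simp_all add: variables)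
  show "total_degree_le (dy g) (n - 1)"
    by (rule total_degree_le_derivation[OF dy.derivation_axioms _ _ _ _ assms]) (simp_all add: variables)
  show "total_degree_le (dz g) (n - 1)"
    by (rule total_degree_le_derivation[OF dz.derivation_axioms _ _ _ _ assms]) (simp_all add: variables)
qed

lemma degree_subst3_le:
  assumes "total_degree_le h n" and linear: "degree px \<le> 1" "degree py \<le> 1" "degree pz \<le> 1"
  shows "degree (subst3 px py pz h) \<le> n"
  using assms(1)
proof induction
  case (add g n h)
  then show ?case
    by (simp add: subst3.add degree_add_le)
next
  case (mult g m h n)
  then show ?case
    by (simp add: subst3.mult) (meson add_mono degree_mult_le le_trans)
qed (use linear in \<open>auto simp: subst3_def map_poly_pCons const3_def pcompose_pCons one_pCons\<close>)

lemma total_degree_le_degrees: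
  assumes "total_degree_le h n"
  shows "degree h \<le> n \<and> degree (coeff h i) \<le> n \<and> degree (coeff (coeff h i) j) \<le> n"
  using assms
proof (induction arbitrary: i j)
  case (add g n h)
  then show ?case
    by (simp add: degree_add_le)
next
  case (mult g m h n)
  have "degree (g * h) \<le> m + n"
    by (rule order.trans[OF degree_mult_le]) (simp add: add_mono mult.IH)
  moreover have "degree (coeff (g * h) i) \<le> m + n"
    unfolding coeff_mult by (intro degree_sum_le order.trans[OF degree_mult_le]) (auto simp: add_mono mult.IH)
  moreover have "degree (coeff (coeff (g * h) i) j) \<le> m + n"
    unfolding coeff_mult coeff_sum
    by (intro degree_sum_le order.trans[OF degree_mult_le]) (auto simp: add_mono mult.IH)
  ultimately show ?case
    by simp
qed (auto simp: const3_def coeff_pCons split: nat.split)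

lemma degrees_0_imp_const3:
  assumes "degree h = 0" "degree (coeff h 0) = 0" "degree (coeff (coeff h 0) 0) = 0"
  shows "\<exists>k. h = const3 k"
proof -
  obtain g where g: "h = [:g:]"
    using assms(1) degree_eq_zeroE by blast
  obtain e where e: "g = [:e:]"
    using assms(2) g degree_eq_zeroE by auto
  obtain k where "e = [:k:]"
    using assms(3) g e degree_eq_zeroE by auto
  then show ?thesis
    using g e by (auto simp: const3_def)
qed

lemma total_degree_le_0_imp_const3: "total_degree_le h 0 \<Longrightarrow> \<exists>k. h = const3 k"
  using total_degree_le_degrees[of h 0] by (intro degrees_0_imp_const3) auto

subsection \<open>Small degrees in positive characteristic\<close>

lemma of_nat_eq_imp_eq_below_CHAR:
  assumes "of_nat m = (of_nat n :: 'a::ring_1)" "m < CHAR('a)" "n < CHAR('a)"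
  shows "m = n"
  using assms
proof (induction m n rule: linorder_wlog)
  case (le m n)
  then have "of_nat (n - m) = (0 :: 'a)"
    by (simp add: of_nat_diff)
  then have "CHAR('a) dvd n - m"
    by (simp only: of_nat_eq_0_iff_char_dvd)
  then show ?case
    using le by (auto dest: dvd_imp_le)
qed auto

lemma pderiv_eq_0_imp_degree_0:
  fixes g :: "'a::idom poly"
  assumes "pderiv g = 0" "degree g < CHAR('a)"
  shows "degree g = 0"
proof (rule ccontr)
  assume "degree g \<noteq> 0"
  then obtain k where k: "degree g = Suc k"
    using not0_implies_Suc by blast
  have "of_nat (Suc k) * coeff g (Suc k) = 0"
    using arg_cong[OF assms(1), of "\<lambda>h. coeff h k"] by (simp add: coeff_pderiv)
  moreover have "of_nat (Suc k) \<noteq> (0::'a)"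
    using assms(2) k of_nat_eq_imp_eq_below_CHAR[of "Suc k" 0] by fastforce
  ultimately show False
    using k by (metis leading_coeff_0_iff degree_0 mult_eq_0_iff nat.distinct(1))
qed

lemma partials_0_imp_const3:
  fixes h :: "'k::field poly3"
  assumes "dx h = 0" "dy h = 0" "dz h = 0" "total_degree_le h n" "n < CHAR('k)"
  shows "\<exists>k. h = const3 k"
proof (rule degrees_0_imp_const3)
  note degrees = total_degree_le_degrees[OF assms(4)]
  show h: "degree h = 0"
    using assms degrees by (intro pderiv_eq_0_imp_degree_0) (auto simp: dz_def intro: le_less_trans)
  then obtain g where g: "h = [:g:]"
    using degree_eq_zeroE by blast
  show "degree (coeff h 0) = 0"
    using assms degrees[of 0] g
    by (intro pderiv_eq_0_imp_degree_0) (auto simp: dy_def map_poly_pCons intro: le_less_trans)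
  then obtain e where e: "g = [:e:]"
    using g degree_eq_zeroE by auto
  show "degree (coeff (coeff h 0) 0) = 0"
    using assms degrees[of 0 0] g e
    by (intro pderiv_eq_0_imp_degree_0) (auto simp: dx_def map_poly_pCons intro: le_less_trans)
qed

lemma coeff_mult_of_degrees_le:
  assumes "degree p \<le> m" "degree q \<le> n"
  shows "coeff (p * q) (m + n) = coeff p m * coeff q n"
proof -
  have "coeff (p * q) (m + n) = (\<Sum>i\<le>m + n. if i = m then coeff p m * coeff q n else 0)"
    unfolding coeff_mult using assms by (intro sum.cong) (auto simp: coeff_eq_0 neq_iff)
  then show ?thesis
    by simp
qed

lemma coeff_pderiv_mult_top:
  fixes p q :: "'a::idom poly"
  assumes "0 < degree p + degree q"
  shows "coeff (pderiv p * q) (degree p + degree q - 1) = of_nat (degree p) * lead_coeff p * lead_coeff q"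
proof (cases "degree p = 0")
  case True
  then have "pderiv p = 0"
    by (metis degree_eq_zeroE pderiv_pCons pderiv_0 pCons_0_0 add_0)
  then show ?thesis
    using True by simp
next
  case False
  have "degree (pderiv p) \<le> degree p - 1"
    by (intro degree_le allI impI) (simp add: coeff_pderiv coeff_eq_0)
  then have "coeff (pderiv p * q) (degree p - 1 + degree q) = coeff (pderiv p) (degree p - 1) * lead_coeff q"
    by (rule coeff_mult_of_degrees_le) simp
  then show ?thesis
    using False by (simp add: coeff_pderiv flip: of_nat_Suc)
qed

lemma wronskian_eq_0_imp_degree_eq:
  fixes g h :: "'k::field poly"
  assumes "pderiv g * h = g * pderiv h" "g \<noteq> 0" "h \<noteq> 0" "degree g < CHAR('k)" "degree h < CHAR('k)"
  shows "degree g = degree h"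
proof (rule ccontr)
  assume "degree g \<noteq> degree h"
  then have pos: "0 < degree g + degree h"
    by auto
  have "of_nat (degree g) * lead_coeff g * lead_coeff h = of_nat (degree h) * lead_coeff h * lead_coeff g"
    using coeff_pderiv_mult_top[OF pos] coeff_pderiv_mult_top[of h g] pos assms(1)
    by (auto simp: mult.commute add.commute)
  then have "of_nat (degree g) = (of_nat (degree h) :: 'k)"
    using assms(2,3) by (simp add: mult.assoc mult.commute[of "lead_coeff h"])
  then show False
    using \<open>degree g \<noteq> degree h\<close> assms(4,5) of_nat_eq_imp_eq_below_CHAR by blast
qed

lemma wronskian_eq_0_imp_smult:
  fixes g h :: "'k::field poly"
  assumes wronskian: "pderiv g * h = g * pderiv h" and h: "h \<noteq> 0"
    and degrees: "degree g < CHAR('k)" "degree h < CHAR('k)"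
  shows "\<exists>k. g = smult k h"
proof -
  define k where "k = lead_coeff g / lead_coeff h"
  define r where "r = g - smult k h"
  have "r = 0"
  proof (rule ccontr)
    assume r: "r \<noteq> 0"
    then have "g \<noteq> 0"
      by (auto simp: r_def k_def)
    then have gh: "degree g = degree h"
      by (rule wronskian_eq_0_imp_degree_eq[OF wronskian _ h degrees])
    have deg_r: "degree r \<le> degree h"
      using gh by (simp add: r_def degree_diff_le)
    have "pderiv r * h = r * pderiv h"
      using wronskian by (simp add: r_def pderiv_diff pderiv_smult algebra_simps)
    then have "degree r = degree h"
      using r h deg_r degrees by (intro wronskian_eq_0_imp_degree_eq) auto
    moreover have "coeff r (degree h) = 0"
      using h gh by (simp add: r_def k_def)
    ultimately show False
      using r by (metis leading_coeff_0_iff)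
  qed
  then show ?thesis
    by (auto simp: r_def)
qed

text \<open>With \<open>w = (p / q)' q\<^sup>2\<close>, the hypothesis says that \<open>(w / q\<^sup>2)' = 0\<close>.\<close>

lemma quotient_deriv2_eq_0_imp_affine:
  fixes p q :: "'k::field poly"
  defines "w \<equiv> q * pderiv p - p * pderiv q"
  assumes q: "q \<noteq> 0" and deriv2: "q * pderiv w = 2 * pderiv q * w"
    and degrees: "degree p \<le> n" "degree q \<le> n" "n + 1 < CHAR('k)" "2 * n < CHAR('k)"
  shows "\<exists>\<mu> \<kappa>. p = [:\<mu>, \<kappa>:] * q"
proof -
  have degree_mult: "degree (a * b) \<le> 2 * n" if "degree a \<le> n" "degree b \<le> n" for a b :: "'k poly"
    using degree_mult_le[of a b] that by linarith
  have degree_pderiv: "degree (pderiv a) \<le> degree a" for a :: "'k poly"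
    by (intro degree_le allI impI) (simp add: coeff_pderiv coeff_eq_0)
  have "degree w \<le> 2 * n"
    unfolding w_def using degrees(1,2)
    by (intro degree_diff_le degree_mult) (auto intro: order_trans[OF degree_pderiv])
  moreover have "pderiv w * (q * q) = w * pderiv (q * q)"
    using deriv2 by (simp add: pderiv_mult algebra_simps)
  moreover have "degree (q * q) \<le> 2 * n"
    using degrees by (intro degree_mult)
  ultimately have "\<exists>\<kappa>. w = smult \<kappa> (q * q)"
    using q degrees by (intro wronskian_eq_0_imp_smult) auto
  then obtain \<kappa> where \<kappa>: "w = smult \<kappa> (q * q)"
    by blast
  define r where "r = p - [:0, \<kappa>:] * q"
  have "pderiv r * q - r * pderiv q = w - smult \<kappa> (q * q)"
    by (simp add: r_def pderiv_diff pderiv_mult pderiv_pCons pderiv_smult w_def algebra_simps)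
  then have "pderiv r * q = r * pderiv q"
    using \<kappa> by simp
  moreover have "degree ([:0, \<kappa>:] * q) \<le> n + 1"
    using degree_mult_le[of "[:0, \<kappa>:]" q] degrees(2) degree_pCons_le[of 0 "[:\<kappa>:]"] by simp
  then have "degree r \<le> n + 1"
    unfolding r_def using degrees(1) by (intro degree_diff_le) auto
  ultimately have "\<exists>\<mu>. r = smult \<mu> q"
    using q degrees by (intro wronskian_eq_0_imp_smult) auto
  then obtain \<mu> where "r = smult \<mu> q"
    by blast
  then have "p = [:\<mu>, \<kappa>:] * q"
    by (simp add: r_def algebra_simps)
  then show ?thesis
    by blast
qed

subsection \<open>Linear systems\<close>

lemma exists_nontrivial_solution:
  fixes M :: "'j \<Rightarrow> 'i \<Rightarrow> 'k::field"
  assumes "finite J" "finite I" "card J < card I"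
  shows "\<exists>c. (\<exists>i\<in>I. c i \<noteq> 0) \<and> (\<forall>j\<in>J. (\<Sum>i\<in>I. c i * M j i) = 0)"
proof -
  interpret vector_space "\<lambda>k (f :: 'j \<Rightarrow> 'k) j. k * f j"
    by unfold_locales (simp_all add: fun_eq_iff algebra_simps)
  have sum_apply: "sum f A j = (\<Sum>x\<in>A. f x j)" for f :: "'b \<Rightarrow> 'j \<Rightarrow> 'k" and A j
    by (induction A rule: infinite_finite_induct) auto
  define column where "column i = (\<lambda>j. if j \<in> J then M j i else 0)" for i
  show ?thesis
  proof (cases "inj_on column I")
    case True
    define unit where "unit j = (\<lambda>j'. if j' = j then 1 else 0 :: 'k)" for j :: 'j
    have column_eq: "column i = (\<Sum>j\<in>J. (\<lambda>j'. M j i * unit j j'))" for i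
      using \<open>finite J\<close> by (auto simp: fun_eq_iff sum_apply column_def unit_def if_distrib cong: if_cong)
    have "column i \<in> span (unit ` J)" for i
      unfolding column_eq by (intro span_sum span_scale span_base imageI)
    then have "column ` I \<subseteq> span (unit ` J)"
      by blast
    then have "dependent (column ` I)"
      using independent_span_bound[of "unit ` J" "column ` I"] card_image_le[of J unit]
        card_image[OF True] assms
      by auto
    then obtain u where u: "\<exists>v\<in>column ` I. u v \<noteq> 0" "(\<Sum>v\<in>column ` I. (\<lambda>j. u v * v j)) = 0"
      using dependent_finite[of "column ` I"] \<open>finite I\<close> by auto
    have "(\<Sum>i\<in>I. u (column i) * M j i) = 0" if "j \<in> J" for j
      using fun_cong[OF u(2), of j] that unfolding sum_apply sum.reindex[OF True] o_def
      by (simp add: column_def)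
    then show ?thesis
      using u(1) by (intro exI[of _ "\<lambda>i. u (column i)"]) auto
  next
    case False
    then obtain i i' where i: "i \<in> I" "i' \<in> I" "i \<noteq> i'" "column i = column i'"
      by (auto simp: inj_on_def)
    define c where "c = (\<lambda>_. 0 :: 'k)(i := 1, i' := - 1)"
    have "(\<Sum>x\<in>I. c x * M j x) = 0" if "j \<in> J" for j
    proof -
      have "(\<Sum>x\<in>I. c x * M j x) = (\<Sum>x\<in>{i, i'}. c x * M j x)"
        using i \<open>finite I\<close> by (intro sum.mono_neutral_right) (auto simp: c_def)
      then show ?thesis
        using i(3) fun_cong[OF i(4), of j] that by (simp add: c_def column_def)
    qed
    then show ?thesis
      using i by (intro exI[of _ c]) (auto simp: c_def)
  qed
qed

section \<open>Lines in isotropic directions\<close>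

text \<open>The triple \<open>(\<beta>, b, e)\<close> stands for the line through \<open>(e + \<beta> b, b, 0)\<close> with the
  isotropic direction \<open>(\<beta>\<^sup>2, \<beta>, 1)\<close>, and for the point \<open>(1, \<beta>, b, e)\<close> of projective space. Two
  lines of different slopes meet iff the points are orthogonal for the standard symplectic form.\<close>

type_synonym 'k line = "'k \<times> 'k \<times> 'k"

definition slope :: "'k line \<Rightarrow> 'k" where "slope l = fst l"
definition yint :: "'k line \<Rightarrow> 'k" where "yint l = fst (snd l)"

definition line_symp :: "'k::field line \<Rightarrow> 'k line \<Rightarrow> 'k" where
  "line_symp = (\<lambda>(\<beta>, b, e) (\<beta>', b', e'). e - b * \<beta>' + \<beta> * b' - e')"

definition on_line :: "'k::field line \<Rightarrow> 'k poly3 \<Rightarrow> 'k poly" where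
  "on_line = (\<lambda>(\<beta>, b, e). subst3 [:e + \<beta> * b, \<beta>\<^sup>2:] [:b, \<beta>:] [:0, 1:])"

definition meet_at :: "'k::field line \<Rightarrow> 'k line \<Rightarrow> 'k" where
  "meet_at l m = (yint l - yint m) / (slope m - slope l)"

interpretation on_line: comm_ring_hom "on_line l" for l
  by (cases l) (simp add: on_line_def subst3.comm_ring_hom_axioms)

lemma on_line_const3 [simp]: "on_line l (const3 k) = [:k:]"
  by (auto simp: on_line_def split: prod.split)

lemma degree_on_line_le: "total_degree_le h n \<Longrightarrow> degree (on_line l h) \<le> n"
  by (auto simp: on_line_def split: prod.split intro!: degree_subst3_le)

lemma meet_at_mult: "slope l \<noteq> slope m \<Longrightarrow> meet_at l m * (slope m - slope l) = yint l - yint m"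
  by (simp add: meet_at_def)

lemma poly_on_line_meet_at:
  assumes "line_symp l m = 0" "slope l \<noteq> slope m"
  shows "poly (on_line l h) (meet_at l m) = poly (on_line m h) (meet_at l m)"
proof -
  obtain \<beta> b e \<beta>' b' e' where l: "l = (\<beta>, b, e)" and m: "m = (\<beta>', b', e')"
    by (cases l; cases m)
  define u where "u = meet_at l m"
  have symp: "e - b * \<beta>' + \<beta> * b' - e' = 0" and u: "u * (\<beta>' - \<beta>) = b - b'"
    using assms meet_at_mult[of l m] by (auto simp: l m u_def line_symp_def slope_def yint_def)
  have y: "b + \<beta> * u = b' + \<beta>' * u"
    using u by (simp add: algebra_simps)
  have "(e + \<beta> * b + \<beta>\<^sup>2 * u) - (e' + \<beta>' * b' + \<beta>'\<^sup>2 * u)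
      = (e - b * \<beta>' + \<beta> * b' - e') + (\<beta> + \<beta>') * ((b - b') - u * (\<beta>' - \<beta>))"
    by (simp add: algebra_simps power2_eq_square)
  then have x: "e + \<beta> * b + \<beta>\<^sup>2 * u = e' + \<beta>' * b' + \<beta>'\<^sup>2 * u"
    using symp u by simp
  show ?thesis
    unfolding u_def[symmetric] using x y by (simp add: l m on_line_def poly_subst3 mult.commute)
qed

lemma meet_at_eq_imp_line_symp_eq_0:
  assumes "line_symp l m = 0" "slope l \<noteq> slope m" "line_symp l m' = 0" "slope l \<noteq> slope m'"
    and "meet_at l m = meet_at l m'"
  shows "line_symp m m' = 0"
proof -
  obtain \<beta> b e \<beta>1 b1 e1 \<beta>2 b2 e2 where l: "l = (\<beta>, b, e)" and m: "m = (\<beta>1, b1, e1)"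
    and m': "m' = (\<beta>2, b2, e2)"
    by (cases l; cases m; cases m')
  define u where "u = meet_at l m"
  have "u * (\<beta>1 - \<beta>) = b - b1" "u * (\<beta>2 - \<beta>) = b - b2"
    using assms meet_at_mult[of l m] meet_at_mult[of l m'] by (simp_all add: l m m' u_def slope_def yint_def)
  then have b: "b1 = b - u * (\<beta>1 - \<beta>)" "b2 = b - u * (\<beta>2 - \<beta>)"
    by auto
  have e: "e1 = e - b * \<beta>1 + \<beta> * b1" "e2 = e - b * \<beta>2 + \<beta> * b2"
    using assms(1,3) by (auto simp: l m m' line_symp_def algebra_simps)
  show ?thesis
    by (simp add: m m' line_symp_def e b algebra_simps)
qed

subsection \<open>Surfaces through given lines\<close>

definition monom3 :: "nat \<Rightarrow> nat \<Rightarrow> nat \<Rightarrow> 'k::field poly3" where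
  "monom3 i j k = monom (monom (monom 1 i) j) k"

lemma total_degree_le_monom3: "total_degree_le (monom3 i j k :: 'k::field poly3) (i + j + k)"
proof -
  have "[:[:[:0, 1:]:]:] ^ i = ([:[:monom 1 i:]:] :: 'k poly3)"
    by (induction i) (simp_all add: monom_Suc monom_0 flip: one_pCons)
  moreover have "[:[:0, 1:]:] ^ j = ([:monom 1 j:] :: 'k poly3)"
    by (induction j) (simp_all add: monom_Suc monom_0 flip: one_pCons)
  moreover have "[:0, 1:] ^ k = (monom 1 k :: 'k poly3)"
    by (induction k) (simp_all add: monom_Suc monom_0 flip: one_pCons)
  ultimately have "monom3 i j k = [:[:[:0, 1:]:]:] ^ i * [:[:0, 1:]:] ^ j * ([:0, 1:] ^ k :: 'k poly3)"
    by (simp add: monom3_def smult_monom)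
  moreover have "total_degree_le ([:[:[:0, 1:]:]:] ^ i * [:[:0, 1:]:] ^ j * ([:0, 1:] ^ k :: 'k poly3))
      (i * Suc 0 + j * Suc 0 + k * Suc 0)"
    by (intro total_degree_le.mult total_degree_le_power total_degree_le.intros)
  ultimately show ?thesis
    by simp
qed

lemma coeff_monom3:
  "coeff (coeff (coeff (const3 c * monom3 i' j' k') k) j) i = (if (i', j', k') = (i, j, k) then c else 0)"
  by (auto simp: monom3_def const3_def smult_monom)

text \<open>The \<open>(m + 1)\<^sup>3\<close> monomials of degree at most \<open>m\<close> in each variable leave a solution to the
  \<open>3 m + 1\<close> equations for each line.\<close>

lemma exists_poly3_vanishing_on_lines:
  fixes A :: "'k::field line set"
  assumes A: "finite A" and m: "3 * card A \<le> (m + 1)\<^sup>2"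
  shows "\<exists>f. f \<noteq> 0 \<and> total_degree_le f (3 * m) \<and> (\<forall>l\<in>A. on_line l f = 0)"
proof -
  define I where "I = {..m} \<times> {..m} \<times> {..m}"
  define mon :: "nat \<times> nat \<times> nat \<Rightarrow> 'k poly3" where "mon = (\<lambda>(i, j, k). monom3 i j k)"
  define M where "M = (\<lambda>(l, r) x. coeff (on_line l (mon x)) r)"
  have "card (A \<times> {..3 * m}) = card A * (3 * m + 1)"
    by (simp add: card_cartesian_product)
  also have "\<dots> < (m + 1)\<^sup>2 * (m + 1)"
  proof (cases "card A = 0")
    case False
    then have "card A * (3 * m + 1) < card A * (3 * (m + 1))"
      by (intro mult_strict_left_mono) auto
    also have "\<dots> \<le> (m + 1)\<^sup>2 * (m + 1)"
      using mult_le_mono1[OF m, of "m + 1"] by (simp add: mult.commute mult.left_commute)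
    finally show ?thesis .
  qed simp
  also have "\<dots> = card I"
    by (simp add: I_def card_cartesian_product power2_eq_square)
  finally obtain c where c: "\<exists>x\<in>I. c x \<noteq> 0" "\<forall>j\<in>A \<times> {..3 * m}. (\<Sum>x\<in>I. c x * M j x) = 0"
    using exists_nontrivial_solution[of "A \<times> {..3 * m}" I M] A by (auto simp: I_def)
  define f where "f = (\<Sum>x\<in>I. const3 (c x) * mon x)"
  have "total_degree_le (mon x) (3 * m)" if "x \<in> I" for x
    using that by (auto simp: I_def mon_def intro: total_degree_le_mono[OF total_degree_le_monom3])
  then have degree: "total_degree_le f (3 * m)"
    unfolding f_def by (intro total_degree_le_sum total_degree_le_const3_mult)
  have "on_line l f = 0" if "l \<in> A" for l
  proof (rule poly_eqI)
    fix r
    have "coeff (on_line l f) r = (\<Sum>x\<in>I. c x * M (l, r) x)"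
      by (simp add: f_def on_line.sum on_line.mult M_def coeff_sum)
    then show "coeff (on_line l f) r = coeff 0 r"
      using c(2) that degree_on_line_le[OF degree, of l] by (cases "r \<le> 3 * m") (simp_all add: coeff_eq_0)
  qed
  moreover have "f \<noteq> 0"
  proof -
    obtain i j k where x: "(i, j, k) \<in> I" "c (i, j, k) \<noteq> 0"
      using c(1) by auto
    have "coeff (coeff (coeff f k) j) i = (\<Sum>x\<in>I. if x = (i, j, k) then c x else 0)"
      unfolding f_def coeff_sum mon_def by (intro sum.cong) (auto simp: coeff_monom3 split: if_splits)
    then show ?thesis
      using x by (auto simp: I_def)
  qed
  ultimately show ?thesis
    using degree by blast
qed

subsection \<open>Derivatives along lines\<close>

definition ddir :: "'k::field \<Rightarrow> 'k poly3 \<Rightarrow> 'k poly3" where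
  "ddir \<beta> h = const3 (\<beta>\<^sup>2) * dx h + const3 \<beta> * dy h + dz h"

text \<open>Differentiates \<open>ddir \<beta>\<close> with respect to \<open>\<beta>\<close>.\<close>

definition ddir' :: "'k::field \<Rightarrow> 'k poly3 \<Rightarrow> 'k poly3" where
  "ddir' \<beta> h = const3 (2 * \<beta>) * dx h + dy h"

interpretation ddir: derivation "ddir \<beta>" for \<beta>
  unfolding ddir_def
  by (intro derivation_add derivation_scale dx.derivation_axioms dy.derivation_axioms dz.derivation_axioms)

interpretation ddir': derivation "ddir' \<beta>" for \<beta>
  unfolding ddir'_def
  by (intro derivation_add derivation_scale dx.derivation_axioms dy.derivation_axioms)

interpretation const3: comm_ring_hom const3
  by unfold_locales (simp_all add: const3_add const3_mult, simp add: const3_def one_pCons)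

lemma ddir_const3_mult: "dx (const3 k * h) = const3 k * dx h" "ddir' \<beta> (const3 k * h) = const3 k * ddir' \<beta> h"
  "ddir \<beta> (const3 k * h) = const3 k * ddir \<beta> h"
  by (simp_all add: ddir_def ddir'_def dx.mult dy.mult dz.mult algebra_simps)

lemma ddir_commute: "ddir' \<beta> (dx h) = dx (ddir' \<beta> h)" "ddir \<beta> (dx h) = dx (ddir \<beta> h)"
  "ddir \<beta> (ddir' \<beta> h) = ddir' \<beta> (ddir \<beta> h)"
  by (simp_all add: ddir_def ddir'_def dx.add dx.mult dy.add dy.mult dz.add dz.mult dx_dy dx_dz dy_dz
      algebra_simps)

lemma total_degree_le_ddir:
  assumes "total_degree_le g n"
  shows "total_degree_le (ddir' \<beta> g) (n - 1)" "total_degree_le (ddir \<beta> g) (n - 1)"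
  unfolding ddir_def ddir'_def using total_degree_le_partial[OF assms]
  by (auto intro!: total_degree_le.add total_degree_le_const3_mult)

lemma ddir_shift: "ddir (\<beta> + t) h = const3 (t\<^sup>2) * dx h + const3 t * ddir' \<beta> h + ddir \<beta> h"
  by (simp add: ddir_def ddir'_def const3.simps algebra_simps power2_eq_square)

lemma ddir_ddir_shift:
  "ddir (\<beta> + t) (ddir (\<beta> + t) h) = const3 (t ^ 4) * dx (dx h) + const3 (t ^ 3) * (2 * dx (ddir' \<beta> h))
     + const3 (t\<^sup>2) * (2 * dx (ddir \<beta> h) + ddir' \<beta> (ddir' \<beta> h)) + const3 t * (2 * ddir' \<beta> (ddir \<beta> h))
     + ddir \<beta> (ddir \<beta> h)"
  unfolding ddir_shift dx.add ddir'.add ddir.add ddir_const3_mult ddir_commute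
  by (simp add: const3.simps algebra_simps power2_eq_square power3_eq_cube power4_eq_xxxx)

lemma pderiv_on_line: "pderiv (on_line l h) = on_line l (ddir (slope l) h)"
  by (cases l) (simp add: on_line.simps ddir_def, simp add: on_line_def slope_def pderiv_subst3 pderiv_pCons)

lemma on_line_ddir_eq_0:
  assumes "on_line l f = 0"
  shows "on_line l (ddir (slope l) f) = 0" "on_line l (ddir (slope l) (ddir (slope l) f)) = 0"
  using assms by (simp_all flip: pderiv_on_line)

subsection \<open>The second derivative modulo the first\<close>

text \<open>\<open>f\<^sub>1\<^sup>3\<close> times \<open>c\<^sub>4 t\<^sup>4 + c\<^sub>3 t\<^sup>3 + c\<^sub>2 t\<^sup>2 + c\<^sub>1 t + c\<^sub>0\<close> leaves the remainder
  \<open>quartic_rem1 t + quartic_rem0\<close> on division by \<open>f\<^sub>1 t\<^sup>2 + f\<^sub>2 t + f\<^sub>3\<close>, and \<open>quartic_quot0\<close> is the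
  constant coefficient of the quotient.\<close>

definition quartic_quot0 :: "'r::comm_ring_1 \<Rightarrow> 'r \<Rightarrow> 'r \<Rightarrow> 'r \<Rightarrow> 'r \<Rightarrow> 'r \<Rightarrow> 'r" where
  "quartic_quot0 f1 f2 f3 c4 c3 c2 = c4 * (f2\<^sup>2 - f1 * f3) - c3 * f1 * f2 + c2 * f1\<^sup>2"

definition quartic_rem0 :: "'r::comm_ring_1 \<Rightarrow> 'r \<Rightarrow> 'r \<Rightarrow> 'r \<Rightarrow> 'r \<Rightarrow> 'r \<Rightarrow> 'r \<Rightarrow> 'r" where
  "quartic_rem0 f1 f2 f3 c4 c3 c2 c0 = f1 ^ 3 * c0 - f3 * quartic_quot0 f1 f2 f3 c4 c3 c2"

definition quartic_rem1 :: "'r::comm_ring_1 \<Rightarrow> 'r \<Rightarrow> 'r \<Rightarrow> 'r \<Rightarrow> 'r \<Rightarrow> 'r \<Rightarrow> 'r \<Rightarrow> 'r" where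
  "quartic_rem1 f1 f2 f3 c4 c3 c2 c1
    = f1 ^ 3 * c1 - f2 * quartic_quot0 f1 f2 f3 c4 c3 c2 - f3 * f1 * (f1 * c3 - c4 * f2)"

lemma quartic_mod_quadratic:
  "quartic_rem1 f1 f2 f3 c4 c3 c2 c1 * t + quartic_rem0 f1 f2 f3 c4 c3 c2 c0
    = f1 ^ 3 * (c4 * t ^ 4 + c3 * t ^ 3 + c2 * t\<^sup>2 + c1 * t + c0)
    - (f1 * t\<^sup>2 + f2 * t + f3) * (f1\<^sup>2 * c4 * t\<^sup>2 + f1 * (f1 * c3 - c4 * f2) * t + quartic_quot0 f1 f2 f3 c4 c3 c2)"
  by (simp add: quartic_rem0_def quartic_rem1_def quartic_quot0_def algebra_simps
      power2_eq_square power3_eq_cube power4_eq_xxxx)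

lemma quartic_rem_eq_0:
  fixes t :: "'k::field"
  assumes "t \<noteq> t'" "f1 * t\<^sup>2 + f2 * t + f3 = 0" "f1 * t'\<^sup>2 + f2 * t' + f3 = 0"
    and "c4 * t ^ 4 + c3 * t ^ 3 + c2 * t\<^sup>2 + c1 * t + c0 = 0"
    and "c4 * t' ^ 4 + c3 * t' ^ 3 + c2 * t'\<^sup>2 + c1 * t' + c0 = 0"
  shows "quartic_rem1 f1 f2 f3 c4 c3 c2 c1 = 0" (is "?r1 = 0")
    and "quartic_rem0 f1 f2 f3 c4 c3 c2 c0 = 0" (is "?r0 = 0")
proof -
  have t: "?r1 * t + ?r0 = 0" and t': "?r1 * t' + ?r0 = 0"
    unfolding quartic_mod_quadratic using assms by simp_all
  have "?r1 * (t - t') = (?r1 * t + ?r0) - (?r1 * t' + ?r0)"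
    by (simp only: algebra_simps)
  then show r1: "?r1 = 0"
    using t t' \<open>t \<noteq> t'\<close> by simp
  show "?r0 = 0"
    using t unfolding r1 by simp
qed

lemma (in comm_ring_hom) quartic_rem:
  "h (quartic_quot0 f1 f2 f3 c4 c3 c2) = quartic_quot0 (h f1) (h f2) (h f3) (h c4) (h c3) (h c2)"
  "h (quartic_rem0 f1 f2 f3 c4 c3 c2 c0) = quartic_rem0 (h f1) (h f2) (h f3) (h c4) (h c3) (h c2) (h c0)"
  "h (quartic_rem1 f1 f2 f3 c4 c3 c2 c1) = quartic_rem1 (h f1) (h f2) (h f3) (h c4) (h c3) (h c2) (h c1)"
  by (simp_all add: quartic_quot0_def quartic_rem0_def quartic_rem1_def simps)

lemma total_degree_le_quartic_rem:
  assumes "total_degree_le f1 n" "total_degree_le f2 n" "total_degree_le f3 n" "total_degree_le c4 n"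
    "total_degree_le c3 n" "total_degree_le c2 n" "total_degree_le c n"
  shows "total_degree_le (quartic_rem0 f1 f2 f3 c4 c3 c2 c) (4 * n)"
    and "total_degree_le (quartic_rem1 f1 f2 f3 c4 c3 c2 c) (4 * n)"
proof -
  have product: "total_degree_le (p * q * r * s) (4 * n)"
    if "total_degree_le p n" "total_degree_le q n" "total_degree_le r n" "total_degree_le s n" for p q r s
  proof -
    have "4 * n = n + n + n + n"
      by simp
    then show ?thesis
      using that by (simp only: total_degree_le.mult)
  qed
  have "quartic_rem0 f1 f2 f3 c4 c3 c2 c = f1 * f1 * f1 * c - (c4 * f2 * f2 * f3 - c4 * f1 * f3 * f3
      - c3 * f1 * f2 * f3 + c2 * f1 * f1 * f3)"
    by (simp add: quartic_rem0_def quartic_quot0_def algebra_simps power2_eq_square power3_eq_cube)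
  then show "total_degree_le (quartic_rem0 f1 f2 f3 c4 c3 c2 c) (4 * n)"
    using assms by (auto intro!: total_degree_le_diff total_degree_le.add product)
  have "quartic_rem1 f1 f2 f3 c4 c3 c2 c = f1 * f1 * f1 * c - (c4 * f2 * f2 * f2 - 2 * (c4 * f1 * f2 * f3)
      - c3 * f1 * f2 * f2 + c3 * f1 * f1 * f3 + c2 * f1 * f1 * f2)"
    by (simp add: quartic_rem1_def quartic_quot0_def algebra_simps power2_eq_square power3_eq_cube)
  then show "total_degree_le (quartic_rem1 f1 f2 f3 c4 c3 c2 c) (4 * n)"
    using assms
    by (auto intro!: total_degree_le_diff total_degree_le.add total_degree_le_numeral_mult product)
qed

definition surface_quot0 :: "'k::field \<Rightarrow> 'k poly3 \<Rightarrow> 'k poly3" where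
  "surface_quot0 \<beta> f = quartic_quot0 (dx f) (ddir' \<beta> f) (ddir \<beta> f)
    (dx (dx f)) (2 * dx (ddir' \<beta> f)) (2 * dx (ddir \<beta> f) + ddir' \<beta> (ddir' \<beta> f))"

definition surface_rem0 :: "'k::field \<Rightarrow> 'k poly3 \<Rightarrow> 'k poly3" where
  "surface_rem0 \<beta> f = quartic_rem0 (dx f) (ddir' \<beta> f) (ddir \<beta> f)
    (dx (dx f)) (2 * dx (ddir' \<beta> f)) (2 * dx (ddir \<beta> f) + ddir' \<beta> (ddir' \<beta> f)) (ddir \<beta> (ddir \<beta> f))"

definition surface_rem1 :: "'k::field \<Rightarrow> 'k poly3 \<Rightarrow> 'k poly3" where
  "surface_rem1 \<beta> f = quartic_rem1 (dx f) (ddir' \<beta> f) (ddir \<beta> f)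
    (dx (dx f)) (2 * dx (ddir' \<beta> f)) (2 * dx (ddir \<beta> f) + ddir' \<beta> (ddir' \<beta> f)) (2 * ddir' \<beta> (ddir \<beta> f))"

lemma total_degree_le_surface_rem:
  assumes "total_degree_le f d"
  shows "total_degree_le (surface_rem0 \<beta> f) (4 * (d - 1))" "total_degree_le (surface_rem1 \<beta> f) (4 * (d - 1))"
proof -
  have first: "total_degree_le (dx f) (d - 1)" "total_degree_le (ddir' \<beta> f) (d - 1)"
    "total_degree_le (ddir \<beta> f) (d - 1)"
    using total_degree_le_partial[OF assms] total_degree_le_ddir[OF assms] by auto
  have second: "total_degree_le (dx h) (d - 1)" "total_degree_le (ddir' \<beta> h) (d - 1)"
    "total_degree_le (ddir \<beta> h) (d - 1)"
    if "total_degree_le h (d - 1)" for h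
    using total_degree_le_partial(1)[OF that] total_degree_le_ddir[OF that, of \<beta>]
    by (meson diff_le_self total_degree_le_mono)+
  show "total_degree_le (surface_rem0 \<beta> f) (4 * (d - 1))" "total_degree_le (surface_rem1 \<beta> f) (4 * (d - 1))"
    unfolding surface_rem0_def surface_rem1_def
    by (intro total_degree_le_quartic_rem total_degree_le.add total_degree_le_numeral_mult first second)+
qed

lemma surface_rem_eq_0_at_meet:
  assumes meet: "line_symp l m = 0" "slope l \<noteq> slope m" and f: "on_line l f = 0" "on_line m f = 0"
  shows "poly (on_line l (surface_rem0 \<beta> f)) (meet_at l m) = 0"
    and "poly (on_line l (surface_rem1 \<beta> f)) (meet_at l m) = 0"
proof -
  define v where "v h = poly (on_line l h) (meet_at l m)" for h
  interpret v: comm_ring_hom v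
    by unfold_locales (simp_all add: v_def on_line.simps)
  have const: "v (const3 k) = k" for k
    by (simp add: v_def)
  have v_m: "v h = poly (on_line m h) (meet_at l m)" for h
    using poly_on_line_meet_at[OF meet] by (simp add: v_def)
  have "v (ddir (slope l) f) = 0" "v (ddir (slope l) (ddir (slope l) f)) = 0"
    using on_line_ddir_eq_0[OF f(1)] by (simp_all add: v_def)
  moreover have "v (ddir (slope m) f) = 0" "v (ddir (slope m) (ddir (slope m) f)) = 0"
    using on_line_ddir_eq_0[OF f(2)] by (simp_all add: v_m)
  ultimately have ddir_0: "v (ddir (\<beta> + t) f) = 0" "v (ddir (\<beta> + t) (ddir (\<beta> + t) f)) = 0"
    if "t = slope l - \<beta> \<or> t = slope m - \<beta>" for t
    using that by auto
  have roots: "v (dx f) * t\<^sup>2 + v (ddir' \<beta> f) * t + v (ddir \<beta> f) = 0"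
    "v (dx (dx f)) * t ^ 4 + v (2 * dx (ddir' \<beta> f)) * t ^ 3 + v (2 * dx (ddir \<beta> f) + ddir' \<beta> (ddir' \<beta> f)) * t\<^sup>2
      + v (2 * ddir' \<beta> (ddir \<beta> f)) * t + v (ddir \<beta> (ddir \<beta> f)) = 0"
    if "t = slope l - \<beta> \<or> t = slope m - \<beta>" for t
    using ddir_0[OF that] unfolding ddir_ddir_shift unfolding ddir_shift
    by (simp_all add: v.add v.mult const mult.commute)
  have "slope l - \<beta> \<noteq> slope m - \<beta>"
    using meet(2) by simp
  note rem_0 =
    quartic_rem_eq_0[OF this roots(1)[OF disjI1] roots(1)[OF disjI2] roots(2)[OF disjI1] roots(2)[OF disjI2],
      OF refl refl refl refl]
  show "poly (on_line l (surface_rem0 \<beta> f)) (meet_at l m) = 0"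
    unfolding v_def[symmetric] surface_rem0_def v.quartic_rem by (rule rem_0)
  show "poly (on_line l (surface_rem1 \<beta> f)) (meet_at l m) = 0"
    unfolding v_def[symmetric] surface_rem1_def v.quartic_rem by (rule rem_0)
qed

subsection \<open>Lines that meet many others\<close>

locale line_graph =
  fixes V :: "'v set" and adj :: "'v \<Rightarrow> 'v \<Rightarrow> bool" and line :: "'v \<Rightarrow> 'k::field line"
  assumes finite_vertices: "finite V"
    and adj_symp: "\<lbrakk>u \<in> V; v \<in> V; adj u v\<rbrakk> \<Longrightarrow> line_symp (line u) (line v) = 0"
    and adj_slope: "\<lbrakk>u \<in> V; v \<in> V; adj u v\<rbrakk> \<Longrightarrow> slope (line u) \<noteq> slope (line v)"
    and neighbours_skew: "\<lbrakk>v \<in> V; u \<in> V; w \<in> V; adj v u; adj v w; u \<noteq> w\<rbrakk> \<Longrightarrow> line_symp (line u) (line w) \<noteq> 0"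
begin

definition neighbours :: "'v \<Rightarrow> 'v set" where
  "neighbours v = {u \<in> V. adj v u}"

abbreviation meet :: "'v \<Rightarrow> 'v \<Rightarrow> 'k" where
  "meet v u \<equiv> meet_at (line v) (line u)"

definition vanishes :: "'k poly3 \<Rightarrow> bool" where
  "vanishes h \<longleftrightarrow> (\<forall>v\<in>V. on_line (line v) h = 0)"

lemma finite_neighbours: "finite (neighbours v)"
  using finite_vertices by (simp add: neighbours_def)

lemma neighbours_line:
  assumes "v \<in> V" "u \<in> neighbours v"
  shows "u \<in> V" "line_symp (line v) (line u) = 0" "slope (line v) \<noteq> slope (line u)"
  using assms adj_symp[of v u] adj_slope[of v u] by (auto simp: neighbours_def)

lemma inj_on_meet: "v \<in> V \<Longrightarrow> inj_on (meet v) (neighbours v)"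
proof (rule inj_onI, rule ccontr)
  fix u w
  assume v: "v \<in> V" and u: "u \<in> neighbours v" and w: "w \<in> neighbours v"
    and meet_eq: "meet v u = meet v w" and "u \<noteq> w"
  have "line_symp (line u) (line w) = 0"
    by (rule meet_at_eq_imp_line_symp_eq_0[OF neighbours_line(2,3)[OF v u] neighbours_line(2,3)[OF v w] meet_eq])
  then show False
    using v u w \<open>u \<noteq> w\<close> neighbours_skew by (auto simp: neighbours_def)
qed

lemma card_neighbours_roots_le:
  assumes "v \<in> V" "p \<noteq> 0"
  shows "card {u \<in> neighbours v. poly p (meet v u) = 0} \<le> degree p"
proof -
  have "card {u \<in> neighbours v. poly p (meet v u) = 0}
    = card (meet v ` {u \<in> neighbours v. poly p (meet v u) = 0})"
    by (intro card_image[symmetric] inj_on_subset[OF inj_on_meet[OF assms(1)]]) auto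
  also have "\<dots> \<le> card {x. poly p x = 0}"
    using poly_roots_finite[OF assms(2)] by (intro card_mono) auto
  also have "\<dots> \<le> degree p"
    using assms(2) by (rule card_poly_roots_bound)
  finally show ?thesis .
qed

lemma on_line_eq_0I:
  assumes v: "v \<in> V" and degree: "total_degree_le h n" "n < card (neighbours v)"
    and roots: "\<And>u. u \<in> neighbours v \<Longrightarrow> poly (on_line (line v) h) (meet v u) = 0"
  shows "on_line (line v) h = 0"
proof (rule ccontr)
  assume "on_line (line v) h \<noteq> 0"
  then have "card {u \<in> neighbours v. poly (on_line (line v) h) (meet v u) = 0} \<le> degree (on_line (line v) h)"
    by (rule card_neighbours_roots_le[OF v])
  also have "{u \<in> neighbours v. poly (on_line (line v) h) (meet v u) = 0} = neighbours v"
    using roots by auto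
  finally show False
    using degree degree_on_line_le[OF degree(1), of "line v"] by simp
qed

lemma vanishes_surface_rem:
  assumes f: "vanishes f" and degree: "total_degree_le f d" "\<And>v. v \<in> V \<Longrightarrow> 4 * (d - 1) < card (neighbours v)"
  shows "vanishes (surface_rem0 \<beta> f)" "vanishes (surface_rem1 \<beta> f)"
proof -
  have "poly (on_line (line v) (surface_rem0 \<beta> f)) (meet v u) = 0"
    "poly (on_line (line v) (surface_rem1 \<beta> f)) (meet v u) = 0" if "v \<in> V" "u \<in> neighbours v" for v u
    using f that neighbours_line[OF that] by (simp_all add: vanishes_def surface_rem_eq_0_at_meet)
  then show "vanishes (surface_rem0 \<beta> f)" "vanishes (surface_rem1 \<beta> f)"
    unfolding vanishes_def using on_line_eq_0I[OF _ total_degree_le_surface_rem(1)[OF degree(1)] degree(2)]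
      on_line_eq_0I[OF _ total_degree_le_surface_rem(2)[OF degree(1)] degree(2)] by blast+
qed

lemma tangent_at_meet:
  assumes f: "vanishes f" and vu: "v \<in> V" "u \<in> neighbours v"
  shows "(slope (line u) - slope (line v)) * poly (on_line (line v) (dx f)) (meet v u)
    + poly (on_line (line v) (ddir' (slope (line v)) f)) (meet v u) = 0"
proof -
  define t where "t = slope (line u) - slope (line v)"
  have "t \<noteq> 0" and slope: "slope (line u) = slope (line v) + t"
    using neighbours_line(3)[OF vu] by (simp_all add: t_def)
  have "on_line (line u) (ddir (slope (line v) + t) f) = 0" "on_line (line v) (ddir (slope (line v)) f) = 0"
    unfolding slope[symmetric] using f vu neighbours_line(1)[OF vu]
    by (auto simp: vanishes_def intro: on_line_ddir_eq_0)
  then have "poly (on_line (line v) (ddir (slope (line v) + t) f)) (meet v u) = 0"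
    "poly (on_line (line v) (ddir (slope (line v)) f)) (meet v u) = 0"
    by (simp_all add: poly_on_line_meet_at[OF neighbours_line(2,3)[OF vu]])
  then have "t * (t * poly (on_line (line v) (dx f)) (meet v u)
      + poly (on_line (line v) (ddir' (slope (line v)) f)) (meet v u)) = 0"
    unfolding ddir_shift by (simp add: on_line.simps algebra_simps power2_eq_square)
  then show ?thesis
    using \<open>t \<noteq> 0\<close> by (simp add: t_def)
qed

text \<open>A polynomial of least degree that vanishes on all of the lines has a partial derivative that
  does not.\<close>

lemma exists_surface_with_smooth_line:
  assumes V: "V \<noteq> {}" and f0: "f0 \<noteq> 0" "total_degree_le f0 D" "vanishes f0" and D: "D < CHAR('k)"
  shows "\<exists>f d v. d \<le> D \<and> total_degree_le f d \<and> vanishes f \<and> v \<in> V \<and>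
    (on_line (line v) (dx f) \<noteq> 0 \<or> on_line (line v) (dy f) \<noteq> 0 \<or> on_line (line v) (dz f) \<noteq> 0)"
proof -
  define Q where "Q d \<longleftrightarrow> (\<exists>f. f \<noteq> 0 \<and> total_degree_le f d \<and> vanishes f)" for d
  define d where "d = (LEAST d. Q d)"
  have "Q D"
    using f0 by (auto simp: Q_def)
  then have "d \<le> D" "Q d"
    by (auto simp: d_def intro: Least_le LeastI)
  then obtain f where f: "f \<noteq> 0" "total_degree_le f d" "vanishes f"
    by (auto simp: Q_def)
  have not_const: "f \<noteq> const3 k" for k
    using f(1,3) V by (auto simp: vanishes_def const3_def[of 0])
  then have "d \<noteq> 0"
    using total_degree_le_0_imp_const3 f(2) by metis
  have "\<exists>v\<in>V. on_line (line v) (dx f) \<noteq> 0 \<or> on_line (line v) (dy f) \<noteq> 0 \<or> on_line (line v) (dz f) \<noteq> 0"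
  proof (rule ccontr)
    assume "\<not> ?thesis"
    then have "vanishes (dx f)" "vanishes (dy f)" "vanishes (dz f)"
      by (auto simp: vanishes_def)
    moreover have "h = 0" if "vanishes h" "total_degree_le h (d - 1)" for h
    proof (rule ccontr)
      assume "h \<noteq> 0"
      then have "d \<le> d - 1"
        using that unfolding d_def by (intro Least_le) (auto simp: Q_def)
      then show False
        using \<open>d \<noteq> 0\<close> by simp
    qed
    ultimately have "dx f = 0" "dy f = 0" "dz f = 0"
      using total_degree_le_partial[OF f(2)] by blast+
    then show False
      using partials_0_imp_const3[OF _ _ _ f(2)] not_const D \<open>d \<le> D\<close> by fastforce
  qed
  then show ?thesis
    using f \<open>d \<le> D\<close> by blast
qed

end

locale smooth_line_on_surface = line_graph V adj line
  for V :: "'v set" and adj and line :: "'v \<Rightarrow> 'k::field line" +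
  fixes f :: "'k poly3" and d :: nat and v :: 'v
  assumes f: "vanishes f" and degree_f: "total_degree_le f d" and v: "v \<in> V"
    and many_neighbours: "u \<in> V \<Longrightarrow> 5 * d < card (neighbours u)"
    and smooth: "on_line (line v) (dx f) \<noteq> 0 \<or> on_line (line v) (dy f) \<noteq> 0 \<or> on_line (line v) (dz f) \<noteq> 0"
begin

definition \<beta> where "\<beta> = slope (line v)"

text \<open>By \<open>tangent_at_meet\<close>, the slope of a line that meets the line \<open>v\<close> is \<open>\<beta> - q / p\<close> at the meeting.\<close>

definition p where "p = on_line (line v) (dx f)"
definition q where "q = on_line (line v) (ddir' \<beta> f)"

lemma tangent: "u \<in> neighbours v \<Longrightarrow> (slope (line u) - \<beta>) * poly p (meet v u) + poly q (meet v u) = 0"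
  using tangent_at_meet[OF f v] by (simp add: p_def q_def \<beta>_def)

lemma neighbours_slope_nonzero: "u \<in> neighbours v \<Longrightarrow> slope (line u) - \<beta> \<noteq> 0"
  using neighbours_line(3)[OF v, of u] by (auto simp: \<beta>_def)

lemma on_line_ddir: "on_line (line v) (ddir \<beta> h) = pderiv (on_line (line v) h)"
  by (simp add: \<beta>_def pderiv_on_line)

lemma on_line_f: "on_line (line v) f = 0"
  using f v by (simp add: vanishes_def)

lemma degree_dx: "total_degree_le (dx f) (d - 1)" and degree_ddir': "total_degree_le (ddir' \<beta> f) (d - 1)"
  using total_degree_le_partial[OF degree_f] total_degree_le_ddir[OF degree_f] by auto

lemma degree_p: "degree p \<le> d - 1" and degree_q: "degree q \<le> d - 1"
  unfolding p_def q_def by (intro degree_on_line_le degree_dx degree_ddir')+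

lemma p_nonzero: "p \<noteq> 0"
proof
  assume "p = 0"
  then have x: "on_line (line v) (dx f) = 0"
    by (simp add: p_def)
  have "poly q (meet v u) = 0" if "u \<in> neighbours v" for u
    using tangent[OF that] \<open>p = 0\<close> by simp
  then have "q = 0"
    unfolding q_def using many_neighbours[OF v] by (intro on_line_eq_0I[OF v degree_ddir']) auto
  then have y: "on_line (line v) (dy f) = 0"
    using x by (simp add: q_def ddir'_def on_line.simps)
  have "on_line (line v) (ddir \<beta> f) = 0"
    by (simp add: on_line_ddir on_line_f)
  then have "on_line (line v) (dz f) = 0"
    using x y by (simp add: ddir_def on_line.simps)
  then show False
    using x y smooth by simp
qed

lemma q_nonzero: "q \<noteq> 0"
proof
  assume "q = 0"
  then have "poly p (meet v u) = 0" if "u \<in> neighbours v" for u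
    using tangent[OF that] neighbours_slope_nonzero[OF that] by simp
  then have "p = 0"
    unfolding p_def using many_neighbours[OF v] by (intro on_line_eq_0I[OF v degree_dx]) auto
  then show False
    using p_nonzero by simp
qed

lemma vanishes_rem: "vanishes (surface_rem0 \<beta> f)" "vanishes (surface_rem1 \<beta> f)"
proof -
  have "4 * (d - 1) < card (neighbours u)" if "u \<in> V" for u
    using many_neighbours[OF that] by simp
  then show "vanishes (surface_rem0 \<beta> f)" "vanishes (surface_rem1 \<beta> f)"
    using vanishes_surface_rem[OF f degree_f] by blast+
qed

lemma surface_rem0_tangent:
  "on_line (line v) (ddir' \<beta> f * dx (surface_rem0 \<beta> f) - dx f * ddir' \<beta> (surface_rem0 \<beta> f)) = 0"
proof (rule on_line_eq_0I[OF v])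
  show "5 * (d - 1) < card (neighbours v)"
    using many_neighbours[OF v] by simp
  have "total_degree_le (dx (surface_rem0 \<beta> f)) (4 * (d - 1))"
    "total_degree_le (ddir' \<beta> (surface_rem0 \<beta> f)) (4 * (d - 1))"
    using total_degree_le_partial(1) total_degree_le_ddir(1) total_degree_le_surface_rem(1)[OF degree_f, of \<beta>]
    by (meson diff_le_self total_degree_le_mono)+
  then have "total_degree_le (ddir' \<beta> f * dx (surface_rem0 \<beta> f)) (d - 1 + 4 * (d - 1))"
    "total_degree_le (dx f * ddir' \<beta> (surface_rem0 \<beta> f)) (d - 1 + 4 * (d - 1))"
    using degree_dx degree_ddir' by (blast intro: total_degree_le.mult)+
  then show "total_degree_le (ddir' \<beta> f * dx (surface_rem0 \<beta> f) - dx f * ddir' \<beta> (surface_rem0 \<beta> f)) (5 * (d - 1))"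
    by (rule total_degree_le_mono[OF total_degree_le_diff]) simp
next
  fix u
  assume u: "u \<in> neighbours v"
  define t where "t = slope (line u) - \<beta>"
  define eval where "eval h = poly (on_line (line v) h) (meet v u)" for h
  have "eval (ddir' \<beta> f) = - t * eval (dx f)"
    using tangent_at_meet[OF f v u] by (simp add: eval_def t_def \<beta>_def add_eq_0_iff algebra_simps)
  moreover have "eval (ddir' \<beta> (surface_rem0 \<beta> f)) = - t * eval (dx (surface_rem0 \<beta> f))"
    using tangent_at_meet[OF vanishes_rem(1) v u]
    by (simp add: eval_def t_def \<beta>_def add_eq_0_iff algebra_simps)
  moreover have "poly (on_line (line v) (ddir' \<beta> f * dx (surface_rem0 \<beta> f) - dx f * ddir' \<beta> (surface_rem0 \<beta> f))) (meet v u)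
      = eval (ddir' \<beta> f) * eval (dx (surface_rem0 \<beta> f)) - eval (dx f) * eval (ddir' \<beta> (surface_rem0 \<beta> f))"
    by (simp add: eval_def on_line.simps)
  ultimately show "poly (on_line (line v) (ddir' \<beta> f * dx (surface_rem0 \<beta> f)
      - dx f * ddir' \<beta> (surface_rem0 \<beta> f))) (meet v u) = 0"
    by simp
qed

definition w where "w = q * pderiv p - p * pderiv q"
definition g where "g = on_line (line v) (surface_quot0 \<beta> f)"

lemma q_mult_g: "q * g = 2 * pderiv q * p ^ 3"
proof -
  have "on_line (line v) (surface_rem1 \<beta> f) = p ^ 3 * (2 * pderiv q) - q * g"
    unfolding surface_rem1_def quartic_rem1_def surface_quot0_def[symmetric] g_def p_def q_def
    by (simp only: on_line.simps on_line_ddir on_line_f ddir_commute(3)[symmetric] pderiv_0 mult_zero_left diff_zero)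
  then show ?thesis
    using vanishes_rem(2) v by (simp add: vanishes_def algebra_simps)
qed

lemma on_line_derivation_surface_rem0:
  assumes "derivation D"
  shows "on_line (line v) (D (surface_rem0 \<beta> f)) = p ^ 3 * on_line (line v) (D (ddir \<beta> (ddir \<beta> f)))
    - g * on_line (line v) (D (ddir \<beta> f))"
proof -
  interpret D: derivation D by fact
  show ?thesis
    unfolding surface_rem0_def quartic_rem0_def surface_quot0_def[symmetric] g_def p_def
    by (simp only: D.diff D.mult on_line.simps on_line_ddir on_line_f pderiv_0 mult_zero_left mult_zero_right
        add_0_left add_0_right mult.commute)
qed

lemma p3_mult_pderiv_w: "p ^ 3 * pderiv w = g * w"
proof -
  have "on_line (line v) (dx (surface_rem0 \<beta> f)) = p ^ 3 * pderiv (pderiv p) - g * pderiv p"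
    by (simp only: on_line_derivation_surface_rem0[OF dx.derivation_axioms]
        ddir_commute(2)[symmetric] on_line_ddir p_def)
  moreover have "on_line (line v) (ddir' \<beta> (surface_rem0 \<beta> f)) = p ^ 3 * pderiv (pderiv q) - g * pderiv q"
    by (simp only: on_line_derivation_surface_rem0[OF ddir'.derivation_axioms]
        ddir_commute(3)[symmetric] on_line_ddir q_def)
  ultimately have "q * (p ^ 3 * pderiv (pderiv p) - g * pderiv p)
    = p * (p ^ 3 * pderiv (pderiv q) - g * pderiv q)"
    using surface_rem0_tangent by (simp add: on_line.simps p_def q_def)
  then show ?thesis
    by (simp add: w_def pderiv_diff pderiv_mult algebra_simps)
qed

lemma q_mult_pderiv_w: "q * pderiv w = 2 * pderiv q * w"
proof -
  have "p ^ 3 * (q * pderiv w) = q * g * w"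
    using p3_mult_pderiv_w by (simp add: algebra_simps)
  also have "\<dots> = p ^ 3 * (2 * pderiv q * w)"
    unfolding q_mult_g by (simp add: algebra_simps)
  finally show ?thesis
    using p_nonzero by simp
qed

lemma card_neighbours_le:
  assumes "2 * d < CHAR('k)"
  shows "\<exists>\<kappa> \<mu>. card (neighbours v) \<le> card {u \<in> neighbours v.
    \<kappa> * (yint (line v) - yint (line u)) + \<mu> * (slope (line u) - slope (line v)) + 1 = 0} + d"
proof -
  have "d - 1 + 1 < CHAR('k)"
  proof (cases "d = 0")
    case True
    then obtain k where "f = const3 k"
      using degree_f total_degree_le_0_imp_const3 by blast
    then show ?thesis
      using smooth by (simp add: on_line.zero)
  next
    case False
    then show ?thesis
      using assms by simp
  qed
  then have "\<exists>\<mu> \<kappa>. p = [:\<mu>, \<kappa>:] * q"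
    using assms q_mult_pderiv_w unfolding w_def
    by (intro quotient_deriv2_eq_0_imp_affine[OF q_nonzero _ degree_p degree_q]) auto
  then obtain \<mu> \<kappa> where p: "p = [:\<mu>, \<kappa>:] * q"
    by blast
  let ?P = "\<lambda>u. \<kappa> * (yint (line v) - yint (line u)) + \<mu> * (slope (line u) - slope (line v)) + 1 = 0"
  have "?P u" if u: "u \<in> neighbours v" and nonzero: "poly q (meet v u) \<noteq> 0" for u
  proof -
    define t where "t = slope (line u) - \<beta>"
    have meet: "t * meet v u = yint (line v) - yint (line u)"
      using meet_at_mult[OF neighbours_line(3)[OF v u]] by (simp add: t_def \<beta>_def mult.commute)
    have "(t * (\<mu> + \<kappa> * meet v u) + 1) * poly q (meet v u) = t * poly p (meet v u) + poly q (meet v u)"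
      by (simp add: p algebra_simps)
    also have "\<dots> = 0"
      using tangent[OF u] by (simp add: t_def)
    finally have "t * (\<mu> + \<kappa> * meet v u) + 1 = 0"
      using nonzero by simp
    then have "\<kappa> * (t * meet v u) + \<mu> * t + 1 = 0"
      by (simp add: algebra_simps)
    then show ?thesis
      unfolding meet by (simp add: t_def \<beta>_def)
  qed
  then have "card (neighbours v)
    \<le> card ({u \<in> neighbours v. ?P u} \<union> {u \<in> neighbours v. poly q (meet v u) = 0})"
    using finite_neighbours by (intro card_mono) auto
  also have "\<dots> \<le> card {u \<in> neighbours v. ?P u} + card {u \<in> neighbours v. poly q (meet v u) = 0}"
    by (rule card_Un_le)
  finally have "card (neighbours v) \<le> card {u \<in> neighbours v. ?P u} + d"
    using card_neighbours_roots_le[OF v q_nonzero] degree_q by linarith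
  then show ?thesis
    by blast
qed

end

theorem (in line_graph) exists_neighbours_in_plane:
  assumes "V \<noteq> {}" and f0: "f0 \<noteq> 0" "total_degree_le f0 D" "vanishes f0"
    and many: "\<And>v. v \<in> V \<Longrightarrow> 5 * D < card (neighbours v)" and char: "2 * D < CHAR('k)"
  shows "\<exists>v\<in>V. \<exists>\<kappa> \<mu>. card (neighbours v) \<le> card {u \<in> neighbours v.
    \<kappa> * (yint (line v) - yint (line u)) + \<mu> * (slope (line u) - slope (line v)) + 1 = 0} + D"
proof -
  obtain f d v where "d \<le> D" "total_degree_le f d" "vanishes f" and v: "v \<in> V"
    and "on_line (line v) (dx f) \<noteq> 0 \<or> on_line (line v) (dy f) \<noteq> 0 \<or> on_line (line v) (dz f) \<noteq> 0"
    using exists_surface_with_smooth_line[OF \<open>V \<noteq> {}\<close> f0] char by auto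
  moreover have "5 * d < card (neighbours u)" if "u \<in> V" for u
    using many[OF that] \<open>d \<le> D\<close> by linarith
  ultimately interpret smooth_line_on_surface V adj line f d v
    by unfold_locales
  obtain \<kappa> \<mu> where "card (neighbours v) \<le> card {u \<in> neighbours v.
      \<kappa> * (yint (line v) - yint (line u)) + \<mu> * (slope (line u) - slope (line v)) + 1 = 0} + d"
    using card_neighbours_le char \<open>d \<le> D\<close> by fastforce
  then show ?thesis
    using v \<open>d \<le> D\<close> by (intro bexI[of _ v] exI[of _ \<kappa>] exI[of _ \<mu>]) auto
qed

section \<open>Point-plane incidences\<close>

subsection \<open>Subgraphs of large minimum degree\<close>

definition edges :: "('a \<Rightarrow> 'b \<Rightarrow> bool) \<Rightarrow> 'a set \<Rightarrow> 'b set \<Rightarrow> nat" where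
  "edges E A B = (\<Sum>a\<in>A. card {b \<in> B. E a b})"

lemma edges_swap:
  assumes "finite A" "finite B"
  shows "edges E A B = edges (\<lambda>b a. E a b) B A"
  unfolding edges_def using assms by (intro sum_multicount_gen) auto

lemma edges_remove_vertex:
  assumes "finite V" "v \<in> V" and sym: "\<And>u v. R u v \<Longrightarrow> R v u"
  shows "edges R V V \<le> 2 * card {u \<in> V. R v u} + edges R (V - {v}) (V - {v})"
proof -
  have "edges R V V = card {u \<in> V. R v u} + (\<Sum>u\<in>V - {v}. card {w \<in> V. R u w})"
    unfolding edges_def using assms(1,2) by (simp add: sum.remove)
  also have "(\<Sum>u\<in>V - {v}. card {w \<in> V. R u w}) \<le> (\<Sum>u\<in>V - {v}. card {w \<in> V - {v}. R u w} + of_bool (R v u))"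
  proof (rule sum_mono)
    fix u
    have "{w \<in> V. R u w} \<subseteq> {w \<in> V - {v}. R u w} \<union> (if R v u then {v} else {})"
      using sym by auto
    then have "card {w \<in> V. R u w} \<le> card ({w \<in> V - {v}. R u w} \<union> (if R v u then {v} else {}))"
      using assms(1) by (intro card_mono) auto
    also have "\<dots> \<le> card {w \<in> V - {v}. R u w} + of_bool (R v u)"
      by (rule order_trans[OF card_Un_le]) auto
    finally show "card {w \<in> V. R u w} \<le> card {w \<in> V - {v}. R u w} + of_bool (R v u)" .
  qed
  also have "\<dots> = edges R (V - {v}) (V - {v}) + card {u \<in> V - {v}. R v u}"
    using assms(1) by (simp add: edges_def sum.distrib of_bool_def sum.If_cases Int_def)
  also have "card {u \<in> V - {v}. R v u} \<le> card {u \<in> V. R v u}"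
    using assms(1) by (intro card_mono) auto
  finally show ?thesis
    by simp
qed

lemma min_degree_subgraph:
  assumes "finite V" and sym: "\<And>u v. R u v \<Longrightarrow> R v u" and "2 * x * card V < edges R V V"
  shows "\<exists>W\<subseteq>V. W \<noteq> {} \<and> (\<forall>v\<in>W. x < card {u \<in> W. R v u})"
  using assms(1,3)
proof (induction V rule: finite_psubset_induct)
  case (psubset V)
  show ?case
  proof (cases "\<exists>v\<in>V. card {u \<in> V. R v u} \<le> x")
    case True
    then obtain v where v: "v \<in> V" "card {u \<in> V. R v u} \<le> x"
      by blast
    have "card V = Suc (card (V - {v}))"
      using v(1) psubset.hyps by (metis card.remove)
    then have "2 * x * card (V - {v}) < edges R (V - {v}) (V - {v})"
      using psubset.prems edges_remove_vertex[of V v R, OF psubset.hyps v(1) sym] v(2) by simp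
    then show ?thesis
      using psubset.IH[of "V - {v}"] v(1) by blast
  next
    case False
    moreover have "V \<noteq> {}"
      using psubset.prems by (auto simp: edges_def)
    ultimately show ?thesis
      by (intro exI[of _ V]) (auto simp: not_le)
  qed
qed

fun bipartite :: "('a \<Rightarrow> 'b \<Rightarrow> bool) \<Rightarrow> 'a + 'b \<Rightarrow> 'a + 'b \<Rightarrow> bool" where
  "bipartite E (Inl a) (Inr b) = E a b"
| "bipartite E (Inr b) (Inl a) = E a b"
| "bipartite E _ _ = False"

lemma bipartite_sym: "bipartite E u v \<Longrightarrow> bipartite E v u"
  by (cases u; cases v) auto

lemma bipartite_neighbours:
  "{u \<in> A <+> B. bipartite E (Inl a) u \<and> Q u} = Inr ` {b \<in> B. E a b \<and> Q (Inr b)}"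
  "{u \<in> A <+> B. bipartite E (Inr b) u \<and> Q u} = Inl ` {a \<in> A. E a b \<and> Q (Inl a)}"
  by auto

lemma edges_bipartite:
  assumes "finite A" "finite B"
  shows "edges (bipartite E) (A <+> B) (A <+> B) = 2 * edges E A B"
proof -
  have "edges (bipartite E) (A <+> B) (A <+> B) = edges E A B + edges (\<lambda>b a. E a b) B A"
    unfolding edges_def sum.Plus[OF assms]
    by (simp add: bipartite_neighbours[where Q = "\<lambda>_. True", simplified] card_image)
  then show ?thesis
    using edges_swap[OF assms] by simp
qed

subsection \<open>Properties that hold generically\<close>

inductive polyfun :: "(('i \<Rightarrow> 'k::field) \<Rightarrow> 'k) \<Rightarrow> bool" where
  const: "polyfun (\<lambda>_. c)"
| var: "polyfun (\<lambda>x. x i)"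
| add: "polyfun g \<Longrightarrow> polyfun h \<Longrightarrow> polyfun (\<lambda>x. g x + h x)"
| mult: "polyfun g \<Longrightarrow> polyfun h \<Longrightarrow> polyfun (\<lambda>x. g x * h x)"

lemma polyfun_uminus: "polyfun g \<Longrightarrow> polyfun (\<lambda>x. - g x)"
  using polyfun.mult[OF polyfun.const[of "-1"]] by fastforce

lemma polyfun_diff: "polyfun g \<Longrightarrow> polyfun h \<Longrightarrow> polyfun (\<lambda>x. g x - h x)"
  using polyfun.add[OF _ polyfun_uminus] by fastforce

lemmas polyfun_intros = polyfun.intros polyfun_uminus polyfun_diff

lemma polyfun_on_segment: "polyfun g \<Longrightarrow> \<exists>P. \<forall>z. g (\<lambda>i. x i + z * (y i - x i)) = poly P z"
proof (induction rule: polyfun.induct)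
  case (const c)
  then show ?case
    by (intro exI[of _ "[:c:]"]) simp
next
  case (var i)
  then show ?case
    by (intro exI[of _ "[:x i, y i - x i:]"]) (simp add: algebra_simps)
next
  case (add g h)
  then obtain P Q
    where "\<forall>z. g (\<lambda>i. x i + z * (y i - x i)) = poly P z" "\<forall>z. h (\<lambda>i. x i + z * (y i - x i)) = poly Q z"
    by blast
  then show ?case
    by (intro exI[of _ "P + Q"]) simp
next
  case (mult g h)
  then obtain P Q
    where "\<forall>z. g (\<lambda>i. x i + z * (y i - x i)) = poly P z" "\<forall>z. h (\<lambda>i. x i + z * (y i - x i)) = poly Q z"
    by blast
  then show ?case
    by (intro exI[of _ "P * Q"]) simp
qed

lemma polyfun_mult_nonzero:
  fixes g h :: "('i \<Rightarrow> 'k::field) \<Rightarrow> 'k"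
  assumes "infinite (UNIV :: 'k set)" "polyfun g" "polyfun h" "g x \<noteq> 0" "h y \<noteq> 0"
  shows "\<exists>z. g z * h z \<noteq> 0"
proof -
  obtain P where P: "\<And>z. g (\<lambda>i. x i + z * (y i - x i)) = poly P z"
    using polyfun_on_segment[OF assms(2)] by blast
  obtain Q where Q: "\<And>z. h (\<lambda>i. x i + z * (y i - x i)) = poly Q z"
    using polyfun_on_segment[OF assms(3)] by blast
  have "P \<noteq> 0" "Q \<noteq> 0"
    using P[of 0] Q[of 1] assms(4,5) by auto
  then have "finite {z. poly (P * Q) z = 0}"
    by (intro poly_roots_finite) simp
  then obtain z where "poly (P * Q) z \<noteq> 0"
    using assms(1) by (metis (mono_tags, lifting) UNIV_eq_I mem_Collect_eq)
  then show ?thesis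
    by (intro exI[of _ "\<lambda>i. x i + z * (y i - x i)"]) (simp add: P Q)
qed

definition generically :: "(('i \<Rightarrow> 'k::field) \<Rightarrow> bool) \<Rightarrow> bool" where
  "generically Q \<longleftrightarrow> (\<exists>g. polyfun g \<and> (\<exists>x. g x \<noteq> 0) \<and> (\<forall>x. g x \<noteq> 0 \<longrightarrow> Q x))"

lemma generically_nonzero: "polyfun g \<Longrightarrow> g x \<noteq> 0 \<Longrightarrow> generically (\<lambda>x. g x \<noteq> 0)"
  by (auto simp: generically_def)

lemma generically_ex: "generically Q \<Longrightarrow> \<exists>x. Q x"
  by (auto simp: generically_def)

lemma generically_conj:
  fixes Q Q' :: "('i \<Rightarrow> 'k::field) \<Rightarrow> bool"
  assumes "infinite (UNIV :: 'k set)" "generically Q" "generically Q'"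
  shows "generically (\<lambda>x. Q x \<and> Q' x)"
proof -
  obtain g x where g: "polyfun g" "g x \<noteq> 0" "\<And>x. g x \<noteq> 0 \<Longrightarrow> Q x"
    using assms(2) by (auto simp: generically_def)
  obtain h y where h: "polyfun h" "h y \<noteq> 0" "\<And>x. h x \<noteq> 0 \<Longrightarrow> Q' x"
    using assms(3) by (auto simp: generically_def)
  have "\<exists>z. g z * h z \<noteq> 0"
    by (rule polyfun_mult_nonzero[where g = g and h = h]) fact+
  then show ?thesis
    unfolding generically_def using g h by (intro exI[of _ "\<lambda>z. g z * h z"]) (auto intro: polyfun.mult)
qed

lemma generically_ball:
  fixes Q :: "'a \<Rightarrow> ('i \<Rightarrow> 'k::field) \<Rightarrow> bool"
  assumes "infinite (UNIV :: 'k set)" "finite A" "\<And>a. a \<in> A \<Longrightarrow> generically (Q a)"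
  shows "generically (\<lambda>x. \<forall>a\<in>A. Q a x)"
  using assms(2,3)
proof (induction A)
  case empty
  have "polyfun (\<lambda>_ :: 'i \<Rightarrow> 'k. 1 :: 'k)"
    by (rule polyfun.const)
  then show ?case
    by (auto simp: generically_def)
next
  case (insert a A)
  then show ?case
    using generically_conj[OF assms(1), of "Q a" "\<lambda>x. \<forall>a\<in>A. Q a x"] by simp
qed

subsection \<open>Generic coordinates\<close>

type_synonym 'k vec4 = "'k \<times> 'k \<times> 'k \<times> 'k"

fun dot4 :: "'k::field vec4 \<Rightarrow> 'k vec4 \<Rightarrow> 'k" where
  "dot4 (a, b, c, d) (a', b', c', d') = a * a' + b * b' + c * c' + d * d'"

fun scale4 :: "'k::field \<Rightarrow> 'k vec4 \<Rightarrow> 'k vec4" where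
  "scale4 k (a, b, c, d) = (k * a, k * b, k * c, k * d)"

fun symp4 :: "'k::field vec4 \<Rightarrow> 'k vec4 \<Rightarrow> 'k" where
  "symp4 (a, b, c, d) (a', b', c', d') = d * a' - c * b' + b * c' - a * d'"

fun minor12 :: "'k::field vec4 \<Rightarrow> 'k vec4 \<Rightarrow> 'k" where
  "minor12 (a, b, _) (a', b', _) = a * b' - b * a'"

definition indep4 :: "'k::field vec4 \<Rightarrow> 'k vec4 \<Rightarrow> bool" where
  "indep4 v w \<longleftrightarrow> w \<noteq> 0 \<and> (\<forall>k. v \<noteq> scale4 k w)"

text \<open>\<open>chart x\<close> and \<open>cochart x\<close> are linear maps that turn the standard pairing into a multiple of the
  symplectic form. The parameters \<open>x 0, \<dots>, x 4\<close> move the symplectic form, and \<open>x 5, \<dots>, x 8\<close> move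
  the Lagrangian plane at infinity, which makes all points and all pairs of points generic.\<close>

fun symp_move :: "(nat \<Rightarrow> 'k::field) \<Rightarrow> 'k vec4 \<Rightarrow> 'k vec4" where
  "symp_move x (a, b, c, d) =
    ((a + x 5 * d - x 6 * c) + x 8 * (b + x 6 * d - x 7 * c), b + x 6 * d - x 7 * c, c + x 8 * d, d)"

fun chart :: "(nat \<Rightarrow> 'k::field) \<Rightarrow> 'k vec4 \<Rightarrow> 'k vec4" where
  "chart x (a, b, c, d) = symp_move x (a + x 0 * c + x 1 * d, c, x 4 * d, b + x 2 * c + x 3 * d)"

fun cochart :: "(nat \<Rightarrow> 'k::field) \<Rightarrow> 'k vec4 \<Rightarrow> 'k vec4" where
  "cochart x (a, b, c, d) = symp_move x
    (x 4 * b, x 3 * b + x 1 * a - d, x 4 * (c - x 2 * b - x 0 * a), - (x 4 * a))"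

lemma dot4_commute: "dot4 v w = dot4 w v"
  by (cases v; cases w) (simp add: algebra_simps)

lemma dot4_scale4: "dot4 (scale4 k v) w = k * dot4 v w"
  by (cases v; cases w) (simp add: algebra_simps)

lemma symp4_commute: "symp4 w v = - symp4 v w"
  by (cases v; cases w) (simp add: algebra_simps)

lemma minor12_commute: "minor12 w v = - minor12 v w"
  by (cases v; cases w) simp

lemma symp4_symp_move: "symp4 (symp_move x v) (symp_move x w) = symp4 v w"
  by (cases v; cases w) (simp add: algebra_simps)

lemma symp4_chart_cochart: "symp4 (chart x v) (cochart x w) = x 4 * dot4 v w"
  by (cases v; cases w) (simp only: chart.simps cochart.simps symp4_symp_move,
      simp add: algebra_simps)

lemma symp_move_surj: "\<exists>v. symp_move x v = w"
proof -
  obtain a b c d where w: "w = (a, b, c, d)"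
    by (cases w)
  let ?c = "c - x 8 * d"
  let ?b = "b - x 6 * d + x 7 * ?c"
  show ?thesis
    unfolding w by (intro exI[of _ "(a - x 8 * b - x 5 * d + x 6 * ?c, ?b, ?c, d)"]) simp
qed

lemma chart_surj:
  assumes "x 4 \<noteq> 0"
  shows "\<exists>v. chart x v = w"
proof -
  obtain a b c d where u: "symp_move x (a, b, c, d) = w"
    using symp_move_surj by (metis prod_cases4)
  have "chart x (a - x 0 * b - x 1 * (c / x 4), d - x 2 * b - x 3 * (c / x 4), b, c / x 4) = w"
    using assms by (simp add: u[symmetric] del: symp_move.simps)
  then show ?thesis
    by blast
qed

lemma cochart_surj:
  assumes "x 4 \<noteq> 0"
  shows "\<exists>v. cochart x v = w"
proof -
  obtain a b c d where u: "symp_move x (a, b, c, d) = w"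
    using symp_move_surj by (metis prod_cases4)
  let ?a = "- (d / x 4)" and ?b = "a / x 4"
  have "cochart x (?a, ?b, c / x 4 + x 2 * ?b + x 0 * ?a, x 3 * ?b + x 1 * ?a - b) = w"
    using assms by (simp add: u[symmetric] del: symp_move.simps)
  then show ?thesis
    by blast
qed

lemma dot4_represents:
  fixes g :: "'k::field vec4 \<Rightarrow> 'k"
  assumes "\<And>a b c d. g (a, b, c, d)
    = a * g (1, 0, 0, 0) + b * g (0, 1, 0, 0) + c * g (0, 0, 1, 0) + d * g (0, 0, 0, 1)"
  shows "\<exists>v. \<forall>w. dot4 v w = g w"
proof (intro exI allI)
  fix w :: "'k vec4"
  obtain a b c d where w: "w = (a, b, c, d)"
    by (cases w)
  have "g w = a * g (1, 0, 0, 0) + b * g (0, 1, 0, 0) + c * g (0, 0, 1, 0) + d * g (0, 0, 0, 1)"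
    unfolding w by (rule assms)
  then show "dot4 (g (1, 0, 0, 0), g (0, 1, 0, 0), g (0, 0, 1, 0), g (0, 0, 0, 1)) w = g w"
    by (simp add: w mult.commute)
qed

lemma dot4_chart: "\<exists>c. \<forall>w. dot4 c w = dot4 a (chart x w)"
  and dot4_cochart: "\<exists>c. \<forall>w. dot4 c w = dot4 a (cochart x w)"
  by (rule dot4_represents, cases a, simp add: algebra_simps)+

lemma polyfun_chart:
  "polyfun (\<lambda>x. fst (chart x v))" "polyfun (\<lambda>x. fst (cochart x v))"
  "polyfun (\<lambda>x. symp4 (chart x v) (chart x w))" "polyfun (\<lambda>x. symp4 (cochart x v) (cochart x w))"
  "polyfun (\<lambda>x. minor12 (chart x v) (cochart x w))"
  by (cases v; cases w; simp only: chart.simps cochart.simps symp4_symp_move symp4.simps symp_move.simps minor12.simps fst_conv;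
      intro polyfun_intros)+

lemma fst_chart_nonzero:
  fixes v :: "'k::field vec4"
  assumes "v \<noteq> 0"
  shows "generically (\<lambda>x. fst (chart x v) \<noteq> 0)" "generically (\<lambda>x. fst (cochart x v) \<noteq> 0)"
proof -
  obtain a b c d where v: "v = (a, b, c, d)"
    by (cases v)
  have "\<exists>x\<in>{\<lambda>_. 0, (\<lambda>_. 0)(8 := 1), (\<lambda>_. 0)(5 := 1), (\<lambda>_. 0)(1 := 1)}. fst (chart x v) \<noteq> 0"
    using assms by (auto simp: v zero_prod_def)
  then show "generically (\<lambda>x. fst (chart x v) \<noteq> 0)"
    by (blast intro: generically_nonzero[OF polyfun_chart(1)])
  have "\<exists>x\<in>{(\<lambda>_. 0)(4 := 1), (\<lambda>_. 0)(8 := 1), (\<lambda>_. 0)(8 := 1, 1 := 1), (\<lambda>_. 0)(4 := 1, 6 := 1)}. fst (cochart x v) \<noteq> 0"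
    using assms by (auto simp: v zero_prod_def)
  then show "generically (\<lambda>x. fst (cochart x v) \<noteq> 0)"
    by (blast intro: generically_nonzero[OF polyfun_chart(2)])
qed

lemma indep4_imp_minor_nonzero:
  fixes a b c d :: "'k::field"
  assumes "indep4 (a, b, c, d) (a', b', c', d')"
  shows "a * b' - b * a' \<noteq> 0 \<or> a * c' - c * a' \<noteq> 0 \<or> a * d' - d * a' \<noteq> 0 \<or> b * c' - c * b' \<noteq> 0
    \<or> b * d' - d * b' \<noteq> 0 \<or> c * d' - d * c' \<noteq> 0"
proof (rule ccontr)
  assume minors: "\<not> ?thesis"
  have "(a, b, c, d) = scale4 (a / a') (a', b', c', d')" if "a' \<noteq> 0"
    using that minors by (auto simp: field_simps)
  moreover have "(a, b, c, d) = scale4 (b / b') (a', b', c', d')" if "b' \<noteq> 0"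
    using that minors by (auto simp: field_simps)
  moreover have "(a, b, c, d) = scale4 (c / c') (a', b', c', d')" if "c' \<noteq> 0"
    using that minors by (auto simp: field_simps)
  moreover have "(a, b, c, d) = scale4 (d / d') (a', b', c', d')" if "d' \<noteq> 0"
    using that minors by (auto simp: field_simps)
  ultimately show False
    using assms unfolding indep4_def zero_prod_def by blast
qed

lemma symp4_chart_nonzero:
  fixes v w :: "'k::field vec4"
  assumes "indep4 v w"
  shows "generically (\<lambda>x. symp4 (chart x v) (chart x w) \<noteq> 0)"
proof -
  obtain a b c d a' b' c' d' where v: "v = (a, b, c, d)" and w: "w = (a', b', c', d')"
    by (cases v; cases w)
  define e where "e i = (\<lambda>_. 0 :: 'k)(i := 1)" for i :: nat
  have expand: "symp4 (chart x v) (chart x w)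
    = - (a * b' - b * a') - x 2 * (a * c' - c * a') - x 3 * (a * d' - d * a')
    + x 0 * (b * c' - c * b') + x 1 * (b * d' - d * b') + (x 2 * x 1 - x 0 * x 3 + x 4) * (c * d' - d * c')" for x
    by (simp only: v w chart.simps symp4_symp_move) (simp add: algebra_simps)
  have "\<exists>i. symp4 (chart (e i) v) (chart (e i) w) \<noteq> 0"
  proof (rule ccontr)
    assume "\<not> ?thesis"
    then have zero: "symp4 (chart (e i) v) (chart (e i) w) = 0" for i
      by blast
    show False
      using zero[of 0] zero[of 1] zero[of 2] zero[of 3] zero[of 4] zero[of 5]
        indep4_imp_minor_nonzero[OF assms[unfolded v w]] unfolding expand e_def by auto
  qed
  then show ?thesis
    using generically_nonzero[OF polyfun_chart(3)] by blast
qed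

lemma symp4_cochart_nonzero:
  fixes v w :: "'k::field vec4"
  assumes inf: "infinite (UNIV :: 'k set)" and indep: "indep4 v w"
  shows "generically (\<lambda>x. symp4 (cochart x v) (cochart x w) \<noteq> 0)"
proof -
  obtain a b c d a' b' c' d' where v: "v = (a, b, c, d)" and w: "w = (a', b', c', d')"
    by (cases v; cases w)
  define e where "e i = (\<lambda>_. 0 :: 'k)(i := 1)" for i :: nat
  define g where "g x = (x 3 * x 0 - x 1 * x 2 - x 4) * (a * b' - b * a')
      + x 1 * (a * c' - c * a') - x 0 * (a * d' - d * a')
      + x 3 * (b * c' - c * b') - x 2 * (b * d' - d * b') + (c * d' - d * c')" for x :: "nat \<Rightarrow> 'k"
  have expand: "symp4 (cochart x v) (cochart x w) = x 4 * g x" for x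
    unfolding g_def by (simp only: v w cochart.simps symp4_symp_move) (simp add: algebra_simps)
  have "\<exists>i. g (e i) \<noteq> 0"
  proof (rule ccontr)
    assume "\<not> ?thesis"
    then have zero: "g (e i) = 0" for i
      by blast
    show False
      using zero[of 0] zero[of 1] zero[of 2] zero[of 3] zero[of 4] zero[of 5]
        indep4_imp_minor_nonzero[OF indep[unfolded v w]] unfolding g_def e_def by auto
  qed
  moreover have "polyfun g"
    unfolding g_def by (intro polyfun_intros)
  ultimately have "generically (\<lambda>x. g x \<noteq> 0)"
    by (blast intro: generically_nonzero)
  moreover have "generically (\<lambda>x :: nat \<Rightarrow> 'k. x 4 \<noteq> 0)"
    by (rule generically_nonzero[of _ "\<lambda>_. 1"]) (auto intro: polyfun_intros)
  ultimately show ?thesis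
    unfolding expand mult_eq_0_iff de_Morgan_disj by (rule generically_conj[OF inf, rotated])
qed

lemma minor12_chart_cochart_nonzero:
  fixes v w :: "'k::field vec4"
  assumes inf: "infinite (UNIV :: 'k set)" and "v \<noteq> 0" "w \<noteq> 0"
  shows "generically (\<lambda>x. minor12 (chart x v) (cochart x w) \<noteq> 0)"
proof -
  obtain a b c d a' b' c' d' where v: "v = (a, b, c, d)" and w: "w = (a', b', c', d')"
    by (cases v; cases w)
  define g where "g x = a + x 0 * c + x 1 * d + x 5 * (b + x 2 * c + x 3 * d)" for x :: "nat \<Rightarrow> 'k"
  define h where "h x = x 3 * b' + x 1 * a' - d'" for x :: "nat \<Rightarrow> 'k"
  have "\<exists>x\<in>{\<lambda>_. 0, (\<lambda>_. 0)(0 := 1), (\<lambda>_. 0)(5 := 1), (\<lambda>_. 0)(1 := 1)}. g x \<noteq> 0"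
    using assms(2) by (auto simp: g_def v zero_prod_def)
  moreover have "polyfun g"
    unfolding g_def by (intro polyfun_intros)
  ultimately have g: "generically (\<lambda>x. g x \<noteq> 0)"
    by (blast intro: generically_nonzero)
  have "\<exists>x. minor12 (chart x v) (cochart x w) \<noteq> 0"
  proof (cases "a' = 0 \<and> b' = 0 \<and> d' = 0")
    case True
    then have "c' \<noteq> 0"
      using assms(3) by (auto simp: w zero_prod_def)
    obtain x where "g x \<noteq> 0"
      using generically_ex[OF g] by blast
    define z where "z = x(4 := 1, 6 := 0, 7 := 1, 8 := 0)"
    have "minor12 (chart z v) (cochart z w) = - c' * g x"
      using True by (simp add: v w z_def g_def algebra_simps)
    then show ?thesis
      using \<open>g x \<noteq> 0\<close> \<open>c' \<noteq> 0\<close> by (intro exI[of _ z]) simp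
  next
    case False
    then have "\<exists>x\<in>{\<lambda>_. 0, (\<lambda>_. 0)(3 := 1), (\<lambda>_. 0)(1 := 1)}. h x \<noteq> 0"
      by (auto simp: h_def)
    moreover have "polyfun h"
      unfolding h_def by (intro polyfun_intros)
    ultimately have "generically (\<lambda>x. h x \<noteq> 0)"
      by (blast intro: generically_nonzero)
    then obtain x where x: "g x \<noteq> 0" "h x \<noteq> 0"
      using generically_ex[OF generically_conj[OF inf g]] by blast
    define z where "z = x(4 := 0, 8 := 0)"
    have "minor12 (chart z v) (cochart z w) = g x * h x"
      by (simp add: v w z_def g_def h_def)
    then show ?thesis
      using x by (intro exI[of _ z]) simp
  qed
  then show ?thesis
    by (blast intro: generically_nonzero[OF polyfun_chart(5)])
qed

definition projectively_distinct :: "('a \<Rightarrow> 'k::field vec4) \<Rightarrow> 'a set \<Rightarrow> bool" where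
  "projectively_distinct p A \<longleftrightarrow> (\<forall>a\<in>A. p a \<noteq> 0 \<and> (\<forall>b\<in>A - {a}. indep4 (p a) (p b)))"

lemma exists_generic_chart:
  fixes p :: "'a \<Rightarrow> 'k::field vec4" and q :: "'b \<Rightarrow> 'k vec4"
  assumes inf: "infinite (UNIV :: 'k set)" and fin: "finite A" "finite B"
    and p: "projectively_distinct p A" and q: "projectively_distinct q B"
  shows "\<exists>x. x 4 \<noteq> 0 \<and> (\<forall>a\<in>A. fst (chart x (p a)) \<noteq> 0) \<and> (\<forall>b\<in>B. fst (cochart x (q b)) \<noteq> 0) \<and>
    (\<forall>a\<in>A. \<forall>a'\<in>A - {a}. symp4 (chart x (p a)) (chart x (p a')) \<noteq> 0) \<and>
    (\<forall>b\<in>B. \<forall>b'\<in>B - {b}. symp4 (cochart x (q b)) (cochart x (q b')) \<noteq> 0) \<and>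
    (\<forall>a\<in>A. \<forall>b\<in>B. minor12 (chart x (p a)) (cochart x (q b)) \<noteq> 0)"
proof (rule generically_ex, intro generically_conj[OF inf] generically_ball[OF inf] fin finite_Diff)
  show "generically (\<lambda>x :: nat \<Rightarrow> 'k. x 4 \<noteq> 0)"
    by (rule generically_nonzero[of _ "\<lambda>_. 1"]) (auto intro: polyfun_intros)
qed (use p q in \<open>auto simp: projectively_distinct_def intro!: fst_chart_nonzero symp4_chart_nonzero
      symp4_cochart_nonzero[OF inf] minor12_chart_cochart_nonzero[OF inf]\<close>)

subsection \<open>Graphs of orthogonal points\<close>

declare chart.simps [simp del] cochart.simps [simp del]

fun line_of :: "'k::field vec4 \<Rightarrow> 'k line" where
  "line_of (a, b, c, d) = (b / a, c / a, d / a)"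

lemma line_symp_line_of:
  assumes "fst v \<noteq> 0" "fst w \<noteq> 0"
  shows "line_symp (line_of v) (line_of w) = symp4 v w / (fst v * fst w)"
  using assms by (cases v; cases w) (simp add: line_symp_def field_simps)

lemma slope_line_of:
  assumes "fst v \<noteq> 0" "fst w \<noteq> 0" "minor12 v w \<noteq> 0"
  shows "slope (line_of v) \<noteq> slope (line_of w)"
  using assms by (cases v; cases w) (auto simp: slope_def field_simps)

lemma functional_not_symp4_multiple:
  fixes v :: "'k::field vec4"
  assumes "fst v \<noteq> 0"
  shows "\<exists>w. dot4 (\<kappa> * yint (line_of v) - \<mu> * slope (line_of v) + 1, \<mu>, - \<kappa>, 0) w \<noteq> k * symp4 v w"
proof (rule ccontr)
  assume multiple: "\<not> ?thesis"
  obtain a b c d where v: "v = (a, b, c, d)"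
    by (cases v)
  have eq: "dot4 (\<kappa> * yint (line_of v) - \<mu> * slope (line_of v) + 1, \<mu>, - \<kappa>, 0) w = k * symp4 v w" for w
    using multiple by blast
  have "k = 0"
    using eq[of "(0, 0, 0, 1)"] assms by (simp add: v)
  then show False
    using eq[of "(0, 1, 0, 0)"] eq[of "(0, 0, 1, 0)"] eq[of "(1, 0, 0, 0)"] by simp
qed

lemma functional_eq_0_on_line:
  assumes "fst w \<noteq> 0" "\<kappa> * (yint l - yint (line_of w)) + \<mu> * (slope (line_of w) - slope l) + 1 = 0"
  shows "dot4 (\<kappa> * yint l - \<mu> * slope l + 1, \<mu>, - \<kappa>, 0) w = 0"
proof -
  have "dot4 (\<kappa> * yint l - \<mu> * slope l + 1, \<mu>, - \<kappa>, 0) w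
      = fst w * (\<kappa> * (yint l - yint (line_of w)) + \<mu> * (slope (line_of w) - slope l) + 1)"
    using assms(1) by (cases w) (simp add: yint_def slope_def algebra_simps)
  then show ?thesis
    using assms(2) by simp
qed

locale symplectic_graph =
  fixes V :: "'v set" and R :: "'v \<Rightarrow> 'v \<Rightarrow> bool" and P :: "'v \<Rightarrow> 'k::field vec4" and D :: nat
  assumes finite_V: "finite V"
    and sym: "R u v \<Longrightarrow> R v u"
    and fst_nonzero: "v \<in> V \<Longrightarrow> fst (P v) \<noteq> 0"
    and orthogonal: "\<lbrakk>u \<in> V; v \<in> V; R u v\<rbrakk> \<Longrightarrow> symp4 (P u) (P v) = 0"
    and minor_nonzero: "\<lbrakk>u \<in> V; v \<in> V; R u v\<rbrakk> \<Longrightarrow> minor12 (P u) (P v) \<noteq> 0"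
    and not_orthogonal: "\<lbrakk>v \<in> V; u \<in> V; w \<in> V; R v u; R v w; u \<noteq> w\<rbrakk> \<Longrightarrow> symp4 (P u) (P w) \<noteq> 0"
    and few_collinear: "\<lbrakk>v \<in> V; \<And>k. \<exists>w. dot4 c w \<noteq> k * symp4 (P v) w\<rbrakk>
      \<Longrightarrow> card {u \<in> V. R v u \<and> dot4 c (P u) = 0} \<le> D"
begin

sublocale line_graph V R "\<lambda>v. line_of (P v)"
proof
  show "finite V"
    by (rule finite_V)
  show "line_symp (line_of (P u)) (line_of (P v)) = 0" "slope (line_of (P u)) \<noteq> slope (line_of (P v))"
    if "u \<in> V" "v \<in> V" "R u v" for u v
    using orthogonal[OF that] minor_nonzero[OF that] fst_nonzero that
    by (simp_all add: line_symp_line_of slope_line_of)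
  show "line_symp (line_of (P u)) (line_of (P w)) \<noteq> 0"
    if "v \<in> V" "u \<in> V" "w \<in> V" "R v u" "R v w" "u \<noteq> w" for v u w
    using not_orthogonal[OF that] fst_nonzero that by (simp add: line_symp_line_of)
qed

lemma subgraph:
  assumes "W \<subseteq> V"
  shows "symplectic_graph W R P D"
proof
  fix v c
  assume "v \<in> W" "\<And>k. \<exists>w. dot4 c w \<noteq> k * symp4 (P v) w"
  then have "card {u \<in> V. R v u \<and> dot4 c (P u) = 0} \<le> D"
    using assms by (intro few_collinear) auto
  moreover have "card {u \<in> W. R v u \<and> dot4 c (P u) = 0} \<le> card {u \<in> V. R v u \<and> dot4 c (P u) = 0}"
    using assms finite_V by (intro card_mono) auto
  ultimately show "card {u \<in> W. R v u \<and> dot4 c (P u) = 0} \<le> D"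
    by simp
next
  show "finite W"
    using assms finite_V by (rule finite_subset)
  show "R u v \<Longrightarrow> R v u" for u v
    by (rule sym)
  show "fst (P v) \<noteq> 0" if "v \<in> W" for v
    using that assms fst_nonzero by blast
  show "symp4 (P u) (P v) = 0" "minor12 (P u) (P v) \<noteq> 0" if "u \<in> W" "v \<in> W" "R u v" for u v
    using that assms orthogonal[of u v] minor_nonzero[of u v] by auto
  show "symp4 (P u) (P w) \<noteq> 0" if "v \<in> W" "u \<in> W" "w \<in> W" "R v u" "R v w" "u \<noteq> w" for v u w
    using that assms not_orthogonal[of v u w] by auto
qed

lemma exists_low_degree:
  assumes "V \<noteq> {}" and C: "finite C" "\<And>u v. \<lbrakk>u \<in> V; v \<in> V; R u v\<rbrakk> \<Longrightarrow> u \<in> C \<or> v \<in> C"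
    and m: "3 * card C \<le> (m + 1)\<^sup>2" "6 * m < CHAR('k)"
  shows "\<exists>v\<in>V. card (neighbours v) \<le> 15 * m + D"
proof (rule ccontr)
  assume "\<not> ?thesis"
  then have degree: "15 * m + D < card (neighbours v)" if "v \<in> V" for v
    using that by auto
  have "3 * card ((\<lambda>v. line_of (P v)) ` C) \<le> (m + 1)\<^sup>2"
    using card_image_le[OF C(1), of "\<lambda>v. line_of (P v)"] m(1) by linarith
  then obtain f where f: "f \<noteq> 0" "total_degree_le f (3 * m)" "\<And>v. v \<in> C \<Longrightarrow> on_line (line_of (P v)) f = 0"
    using exists_poly3_vanishing_on_lines[of "(\<lambda>v. line_of (P v)) ` C" m] C(1) by auto
  have "on_line (line_of (P v)) f = 0" if v: "v \<in> V" for v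
  proof (cases "v \<in> C")
    case False
    have "poly (on_line (line_of (P v)) f) (meet v u) = 0" if u: "u \<in> neighbours v" for u
    proof -
      have "u \<in> C"
        using C(2)[of v u] v u False by (auto simp: neighbours_def)
      then show ?thesis
        using f(3) by (simp add: poly_on_line_meet_at[OF neighbours_line(2,3)[OF v u]])
    qed
    then show ?thesis
      using degree[OF v] by (intro on_line_eq_0I[OF v f(2)]) auto
  qed (rule f(3))
  then have "vanishes f"
    by (simp add: vanishes_def)
  moreover have "5 * (3 * m) < card (neighbours v)" if "v \<in> V" for v
    using degree[OF that] by simp
  moreover have "2 * (3 * m) < CHAR('k)"
    using m(2) by simp
  ultimately obtain v \<kappa> \<mu> where v: "v \<in> V" and neighbours_v: "card (neighbours v) \<le> card {u \<in> neighbours v.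
      \<kappa> * (yint (line_of (P v)) - yint (line_of (P u))) + \<mu> * (slope (line_of (P u)) - slope (line_of (P v))) + 1 = 0} + 3 * m"
    using exists_neighbours_in_plane[OF \<open>V \<noteq> {}\<close> f(1,2)] by blast
  define c where "c = (\<kappa> * yint (line_of (P v)) - \<mu> * slope (line_of (P v)) + 1, \<mu>, - \<kappa>, 0 :: 'k)"
  have "card {u \<in> V. R v u \<and> dot4 c (P u) = 0} \<le> D"
    unfolding c_def using v by (intro few_collinear functional_not_symp4_multiple fst_nonzero)
  moreover have "card {u \<in> neighbours v. \<kappa> * (yint (line_of (P v)) - yint (line_of (P u)))
      + \<mu> * (slope (line_of (P u)) - slope (line_of (P v))) + 1 = 0} \<le> card {u \<in> V. R v u \<and> dot4 c (P u) = 0}"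
    using finite_V fst_nonzero
    by (intro card_mono) (auto simp: neighbours_def c_def intro!: functional_eq_0_on_line)
  ultimately show False
    using neighbours_v degree[OF v] by linarith
qed

lemma edges_le:
  assumes C: "finite C" "\<And>u v. \<lbrakk>u \<in> V; v \<in> V; R u v\<rbrakk> \<Longrightarrow> u \<in> C \<or> v \<in> C"
    and m: "3 * card C \<le> (m + 1)\<^sup>2" "6 * m < CHAR('k)"
  shows "edges R V V \<le> 2 * ((15 * m + D) * card V)"
proof (rule ccontr)
  assume "\<not> ?thesis"
  then have "2 * (15 * m + D) * card V < edges R V V"
    by (simp only: not_le mult.assoc)
  then have "\<exists>W\<subseteq>V. W \<noteq> {} \<and> (\<forall>v\<in>W. 15 * m + D < card {u \<in> W. R v u})"
    using sym by (intro min_degree_subgraph[OF finite_V])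
  then obtain W where W: "W \<subseteq> V" "W \<noteq> {}" "\<And>v. v \<in> W \<Longrightarrow> 15 * m + D < card {u \<in> W. R v u}"
    by blast
  interpret W: symplectic_graph W R P D
    using W(1) by (rule subgraph)
  have "\<exists>v\<in>W. card (W.neighbours v) \<le> 15 * m + D"
    by (rule W.exists_low_degree[OF W(2) C(1) _ m]) (use C(2) W(1) in blast)
  then show False
    using W(3) unfolding W.neighbours_def by (meson not_le)
qed

end

lemma functional_on_cochart:
  assumes x: "x 4 \<noteq> 0" and c: "\<And>k. \<exists>w. dot4 c w \<noteq> k * symp4 (chart x v) w"
  shows "\<exists>c'. (\<forall>w. dot4 c' w = dot4 c (cochart x w)) \<and> (\<forall>k. c' \<noteq> scale4 k v)"
proof -
  obtain c' where c': "dot4 c' w = dot4 c (cochart x w)" for w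
    using dot4_cochart by blast
  have "c' \<noteq> scale4 k v" for k
  proof
    assume "c' = scale4 k v"
    then have "dot4 c (cochart x w) = k / x 4 * symp4 (chart x v) (cochart x w)" for w
      using x by (simp add: symp4_chart_cochart dot4_scale4 flip: c')
    then show False
      using c[of "k / x 4"] cochart_surj[of x, OF x] by metis
  qed
  then show ?thesis
    using c' by blast
qed

lemma functional_on_chart:
  assumes x: "x 4 \<noteq> 0" and c: "\<And>k. \<exists>v. dot4 c v \<noteq> k * symp4 (cochart x w) v"
  shows "\<exists>c'. (\<forall>v. dot4 c' v = dot4 c (chart x v)) \<and> (\<forall>k. c' \<noteq> scale4 k w)"
proof -
  obtain c' where c': "dot4 c' v = dot4 c (chart x v)" for v
    using dot4_chart by blast
  have "c' \<noteq> scale4 k w" for k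
  proof
    assume "c' = scale4 k w"
    then have "dot4 c (chart x v) = - k / x 4 * symp4 (cochart x w) (chart x v)" for v
      using x by (simp add: symp4_commute[of "cochart x w"] symp4_chart_cochart
          dot4_scale4 dot4_commute[of v] flip: c')
    then show False
      using c[of "- k / x 4"] chart_surj[of x, OF x] by metis
  qed
  then show ?thesis
    using c' by blast
qed

lemma symplectic_graph_charts:
  fixes p :: "'a \<Rightarrow> 'k::field vec4" and q :: "'b \<Rightarrow> 'k vec4" and x :: "nat \<Rightarrow> 'k"
  defines "P \<equiv> case_sum (\<lambda>a. chart x (p a)) (\<lambda>b. cochart x (q b))"
  assumes fin: "finite A" "finite B" and x4: "x 4 \<noteq> 0"
    and E: "\<And>a b. \<lbrakk>a \<in> A; b \<in> B; E a b\<rbrakk> \<Longrightarrow> dot4 (p a) (q b) = 0"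
    and few_collinear: "\<And>a c. \<lbrakk>a \<in> A; \<And>k. c \<noteq> scale4 k (p a)\<rbrakk> \<Longrightarrow> card {b \<in> B. E a b \<and> dot4 c (q b) = 0} \<le> D"
      "\<And>b c. \<lbrakk>b \<in> B; \<And>k. c \<noteq> scale4 k (q b)\<rbrakk> \<Longrightarrow> card {a \<in> A. E a b \<and> dot4 c (p a) = 0} \<le> D"
    and fst_chart: "\<forall>a\<in>A. fst (chart x (p a)) \<noteq> 0" "\<forall>b\<in>B. fst (cochart x (q b)) \<noteq> 0"
    and skew: "\<forall>a\<in>A. \<forall>a'\<in>A - {a}. symp4 (chart x (p a)) (chart x (p a')) \<noteq> 0"
      "\<forall>b\<in>B. \<forall>b'\<in>B - {b}. symp4 (cochart x (q b)) (cochart x (q b')) \<noteq> 0"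
    and minor: "\<forall>a\<in>A. \<forall>b\<in>B. minor12 (chart x (p a)) (cochart x (q b)) \<noteq> 0"
  shows "symplectic_graph (A <+> B) (bipartite E) P D"
proof
  fix u c
  assume u: "u \<in> A <+> B" and c: "\<And>k. \<exists>w. dot4 c w \<noteq> k * symp4 (P u) w"
  show "card {w \<in> A <+> B. bipartite E u w \<and> dot4 c (P w) = 0} \<le> D"
  proof (cases u)
    case (Inl a)
    obtain c' where c': "\<And>w. dot4 c' w = dot4 c (cochart x w)" "\<And>k. c' \<noteq> scale4 k (p a)"
      using functional_on_cochart[OF x4 c[unfolded Inl P_def sum.case]] by blast
    have "card {b \<in> B. E a b \<and> dot4 c (cochart x (q b)) = 0} \<le> D"
      using few_collinear(1)[OF _ c'(2)] u by (auto simp: Inl c'(1))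
    then show ?thesis
      by (simp add: Inl P_def bipartite_neighbours card_image)
  next
    case (Inr b)
    obtain c' where c': "\<And>v. dot4 c' v = dot4 c (chart x v)" "\<And>k. c' \<noteq> scale4 k (q b)"
      using functional_on_chart[OF x4 c[unfolded Inr P_def sum.case]] by blast
    have "card {a \<in> A. E a b \<and> dot4 c (chart x (p a)) = 0} \<le> D"
      using few_collinear(2)[OF _ c'(2)] u by (auto simp: Inr c'(1))
    then show ?thesis
      by (simp add: Inr P_def bipartite_neighbours card_image)
  qed
next
  show "symp4 (P u) (P v) = 0" if "u \<in> A <+> B" "v \<in> A <+> B" "bipartite E u v" for u v
    using that E x4
    by (cases u; cases v) (auto simp: P_def symp4_chart_cochart symp4_commute[of "cochart _ _" "chart _ _"])
  show "minor12 (P u) (P v) \<noteq> 0" if "u \<in> A <+> B" "v \<in> A <+> B" "bipartite E u v" for u v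
    using that minor by (cases u; cases v) (auto simp: P_def minor12_commute[of "cochart _ _" "chart _ _"])
  show "symp4 (P u) (P w) \<noteq> 0" if "v \<in> A <+> B" "u \<in> A <+> B" "w \<in> A <+> B"
    "bipartite E v u" "bipartite E v w" "u \<noteq> w" for u v w
    using that skew by (cases v; cases u; cases w) (auto simp: P_def)
  show "fst (P u) \<noteq> 0" if "u \<in> A <+> B" for u
    using that fst_chart by (auto simp: P_def)
qed (use fin in \<open>auto intro: bipartite_sym\<close>)

text \<open>Rudnev's point-plane incidence bound, with the planes given by their normal vectors.\<close>

theorem point_plane_incidence_bound:
  fixes p :: "'a \<Rightarrow> 'k::field vec4" and q :: "'b \<Rightarrow> 'k vec4"
  assumes inf: "infinite (UNIV :: 'k set)" and fin: "finite A" "finite B"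
    and p: "projectively_distinct p A" and q: "projectively_distinct q B"
    and E: "\<And>a b. \<lbrakk>a \<in> A; b \<in> B; E a b\<rbrakk> \<Longrightarrow> dot4 (p a) (q b) = 0"
    and few_collinear: "\<And>a c. \<lbrakk>a \<in> A; \<And>k. c \<noteq> scale4 k (p a)\<rbrakk> \<Longrightarrow> card {b \<in> B. E a b \<and> dot4 c (q b) = 0} \<le> D"
      "\<And>b c. \<lbrakk>b \<in> B; \<And>k. c \<noteq> scale4 k (q b)\<rbrakk> \<Longrightarrow> card {a \<in> A. E a b \<and> dot4 c (p a) = 0} \<le> D"
    and m: "3 * card A \<le> (m + 1)\<^sup>2" "6 * m < CHAR('k)"
  shows "edges E A B \<le> (15 * m + D) * (card A + card B)"
proof -
  obtain x where x4: "x 4 \<noteq> 0"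
    and fst_chart: "\<forall>a\<in>A. fst (chart x (p a)) \<noteq> 0" "\<forall>b\<in>B. fst (cochart x (q b)) \<noteq> 0"
    and skew: "\<forall>a\<in>A. \<forall>a'\<in>A - {a}. symp4 (chart x (p a)) (chart x (p a')) \<noteq> 0"
      "\<forall>b\<in>B. \<forall>b'\<in>B - {b}. symp4 (cochart x (q b)) (cochart x (q b')) \<noteq> 0"
    and minor: "\<forall>a\<in>A. \<forall>b\<in>B. minor12 (chart x (p a)) (cochart x (q b)) \<noteq> 0"
    using exists_generic_chart[OF inf fin p q] by blast
  define P where "P = case_sum (\<lambda>a. chart x (p a)) (\<lambda>b. cochart x (q b))"
  interpret symplectic_graph "A <+> B" "bipartite E" P D
    unfolding P_def by (rule symplectic_graph_charts[OF fin x4 E few_collinear fst_chart skew minor])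
  have "u \<in> Inl ` A \<or> v \<in> Inl ` A" if "u \<in> A <+> B" "v \<in> A <+> B" "bipartite E u v" for u v
    using that by (cases u; cases v) auto
  then have "edges (bipartite E) (A <+> B) (A <+> B) \<le> 2 * ((15 * m + D) * card (A <+> B))"
    using fin m by (intro edges_le[of "Inl ` A"]) (auto simp: card_image)
  then show ?thesis
    using fin by (simp add: edges_bipartite card_Plus)
qed

section \<open>Forms on the plane\<close>

subsection \<open>Directions\<close>

type_synonym 'k vec2 = "'k \<times> 'k"

definition scale2 :: "'k::field \<Rightarrow> 'k vec2 \<Rightarrow> 'k vec2" where
  "scale2 k v = (k * fst v, k * snd v)"

definition parallel2 :: "'k::field vec2 \<Rightarrow> 'k vec2 \<Rightarrow> bool" where
  "parallel2 u v \<longleftrightarrow> fst u * snd v = snd u * fst v"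

definition leading :: "'k::field vec2 \<Rightarrow> 'k" where
  "leading v = (if fst v \<noteq> 0 then fst v else snd v)"

definition direction :: "'k::field vec2 \<Rightarrow> 'k vec2" where
  "direction v = scale2 (inverse (leading v)) v"

lemma leading_eq_0_iff [simp]: "leading v = 0 \<longleftrightarrow> v = 0"
  by (auto simp: leading_def prod_eq_iff)

lemma scale2_scale2 [simp]: "scale2 k (scale2 l v) = scale2 (k * l) v"
  by (simp add: scale2_def mult.assoc)

lemma scale2_1 [simp]: "scale2 1 v = v"
  by (simp add: scale2_def)

lemma scale2_eq_0_iff [simp]: "scale2 k v = 0 \<longleftrightarrow> k = 0 \<or> v = 0"
  by (auto simp: scale2_def prod_eq_iff)

lemma scale2_cancel [simp]: "scale2 k u = scale2 k v \<longleftrightarrow> k = 0 \<or> u = v"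
  by (auto simp: scale2_def prod_eq_iff)

lemma leading_scale2: "leading (scale2 k v) = k * leading v"
  by (auto simp: leading_def scale2_def)

lemma scale2_leading_direction: "scale2 (leading v) (direction v) = v"
  by (cases "v = 0") (simp_all add: direction_def)

lemma direction_scale2:
  assumes "k \<noteq> 0"
  shows "direction (scale2 k v) = direction v"
proof -
  have "inverse (k * leading v) * k = inverse (leading v)"
    using assms by (cases "leading v = 0") (auto simp: field_simps)
  then show ?thesis
    unfolding direction_def leading_scale2 scale2_scale2 by (simp only:)
qed

lemma direction_eq_0_iff [simp]: "direction v = 0 \<longleftrightarrow> v = 0"
  by (simp add: direction_def)

lemma leading_direction: "v \<noteq> 0 \<Longrightarrow> leading (direction v) = 1"
  by (simp add: direction_def leading_scale2)

lemma direction_eq_self: "leading v = 1 \<Longrightarrow> direction v = v"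
  by (simp add: direction_def)

lemma parallel2_imp_scale2:
  assumes "parallel2 u v" "v \<noteq> 0"
  shows "\<exists>k. u = scale2 k v"
proof (cases "fst v = 0")
  case True
  then show ?thesis
    using assms by (intro exI[of _ "snd u / snd v"]) (auto simp: parallel2_def scale2_def prod_eq_iff)
next
  case False
  then show ?thesis
    using assms
    by (intro exI[of _ "fst u / fst v"]) (auto simp: parallel2_def scale2_def prod_eq_iff field_simps)
qed

lemma direction_eq_iff_parallel2:
  assumes "u \<noteq> 0" "v \<noteq> 0"
  shows "direction u = direction v \<longleftrightarrow> parallel2 u v"
proof
  assume "direction u = direction v"
  then have "u = scale2 (leading u) (direction v)" "v = scale2 (leading v) (direction v)"
    using scale2_leading_direction[of u] scale2_leading_direction[of v] by simp_all
  then have "fst u * snd v = leading u * fst (direction v) * (leading v * snd (direction v))"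
    "snd u * fst v = leading u * snd (direction v) * (leading v * fst (direction v))"
    by (metis scale2_def fst_conv snd_conv)+
  then show "parallel2 u v"
    by (simp add: parallel2_def)
next
  assume "parallel2 u v"
  then obtain k where k: "u = scale2 k v"
    using parallel2_imp_scale2 assms(2) by blast
  then have "k \<noteq> 0"
    using assms(1) by auto
  then show "direction u = direction v"
    by (simp add: k direction_scale2)
qed

lemma eq_if_parallel2:
  assumes "parallel2 u v" "leading u = 1" "leading v = 1"
  shows "u = v"
proof -
  have "u \<noteq> 0" "v \<noteq> 0"
    using assms(2,3) by (auto simp flip: leading_eq_0_iff)
  then show ?thesis
    using assms direction_eq_iff_parallel2[of u v] by (simp add: direction_eq_self)
qed

lemma parallel2_if_orthogonal:
  fixes u v \<alpha> :: "'k::field vec2"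
  assumes "fst u * fst \<alpha> + snd u * snd \<alpha> = 0" "fst v * fst \<alpha> + snd v * snd \<alpha> = 0" "\<alpha> \<noteq> 0"
  shows "parallel2 u v"
proof -
  have "fst \<alpha> * (fst u * snd v - snd u * fst v)
      = snd v * (fst u * fst \<alpha> + snd u * snd \<alpha>) - snd u * (fst v * fst \<alpha> + snd v * snd \<alpha>)"
    "snd \<alpha> * (fst u * snd v - snd u * fst v)
      = fst u * (fst v * fst \<alpha> + snd v * snd \<alpha>) - fst v * (fst u * fst \<alpha> + snd u * snd \<alpha>)"
    by (simp_all add: algebra_simps)
  then have "fst \<alpha> * (fst u * snd v - snd u * fst v) = 0" "snd \<alpha> * (fst u * snd v - snd u * fst v) = 0"
    by (simp_all add: assms)
  then show ?thesis
    using assms(3) by (auto simp: parallel2_def prod_eq_iff)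
qed

subsection \<open>Reflexive bilinear forms\<close>

locale plane_form =
  fixes w11 w12 w21 w22 \<epsilon> :: "'f::field"
  assumes det: "w11 * w22 - w12 * w21 \<noteq> 0"
    and eps: "w11 = \<epsilon> * w11" "w22 = \<epsilon> * w22" "w12 = \<epsilon> * w21" "w21 = \<epsilon> * w12"
begin

definition covector :: "'f vec2 \<Rightarrow> 'f vec2" where
  "covector v = (w11 * fst v + w12 * snd v, w21 * fst v + w22 * snd v)"

definition form :: "'f vec2 \<Rightarrow> 'f vec2 \<Rightarrow> 'f" where
  "form u v = fst u * fst (covector v) + snd u * snd (covector v)"

definition vals :: "'f vec2 set \<Rightarrow> 'f set" where
  "vals S = (\<lambda>(s, t). form s t) ` (S \<times> S)"

lemma eps_nonzero: "\<epsilon> \<noteq> 0"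
proof
  assume "\<epsilon> = 0"
  then have "w11 = 0" "w22 = 0" "w12 = 0"
    using eps(1-3) by simp_all
  then show False
    using det by simp
qed

lemma form_commute: "form u v = \<epsilon> * form v u"
proof -
  have "\<epsilon> * form v u = (\<epsilon> * w11) * fst u * fst v + (\<epsilon> * w21) * fst u * snd v + (\<epsilon> * w12) * snd u * fst v
      + (\<epsilon> * w22) * snd u * snd v"
    by (simp add: form_def covector_def algebra_simps)
  then show ?thesis
    unfolding eps[symmetric] by (simp add: form_def covector_def algebra_simps)
qed

lemma form_scale2 [simp]: "form (scale2 k u) v = k * form u v" "form u (scale2 k v) = k * form u v"
  by (simp_all add: form_def covector_def scale2_def algebra_simps)

lemma form_diff: "form (u - v) w = form u w - form v w" "form w (u - v) = form w u - form w v"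
  by (simp_all add: form_def covector_def algebra_simps)

lemma covector_scale2: "covector (scale2 k v) = scale2 k (covector v)"
  by (simp add: covector_def scale2_def algebra_simps)

lemma covector_surj: "\<exists>v. covector v = \<alpha>"
proof -
  let ?d = "w11 * w22 - w12 * w21" and ?v = "(w22 * fst \<alpha> - w12 * snd \<alpha>, w11 * snd \<alpha> - w21 * fst \<alpha>)"
  have "covector ?v = scale2 ?d \<alpha>"
    by (simp add: covector_def scale2_def algebra_simps)
  then have "covector (scale2 (inverse ?d) ?v) = \<alpha>"
    using det by (simp only: covector_scale2 scale2_scale2 left_inverse scale2_1) simp
  then show ?thesis
    by blast
qed

lemma covector_eq_0_iff: "covector v = 0 \<longleftrightarrow> v = 0"
proof
  assume "covector v = 0"
  then have "w11 * fst v + w12 * snd v = 0" "w21 * fst v + w22 * snd v = 0"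
    by (simp_all add: covector_def prod_eq_iff)
  moreover have "(w11 * w22 - w12 * w21) * fst v
    = w22 * (w11 * fst v + w12 * snd v) - w12 * (w21 * fst v + w22 * snd v)"
    "(w11 * w22 - w12 * w21) * snd v = w11 * (w21 * fst v + w22 * snd v) - w21 * (w11 * fst v + w12 * snd v)"
    by (simp_all add: algebra_simps)
  ultimately show "v = 0"
    using det by (simp add: prod_eq_iff)
qed (simp add: covector_def zero_prod_def)

lemma parallel2_if_form_eq_0:
  assumes "form u x = 0" "form v x = 0" "x \<noteq> 0"
  shows "parallel2 u v"
  using assms by (intro parallel2_if_orthogonal[of _ "covector x"]) (simp_all add: form_def covector_eq_0_iff)

lemma parallel2_if_form_eq_0':
  assumes "form x u = 0" "form x v = 0" "x \<noteq> 0"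
  shows "parallel2 u v"
  using assms form_commute[of u x] form_commute[of v x] by (intro parallel2_if_form_eq_0[of u x]) simp_all

lemma finite_vals: "finite S \<Longrightarrow> finite (vals S)"
  by (simp add: vals_def)

lemma form_in_vals: "s \<in> S \<Longrightarrow> t \<in> S \<Longrightarrow> form s t \<in> vals S"
  by (force simp: vals_def)

lemma card_vals_mono: "finite T \<Longrightarrow> S \<subseteq> T \<Longrightarrow> card (vals S) \<le> card (vals T)"
  by (intro card_mono finite_vals) (auto simp: vals_def)

end

subsection \<open>Collisions\<close>

lemma sum_over_fibres:
  fixes g :: "'b \<Rightarrow> nat"
  assumes "finite A"
  shows "(\<Sum>x\<in>A. g (f x)) = (\<Sum>y\<in>f ` A. card {x \<in> A. f x = y} * g y)"
proof -
  have "(\<Sum>x\<in>A. g (f x)) = (\<Sum>y\<in>f ` A. \<Sum>x\<in>{x \<in> A. f x = y}. g (f x))"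
    by (rule sum.image_gen[OF assms])
  also have "\<dots> = (\<Sum>y\<in>f ` A. card {x \<in> A. f x = y} * g y)"
    by (intro sum.cong refl) simp
  finally show ?thesis .
qed

lemma edges_eq_card:
  assumes "finite A" "finite B"
  shows "edges E A B = card {z \<in> A \<times> B. E (fst z) (snd z)}"
proof -
  have "{z \<in> A \<times> B. E (fst z) (snd z)} = (SIGMA a:A. {b \<in> B. E a b})"
    by auto
  then show ?thesis
    using assms by (simp add: edges_def)
qed

lemma card_square_le_collisions:
  assumes "finite A" "finite W" "g ` A \<subseteq> W"
  shows "(card A)\<^sup>2 \<le> card W * edges (\<lambda>x y. g x = g y) A A"
proof -
  define n where "n w = card {x \<in> A. g x = w}" for w
  have "card A = (\<Sum>w\<in>g ` A. n w)"
    using sum_over_fibres[OF assms(1), of "\<lambda>_. 1" g] by (simp add: n_def)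
  then have "(real (card A))\<^sup>2 \<le> (\<Sum>w\<in>g ` A. (real (n w))\<^sup>2) * card (g ` A)"
    using sum_squared_le_sum_of_squares[of "\<lambda>w. real (n w)" "g ` A"] by simp
  also have "(\<Sum>w\<in>g ` A. (real (n w))\<^sup>2) = real (edges (\<lambda>x y. g x = g y) A A)"
    using sum_over_fibres[OF assms(1), of n g]
    by (simp add: edges_def n_def power2_eq_square eq_commute)
  finally have "real ((card A)\<^sup>2) \<le> real (edges (\<lambda>x y. g x = g y) A A * card (g ` A))"
    by simp
  then have "(card A)\<^sup>2 \<le> edges (\<lambda>x y. g x = g y) A A * card (g ` A)"
    by (simp only: of_nat_le_iff)
  also have "\<dots> \<le> edges (\<lambda>x y. g x = g y) A A * card W"
    by (rule mult_le_mono2[OF card_mono[OF assms(2,3)]])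
  finally show ?thesis
    by (simp add: mult.commute)
qed

context plane_form
begin

text \<open>The fibres of \<open>form s\<close> are parallel lines whose direction determines the direction of \<open>s\<close>.\<close>

lemma card_common_fibre_le:
  assumes T: "finite T" "0 \<notin> T" "inj_on direction T" and "x \<noteq> y"
  shows "card {s \<in> T. form s x = form s y} \<le> 1"
proof -
  have "s = s'" if s: "s \<in> T" "form s x = form s y" and s': "s' \<in> T" "form s' x = form s' y" for s s'
  proof -
    have "parallel2 s s'"
      using s s' \<open>x \<noteq> y\<close> by (intro parallel2_if_form_eq_0[of s "x - y"]) (simp_all add: form_diff)
    then have "direction s = direction s'"
      using s(1) s'(1) T(2) by (subst direction_eq_iff_parallel2) auto
    then show ?thesis
      using T(3) s(1) s'(1) by (auto dest: inj_onD)
  qed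
  then show ?thesis
    using T(1) card_le_Suc0_iff_eq[of "{s \<in> T. form s x = form s y}"] by auto
qed

lemma card_le_twice_vals:
  assumes T: "finite T" "0 \<notin> T" "inj_on direction T"
  shows "card T \<le> 2 * card (vals T)"
proof (cases "T = {}")
  case False
  define n where "n = card T"
  define E where "E s z \<longleftrightarrow> form s (fst z) = form s (snd z)" for s z
  have collisions: "edges (\<lambda>x y. form s x = form s y) T T = card {z \<in> T \<times> T. E s z}" for s
    using T(1) by (simp add: edges_eq_card E_def)
  have "n * n\<^sup>2 = (\<Sum>s\<in>T. n\<^sup>2)"
    by (simp add: n_def)
  also have "\<dots> \<le> (\<Sum>s\<in>T. card (vals T) * edges (\<lambda>x y. form s x = form s y) T T)"
    unfolding n_def using T(1)
    by (intro sum_mono card_square_le_collisions finite_vals) (auto intro: form_in_vals)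
  also have "\<dots> = card (vals T) * edges E T (T \<times> T)"
    unfolding collisions by (simp add: edges_def sum_distrib_left)
  also have "edges E T (T \<times> T) = (\<Sum>z\<in>T \<times> T. card {s \<in> T. E s z})"
    using edges_swap[of T "T \<times> T" E] T(1) by (simp add: edges_def)
  also have "\<dots> \<le> (\<Sum>z\<in>T \<times> T. 1 + (if fst z = snd z then n else 0))"
  proof (rule sum_mono)
    fix z
    have "card {s \<in> T. E s z} \<le> n"
      unfolding n_def using T(1) by (intro card_mono) auto
    then show "card {s \<in> T. E s z} \<le> 1 + (if fst z = snd z then n else 0)"
      using card_common_fibre_le[OF T, of "fst z" "snd z"] by (auto simp: E_def)
  qed
  also have "\<dots> = n * n + (\<Sum>x\<in>T. \<Sum>y\<in>T. if x = y then n else 0)"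
    by (simp only: sum.distrib) (simp add: card_cartesian_product n_def sum.cartesian_product case_prod_beta)
  also have "\<dots> = n * n + n * n"
    using T(1) by (simp add: n_def)
  finally have "n * n\<^sup>2 \<le> card (vals T) * (n * n + n * n)"
    by (simp add: mult_le_mono2)
  moreover have "n * n\<^sup>2 = (n * n) * n" "card (vals T) * (n * n + n * n) = (n * n) * (2 * card (vals T))"
    by (simp_all add: power2_eq_square algebra_simps)
  ultimately have "(n * n) * n \<le> (n * n) * (2 * card (vals T))"
    by (simp only:)
  moreover have "n > 0"
    using False T(1) by (simp add: n_def card_gt_0_iff)
  ultimately have "n \<le> 2 * card (vals T)"
    by (simp only: mult_le_cancel1 nat_0_less_mult_iff simp_thms)
  then show ?thesis
    by (simp add: n_def)
qed simp

subsection \<open>Quadruples with equal values\<close>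

text \<open>A pair \<open>(s, t)\<close> is normalized by scaling both vectors, which preserves the relation \<open>equal_vals\<close>.\<close>

definition normalized_pairs :: "'f vec2 set \<Rightarrow> ('f vec2 \<times> 'f vec2) set" where
  "normalized_pairs \<Delta> = {q. fst q \<in> \<Delta> \<and> leading (fst q) = 1 \<and> snd q \<noteq> 0 \<and> direction (snd q) \<in> \<Delta>}"

definition equal_vals :: "'f vec2 \<times> 'f vec2 \<Rightarrow> 'f vec2 \<times> 'f vec2 \<Rightarrow> bool" where
  "equal_vals q r \<longleftrightarrow> form (fst q) (fst r) = form (snd q) (snd r) \<and> form (fst q) (fst r) \<noteq> 0"

lemma equal_vals_commute: "equal_vals q r \<longleftrightarrow> equal_vals r q"
  unfolding equal_vals_def form_commute[of "fst q"] form_commute[of "snd q"] using eps_nonzero by auto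

lemma inj_on_direction_snd:
  assumes N: "N \<subseteq> normalized_pairs \<Delta>" "\<And>r. r \<in> N \<Longrightarrow> equal_vals q r" and same: "\<And>r. r \<in> N \<Longrightarrow> fst r = s"
  shows "inj_on (\<lambda>r. direction (snd r)) N"
proof (rule inj_onI)
  fix r r'
  assume r: "r \<in> N" "r' \<in> N" "direction (snd r) = direction (snd r')"
  have val: "form u v = leading v * form u (direction v)" for u v
    using form_scale2(2)[of u "leading v" "direction v"] by (simp only: scale2_leading_direction)
  have "form (snd q) (snd r) = form (snd q) (snd r')" "form (snd q) (snd r) \<noteq> 0"
    using N(2)[OF r(1)] N(2)[OF r(2)] same[OF r(1)] same[OF r(2)] by (auto simp: equal_vals_def)
  then have "leading (snd r) = leading (snd r')"
    unfolding val[of _ "snd r"] val[of _ "snd r'"] using r(3) by auto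
  then have "snd r = snd r'"
    using r(3) scale2_leading_direction by metis
  then show "r = r'"
    using same[OF r(1)] same[OF r(2)] by (simp add: prod_eq_iff)
qed

lemma card_common_neighbours_le:
  assumes fin: "finite \<Delta>" and t: "t \<noteq> 0"
    and indep: "\<And>k. \<not> (\<gamma> = scale2 k s \<and> \<delta> = scale2 k t)"
    and N: "N \<subseteq> normalized_pairs \<Delta>" "\<And>r. r \<in> N \<Longrightarrow> equal_vals (s, t) r"
      "\<And>r. r \<in> N \<Longrightarrow> form \<gamma> (fst r) = form \<delta> (snd r)"
  shows "card N \<le> card \<Delta>"
proof (cases "inj_on fst N")
  case True
  moreover have "fst ` N \<subseteq> \<Delta>"
    using N(1) by (auto simp: normalized_pairs_def)
  ultimately show ?thesis
    using fin card_inj_on_le by blast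
next
  case False
  then obtain q q' where q: "q \<in> N" "q' \<in> N" "fst q = fst q'" "q \<noteq> q'"
    unfolding inj_on_def by blast
  have "form \<delta> (snd q - snd q') = 0" "form t (snd q - snd q') = 0"
    using N(2,3)[OF q(1)] N(2,3)[OF q(2)] q(3) by (simp_all add: form_diff equal_vals_def)
  moreover have "snd q - snd q' \<noteq> 0"
    using q(3,4) by (simp add: prod_eq_iff)
  ultimately have "parallel2 \<delta> t"
    by (rule parallel2_if_form_eq_0)
  then obtain k where k: "\<delta> = scale2 k t"
    using parallel2_imp_scale2 t by blast
  then have "\<gamma> - scale2 k s \<noteq> 0"
    using indep[of k] by auto
  moreover have "form (\<gamma> - scale2 k s) (fst r) = 0" if "r \<in> N" for r
    using N(2,3)[OF that] by (simp add: form_diff k equal_vals_def)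
  ultimately have "parallel2 (fst r) (fst q)" if "r \<in> N" for r
    using that q(1) by (intro parallel2_if_form_eq_0'[of "\<gamma> - scale2 k s"]) auto
  then have "fst r = fst q" if "r \<in> N" for r
    using that q(1) N(1) by (intro eq_if_parallel2) (auto simp: normalized_pairs_def)
  then have "inj_on (\<lambda>r. direction (snd r)) N"
    using N(1,2) by (intro inj_on_direction_snd)
  moreover have "(\<lambda>r. direction (snd r)) ` N \<subseteq> \<Delta>"
    using N(1) by (auto simp: normalized_pairs_def)
  ultimately show ?thesis
    using fin card_inj_on_le by blast
qed

definition point_of :: "'f vec2 \<times> 'f vec2 \<Rightarrow> 'f vec4" where
  "point_of q = (fst (fst q), snd (fst q), fst (snd q), snd (snd q))"

definition normal_of :: "'f vec2 \<times> 'f vec2 \<Rightarrow> 'f vec4" where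
  "normal_of q = point_of (covector (fst q), - covector (snd q))"

lemma dot4_point_of_normal_of: "dot4 (point_of q) (normal_of r) = form (fst q) (fst r) - form (snd q) (snd r)"
  by (simp only: point_of_def normal_of_def form_def dot4.simps fst_conv snd_conv fst_uminus snd_uminus)
    (simp add: algebra_simps)

lemma point_of_surj: "\<exists>q. point_of q = v"
  by (cases v) (auto simp: point_of_def)

lemma normal_of_surj: "\<exists>q. normal_of q = v"
proof -
  obtain \<alpha> \<beta> where v: "v = point_of (\<alpha>, \<beta>)"
    using point_of_surj by (metis surj_pair)
  obtain s t where "covector s = \<alpha>" "covector t = - \<beta>"
    using covector_surj by metis
  then show ?thesis
    by (intro exI[of _ "(s, t)"]) (simp add: normal_of_def v)
qed

lemma point_of_scale2: "point_of (scale2 k (fst q), scale2 k (snd q)) = scale4 k (point_of q)"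
  by (simp only: point_of_def scale2_def scale4.simps fst_conv snd_conv)

lemma normal_of_scale2: "normal_of (scale2 k (fst q), scale2 k (snd q)) = scale4 k (normal_of q)"
  by (simp add: normal_of_def point_of_def covector_scale2) (simp add: scale2_def)

lemma inj_point_of: "inj point_of"
  by (auto simp: inj_def point_of_def prod_eq_iff)

lemma inj_normal_of: "inj normal_of"
proof -
  have "inj covector"
  proof (rule injI)
    fix u v
    assume "covector u = covector v"
    then have "covector (u - v) = 0"
      by (simp add: covector_def prod_eq_iff algebra_simps)
    then show "u = v"
      by (simp add: covector_eq_0_iff)
  qed
  show ?thesis
  proof (rule injI)
    fix q r
    assume "normal_of q = normal_of r"
    then have "covector (fst q) = covector (fst r)" "covector (snd q) = covector (snd r)"
      by (simp_all add: normal_of_def inj_point_of[THEN inj_eq])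
    then show "q = r"
      using \<open>inj covector\<close> by (auto simp: inj_eq intro: prod_eqI)
  qed
qed

lemma projectively_distinct_normalized_pairs:
  assumes A: "A \<subseteq> normalized_pairs \<Delta>" and "inj p"
    and p: "\<And>k q. p (scale2 k (fst q), scale2 k (snd q)) = scale4 k (p q)"
  shows "projectively_distinct p A"
  unfolding projectively_distinct_def indep4_def
proof (intro ballI conjI allI)
  have nonzero: "p q \<noteq> 0" if "q \<in> A" for q
  proof
    assume "p q = 0"
    then have "p q = p (scale2 0 (fst q), scale2 0 (snd q))"
      unfolding p by (cases "p q") (simp add: zero_prod_def)
    then have "q = (scale2 0 (fst q), scale2 0 (snd q))"
      using \<open>inj p\<close> by (simp only: inj_eq)
    then have "snd q = 0"
      by (metis scale2_eq_0_iff snd_conv)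
    then show False
      using that A by (auto simp: normalized_pairs_def)
  qed
  then show "p q \<noteq> 0" if "q \<in> A" for q
    using that .
  show "p q \<noteq> 0" if "q \<in> A - {r}" for q r
    using that nonzero by blast
  show "p q \<noteq> scale4 k (p r)" if "q \<in> A" "r \<in> A - {q}" for q r k
  proof
    assume "p q = scale4 k (p r)"
    then have "q = (scale2 k (fst r), scale2 k (snd r))"
      unfolding p[symmetric] using \<open>inj p\<close> by (simp only: inj_eq)
    then have "fst q = scale2 k (fst r)" "snd q = scale2 k (snd r)"
      by (metis fst_conv, metis snd_conv)
    moreover have "leading (fst q) = 1" "leading (fst r) = 1"
      using that A by (auto simp: normalized_pairs_def)
    ultimately have "fst q = scale2 k (fst r)" "snd q = scale2 k (snd r)" "k = 1"
      by (simp_all add: leading_scale2)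
    then show False
      using that by (simp add: prod_eq_iff)
  qed
qed

lemma edges_equal_vals_le:
  assumes inf: "infinite (UNIV :: 'f set)" and fin: "finite \<Delta>" "finite A" "finite B"
    and A: "A \<subseteq> normalized_pairs \<Delta>" and B: "B \<subseteq> normalized_pairs \<Delta>"
    and m: "3 * card A \<le> (m + 1)\<^sup>2" "6 * m < CHAR('f)"
  shows "edges equal_vals A B \<le> (15 * m + card \<Delta>) * (card A + card B)"
proof (rule point_plane_incidence_bound[OF inf fin(2,3), of point_of normal_of])
  show "projectively_distinct point_of A" "projectively_distinct normal_of B"
    using projectively_distinct_normalized_pairs[OF A inj_point_of point_of_scale2]
      projectively_distinct_normalized_pairs[OF B inj_normal_of normal_of_scale2] by auto
  show "dot4 (point_of q) (normal_of r) = 0" if "equal_vals q r" for q r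
    using that by (simp add: dot4_point_of_normal_of equal_vals_def)
next
  fix q c
  assume q: "q \<in> A" and c: "\<And>k. c \<noteq> scale4 k (point_of q)"
  obtain g where g: "c = point_of g"
    using point_of_surj by metis
  show "card {r \<in> B. equal_vals q r \<and> dot4 c (normal_of r) = 0} \<le> card \<Delta>"
  proof (rule card_common_neighbours_le[OF fin(1)])
    show "snd q \<noteq> 0" "{r \<in> B. equal_vals q r \<and> dot4 c (normal_of r) = 0} \<subseteq> normalized_pairs \<Delta>"
      using q A B by (auto simp: normalized_pairs_def)
    show "\<not> (fst g = scale2 k (fst q) \<and> snd g = scale2 k (snd q))" for k
      using c[of k] point_of_scale2[of k q] by (metis g prod.collapse)
  qed (simp_all add: g dot4_point_of_normal_of)
next
  fix q c
  assume q: "q \<in> B" and c: "\<And>k. c \<noteq> scale4 k (normal_of q)"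
  obtain g where g: "c = normal_of g"
    using normal_of_surj by metis
  show "card {r \<in> A. equal_vals r q \<and> dot4 c (point_of r) = 0} \<le> card \<Delta>"
  proof (rule card_common_neighbours_le[OF fin(1)])
    show "snd q \<noteq> 0" "{r \<in> A. equal_vals r q \<and> dot4 c (point_of r) = 0} \<subseteq> normalized_pairs \<Delta>"
      using q A B by (auto simp: normalized_pairs_def)
    show "\<not> (fst g = scale2 k (fst q) \<and> snd g = scale2 k (snd q))" for k
      using c[of k] normal_of_scale2[of k q] by (metis g prod.collapse)
    show "equal_vals (fst q, snd q) r" if "r \<in> {r \<in> A. equal_vals r q \<and> dot4 c (point_of r) = 0}" for r
      using that by (simp add: equal_vals_commute[of q])
    show "form (fst g) (fst r) = form (snd g) (snd r)"
      if "r \<in> {r \<in> A. equal_vals r q \<and> dot4 c (point_of r) = 0}" for r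
      using that by (simp add: g dot4_commute[of "normal_of g"] dot4_point_of_normal_of
          form_commute[of "fst g"] form_commute[of "snd g"])
  qed
qed (rule m)+

end

subsection \<open>Popular values\<close>

lemma sum_layers:
  fixes w h :: "'b \<Rightarrow> nat"
  assumes "finite B" "\<And>q. q \<in> B \<Longrightarrow> w q \<le> k"
  shows "(\<Sum>q\<in>B. w q * h q) = (\<Sum>i=1..k. \<Sum>q\<in>{q \<in> B. i \<le> w q}. h q)"
proof -
  have "(\<Sum>i=1..k. \<Sum>q\<in>{q \<in> B. i \<le> w q}. h q) = (\<Sum>q\<in>B. \<Sum>i\<in>{i \<in> {1..k}. i \<le> w q}. h q)"
    using assms(1) by (intro sum.swap_restrict) auto
  also have "\<dots> = (\<Sum>q\<in>B. w q * h q)"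
  proof (intro sum.cong refl)
    fix q
    assume "q \<in> B"
    then have "{i \<in> {1..k}. i \<le> w q} = {1..w q}"
      using assms(2)[of q] by auto
    then show "(\<Sum>i\<in>{i \<in> {1..k}. i \<le> w q}. h q) = w q * h q"
      by simp
  qed
  finally show ?thesis ..
qed

definition popular :: "('a \<Rightarrow> 'b) \<Rightarrow> 'a set \<Rightarrow> nat \<Rightarrow> 'b set" where
  "popular f A i = {q \<in> f ` A. i \<le> card {x \<in> A. f x = q}}"

lemma finite_popular: "finite A \<Longrightarrow> finite (popular f A i)"
  by (simp add: popular_def)

lemma sum_over_popular:
  fixes h :: "'b \<Rightarrow> nat"
  assumes "finite A" "\<And>q. q \<in> f ` A \<Longrightarrow> card {x \<in> A. f x = q} \<le> k"
  shows "(\<Sum>x\<in>A. h (f x)) = (\<Sum>i=1..k. sum h (popular f A i))"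
  unfolding popular_def sum_over_fibres[OF assms(1), of h f]
  using assms by (intro sum_layers[of "f ` A" "\<lambda>q. card {x \<in> A. f x = q}"]) auto

lemma sum_card_popular:
  assumes "finite A" "\<And>q. q \<in> f ` A \<Longrightarrow> card {x \<in> A. f x = q} \<le> k"
  shows "(\<Sum>i=1..k. card (popular f A i)) = card A"
  using sum_over_popular[of A f k "\<lambda>_. 1"] assms by simp

lemma mult_card_popular_le:
  assumes "finite A"
  shows "i * card (popular f A i) \<le> card A"
proof -
  have "i * card (popular f A i) = (\<Sum>q\<in>popular f A i. i)"
    by simp
  also have "\<dots> \<le> (\<Sum>q\<in>popular f A i. card {x \<in> A. f x = q})"
    by (rule sum_mono) (simp add: popular_def)
  also have "\<dots> \<le> (\<Sum>q\<in>f ` A. card {x \<in> A. f x = q})"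
    using assms by (intro sum_mono2) (auto simp: popular_def)
  also have "\<dots> = card A"
    using sum_over_fibres[OF assms, of "\<lambda>_. 1" f] by simp
  finally show ?thesis .
qed

lemma edges_popular:
  fixes f :: "'a \<Rightarrow> 'b"
  assumes "finite A" and R: "\<And>x y. \<lbrakk>x \<in> A; y \<in> A\<rbrakk> \<Longrightarrow> R' (f x) (f y) = R x y"
    and k: "\<And>q. q \<in> f ` A \<Longrightarrow> card {x \<in> A. f x = q} \<le> k"
  shows "edges R A A = (\<Sum>i=1..k. \<Sum>j=1..k. edges R' (popular f A i) (popular f A j))"
proof -
  note fibre_sum = sum_over_popular[OF assms(1) k]
  have degree: "card {y \<in> A. R' q (f y)} = (\<Sum>j=1..k. card {q' \<in> popular f A j. R' q q'})" for q
    using fibre_sum[where h = "\<lambda>q'. of_bool (R' q q')"]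
    by (simp add: finite_popular assms(1) of_bool_def sum.If_cases Int_def)
  have "edges R A A = (\<Sum>x\<in>A. card {y \<in> A. R' (f x) (f y)})"
    unfolding edges_def using R by (intro sum.cong arg_cong[of _ _ card]) auto
  also have "\<dots> = (\<Sum>i=1..k. \<Sum>q\<in>popular f A i. \<Sum>j=1..k. card {q' \<in> popular f A j. R' q q'})"
    unfolding degree by (rule fibre_sum)
  also have "\<dots> = (\<Sum>i=1..k. \<Sum>j=1..k. edges R' (popular f A i) (popular f A j))"
    unfolding edges_def by (intro sum.cong refl sum.swap)
  finally show ?thesis .
qed

lemma exists_subset_with_uniform_fibres:
  assumes D: "D \<subseteq> popular f A k" and "1 \<le> k"
  shows "\<exists>U\<subseteq>A. f ` U = D \<and> (\<forall>d\<in>D. card {x \<in> U. f x = d} = k)"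
proof -
  have "\<exists>W\<subseteq>{x \<in> A. f x = d}. card W = k" if "d \<in> D" for d
  proof -
    have "k \<le> card {x \<in> A. f x = d}"
      using that D by (auto simp: popular_def)
    then show ?thesis
      by (meson obtain_subset_with_card_n)
  qed
  then obtain W where W: "\<And>d. d \<in> D \<Longrightarrow> W d \<subseteq> {x \<in> A. f x = d}" "\<And>d. d \<in> D \<Longrightarrow> card (W d) = k"
    by metis
  define U where "U = (\<Union>d\<in>D. W d)"
  have fibre: "{x \<in> U. f x = d} = W d" if "d \<in> D" for d
    using W(1) that unfolding U_def by blast
  have "W d \<noteq> {}" if "d \<in> D" for d
    using W(2)[OF that] \<open>1 \<le> k\<close> by auto
  then have "f ` U = D"
    using W(1) unfolding U_def by fast
  moreover have "U \<subseteq> A"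
    using W(1) unfolding U_def by blast
  ultimately show ?thesis
    using fibre W(2) by (intro exI[of _ U]) auto
qed

lemma subset_with_large_sum:
  fixes g :: "'a \<Rightarrow> nat"
  assumes "finite A" "m \<le> card A"
  shows "\<exists>B\<subseteq>A. card B = m \<and> m * sum g A \<le> card A * sum g B"
  using assms
proof (induction "card A" arbitrary: A)
  case (Suc c)
  show ?case
  proof (cases "m = card A")
    case False
    define a where "a = arg_min_on g A"
    have "A \<noteq> {}"
      using Suc.hyps by auto
    then have a: "a \<in> A" "\<And>x. x \<in> A \<Longrightarrow> g a \<le> g x"
      using arg_min_if_finite(1)[OF Suc.prems(1)] arg_min_least[OF Suc.prems(1)] by (auto simp: a_def)
    have card: "card (A - {a}) = c"
      using Suc.hyps Suc.prems a(1) by simp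
    obtain B where B: "B \<subseteq> A - {a}" "card B = m" "m * sum g (A - {a}) \<le> c * sum g B"
      using Suc.hyps(1)[of "A - {a}"] Suc.hyps(2) Suc.prems card False by auto
    have "c * g a \<le> sum g (A - {a})"
      using sum_mono[of "A - {a}" "\<lambda>_. g a" g] a card by simp
    then have "c * sum g A \<le> Suc c * sum g (A - {a})"
      using a(1) Suc.prems by (simp add: sum.remove algebra_simps)
    then have "m * (c * sum g A) \<le> m * (Suc c * sum g (A - {a}))"
      by (rule mult_le_mono2)
    also have "\<dots> \<le> Suc c * (c * sum g B)"
      using mult_le_mono2[OF B(3), of "Suc c"] by (simp only: ac_simps)
    finally have "c * (m * sum g A) \<le> c * (Suc c * sum g B)"
      by (simp only: ac_simps)
    moreover have "m \<le> c"
      using False Suc.hyps(2) Suc.prems(2) by simp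
    ultimately have "m * sum g A \<le> card A * sum g B"
      using Suc.hyps(2) by (cases "c = 0") (simp_all only: mult_le_cancel1, auto)
    then show ?thesis
      using B by blast
  qed auto
qed auto

subsection \<open>Counting quadruples with equal values\<close>

context plane_form
begin

lemma edges_equal_vals_small:
  assumes inf: "infinite (UNIV :: 'f set)" and fin: "finite \<Delta>" "finite A" "finite B"
    and sub: "A \<subseteq> normalized_pairs \<Delta>" "B \<subseteq> normalized_pairs \<Delta>"
    and AB: "card A \<le> card B" and char: "108 * card A < CHAR('f)\<^sup>2"
  shows "real (edges equal_vals A B) \<le> 2 * real (card B) * (30 * sqrt (card A) + card \<Delta>)"
proof -
  define x where "x = sqrt (3 * real (card A))"
  define m where "m = nat \<lfloor>x\<rfloor>"
  have x2: "x\<^sup>2 = real (3 * card A)" and "0 \<le> x"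
    by (simp_all add: x_def)
  then have m: "real m \<le> x" "x \<le> real (m + 1)"
    by (simp_all add: m_def, linarith)
  have "x\<^sup>2 \<le> (real (m + 1))\<^sup>2"
    using m(2) \<open>0 \<le> x\<close> by (rule power_mono)
  then have lower: "3 * card A \<le> (m + 1)\<^sup>2"
    unfolding x2 by (simp only: of_nat_power[symmetric] of_nat_le_iff)
  have "(real m)\<^sup>2 \<le> x\<^sup>2"
    using m(1) by (intro power_mono) auto
  then have "m\<^sup>2 \<le> 3 * card A"
    unfolding x2 by (simp only: of_nat_power[symmetric] of_nat_le_iff)
  then have "(6 * m)\<^sup>2 < CHAR('f)\<^sup>2"
    using char by (simp add: power_mult_distrib)
  then have "6 * m < CHAR('f)"
    by (rule power_less_imp_less_base) simp
  then have "edges equal_vals A B \<le> (15 * m + card \<Delta>) * (card A + card B)"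
    by (rule edges_equal_vals_le[OF inf fin sub lower])
  then have "real (edges equal_vals A B) \<le> real ((15 * m + card \<Delta>) * (card A + card B))"
    by (simp only: of_nat_le_iff)
  also have "\<dots> = (15 * real m + card \<Delta>) * (real (card A) + card B)"
    by simp
  also have "\<dots> \<le> (30 * sqrt (card A) + card \<Delta>) * (2 * real (card B))"
  proof -
    have "x \<le> 2 * sqrt (card A)"
      unfolding x_def by (rule real_le_lsqrt) (simp_all add: power_mult_distrib)
    then show ?thesis
      using m(1) AB by (intro mult_mono) auto
  qed
  finally show ?thesis
    by (simp add: mult.commute)
qed

lemma sqrt_add_le_if_square_le:
  fixes p n d :: real
  assumes "15 \<le> p" "p\<^sup>2 \<le> 216 * n" "d \<le> p"
  shows "30 * sqrt n + d \<le> 666 * (n / p)"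
proof -
  have "0 \<le> n"
    using assms(2) zero_le_power2[of p] by linarith
  have "p / 15 \<le> sqrt n"
    using assms(2) \<open>0 \<le> n\<close> by (intro real_le_rsqrt) (simp add: power_divide)
  then have "sqrt n * (p / 15) \<le> sqrt n * sqrt n"
    using \<open>0 \<le> n\<close> by (intro mult_left_mono) auto
  then have "30 * sqrt n \<le> 450 * (n / p)"
    using assms(1) \<open>0 \<le> n\<close> by (simp add: field_simps)
  moreover have "d * p \<le> p * p"
    using assms(1,3) by (intro mult_right_mono) auto
  then have "d * p \<le> 216 * n"
    using assms(2) by (simp add: power2_eq_square)
  then have "d \<le> 216 * (n / p)"
    using assms(1) by (simp add: field_simps)
  ultimately show ?thesis
    by linarith
qed

text \<open>When \<open>A\<close> is too large for the incidence bound, an average subset of about \<open>p\<^sup>2 / 108\<close> elements is not.\<close>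

lemma edges_equal_vals_ordered:
  assumes inf: "infinite (UNIV :: 'f set)" and fin: "finite \<Delta>" "finite A" "finite B"
    and sub: "A \<subseteq> normalized_pairs \<Delta>" "B \<subseteq> normalized_pairs \<Delta>"
    and AB: "card A \<le> card B" and \<Delta>: "card \<Delta> \<le> CHAR('f)" and char: "15 \<le> CHAR('f)"
  shows "real (edges equal_vals A B) \<le> 2 * real (card B) * (30 * sqrt (card A) + card \<Delta>)
    + 1400 * (real (card A) * real (card B)) / CHAR('f)"
proof (cases "108 * card A < CHAR('f)\<^sup>2")
  case True
  have "0 \<le> 1400 * (real (card A) * real (card B)) / CHAR('f)"
    by simp
  then show ?thesis
    using edges_equal_vals_small[OF inf fin sub AB True] by linarith
next
  case False
  define p where "p = real CHAR('f)"
  have p: "15 \<le> p"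
    using char by (simp add: p_def)
  define n where "n = (CHAR('f)\<^sup>2 - 1) div 108"
  have "225 \<le> CHAR('f)\<^sup>2"
    using power_mono[OF char, of 2] by simp
  then have n: "108 * n < CHAR('f)\<^sup>2" "CHAR('f)\<^sup>2 \<le> 216 * n" "0 < n"
    unfolding n_def by linarith+
  have "real (CHAR('f)\<^sup>2) \<le> real (216 * n)"
    using n(2) by (simp only: of_nat_le_iff)
  then have square_le: "p\<^sup>2 \<le> 216 * real n"
    by (simp add: p_def)
  have "n \<le> card A"
    using False n(1) by linarith
  then obtain A0 where A0: "A0 \<subseteq> A" "card A0 = n" "n * edges equal_vals A B \<le> card A * edges equal_vals A0 B"
    unfolding edges_def using subset_with_large_sum[OF fin(2)] by blast
  then have "real (edges equal_vals A0 B) \<le> 2 * real (card B) * (30 * sqrt n + card \<Delta>)"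
    using edges_equal_vals_small[OF inf fin(1) finite_subset[OF A0(1) fin(2)] fin(3) _ sub(2)] sub(1) AB n(1)
      \<open>n \<le> card A\<close> by auto
  note small = mult_left_mono[OF this, of "real (card A)"]
  have "real n * edges equal_vals A B \<le> card A * edges equal_vals A0 B"
    using A0(3) by (simp only: of_nat_mult[symmetric] of_nat_le_iff)
  also have "\<dots> \<le> card A * (2 * real (card B) * (30 * sqrt n + card \<Delta>))"
    using small by simp
  also have "\<dots> \<le> card A * (2 * real (card B) * (666 * (real n / p)))"
    using sqrt_add_le_if_square_le[OF p square_le, of "card \<Delta>"] \<Delta> by (intro mult_left_mono) (auto simp: p_def)
  also have "\<dots> = real n * (1332 * (real (card A) * real (card B)) / p)"
    by simp
  finally have "edges equal_vals A B \<le> 1332 * (real (card A) * real (card B)) / p"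
    using n(3) by (subst (asm) mult_le_cancel_left_pos) auto
  also have "\<dots> \<le> 1400 * (real (card A) * real (card B)) / p"
    using p by (intro divide_right_mono mult_right_mono) auto
  also have "\<dots> \<le> 2 * real (card B) * (30 * sqrt (card A) + card \<Delta>) + \<dots>"
    by simp
  finally show ?thesis
    by (simp add: p_def)
qed

lemma edges_equal_vals_bound:
  assumes inf: "infinite (UNIV :: 'f set)" and fin: "finite \<Delta>" "finite A" "finite B"
    and sub: "A \<subseteq> normalized_pairs \<Delta>" "B \<subseteq> normalized_pairs \<Delta>"
    and \<Delta>: "card \<Delta> \<le> CHAR('f)" and char: "15 \<le> CHAR('f)"
  shows "real (edges equal_vals A B) \<le> 60 * (real (card B) * sqrt (card A) + real (card A) * sqrt (card B))
    + 2 * card \<Delta> * (real (card A) + card B) + 1400 * (real (card A) * real (card B)) / CHAR('f)"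
proof -
  have weaken: "2 * y * (30 * sqrt x + d) \<le> 60 * (y * sqrt x + x * sqrt y) + 2 * d * (x + y)"
    if "0 \<le> x" "0 \<le> y" "0 \<le> d" for x y d :: real
  proof -
    have "60 * (y * sqrt x + x * sqrt y) + 2 * d * (x + y) - 2 * y * (30 * sqrt x + d)
      = 60 * (x * sqrt y) + 2 * (d * x)"
      by (simp add: algebra_simps)
    moreover have "0 \<le> 60 * (x * sqrt y) + 2 * (d * x)"
      using that by simp
    ultimately show ?thesis
      by linarith
  qed
  show ?thesis
  proof (cases "card A \<le> card B")
    case True
    then show ?thesis
      using edges_equal_vals_ordered[OF inf fin sub True \<Delta> char] weaken[of "card A" "card B" "card \<Delta>"] by simp
  next
    case False
    then have BA: "card B \<le> card A"
      by simp
    have "edges equal_vals A B = edges equal_vals B A"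
      using edges_swap[OF fin(2,3), of equal_vals] equal_vals_commute by presburger
    then show ?thesis
      using edges_equal_vals_ordered[OF inf fin(1,3,2) sub(2,1) BA \<Delta> char] weaken[of "card B" "card A" "card \<Delta>"]
      by (simp add: ac_simps)
  qed
qed

end

lemma double_sum_bound_terms:
  fixes a r :: "nat \<Rightarrow> real"
  shows "(\<Sum>i\<in>I. \<Sum>j\<in>I. 60 * (a j * r i + a i * r j) + 2 * D * (a i + a j) + 1400 * (a i * a j) / p)
    = 120 * (sum a I * sum r I) + 4 * D * card I * sum a I + 1400 * (sum a I)\<^sup>2 / p"
proof -
  have swap: "(\<Sum>i\<in>I. \<Sum>j\<in>I. a j * r i) = sum a I * sum r I"
    by (subst sum.swap) (simp only: sum_product)
  have const: "(\<Sum>i\<in>I. \<Sum>j\<in>I. a i) = card I * sum a I" "(\<Sum>i\<in>I. \<Sum>j\<in>I. a j) = card I * sum a I"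
    by (simp_all add: sum_distrib_left)
  have "(\<Sum>i\<in>I. \<Sum>j\<in>I. 60 * (a j * r i + a i * r j) + 2 * D * (a i + a j) + 1400 * (a i * a j) / p)
    = 60 * ((\<Sum>i\<in>I. \<Sum>j\<in>I. a j * r i) + (\<Sum>i\<in>I. \<Sum>j\<in>I. a i * r j))
      + 2 * D * ((\<Sum>i\<in>I. \<Sum>j\<in>I. a i) + (\<Sum>i\<in>I. \<Sum>j\<in>I. a j)) + 1400 / p * (\<Sum>i\<in>I. \<Sum>j\<in>I. a i * a j)"
    unfolding sum_distrib_left sum.distrib[symmetric] by (intro sum.cong refl) simp
  also have "\<dots> = 120 * (sum a I * sum r I) + 4 * D * card I * sum a I + 1400 * (sum a I)\<^sup>2 / p"
    unfolding swap const sum_product[symmetric] by (simp add: power2_eq_square algebra_simps)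
  finally show ?thesis .
qed

lemma sum_inverse_sqrt_le: "(\<Sum>i=1..k. 1 / sqrt (real i)) \<le> 2 * sqrt (real k)"
proof (induction k)
  case (Suc k)
  define a where "a = sqrt (real k)"
  define b where "b = sqrt (real (Suc k))"
  have b: "b > 0" "a \<ge> 0"
    by (auto simp: a_def b_def)
  have "b * b = a * a + 1"
    by (simp add: a_def b_def)
  then have "2 * (a * b) + 1 \<le> 2 * (b * b)"
    using zero_le_square[of "a - b"] by (simp add: algebra_simps)
  then have "1 / b \<le> 2 * b - 2 * a"
    using b by (simp add: field_simps)
  then show ?case
    using Suc.IH by (simp add: a_def b_def)
qed simp

lemma exists_large_layer:
  fixes a :: "nat \<Rightarrow> nat"
  assumes "0 < N" and N: "N \<le> 2 * (\<Sum>j=1..k. a j)" and k: "real k < real N powr (2/3)"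
  shows "\<exists>j\<in>{1..k}. real N powr (2/3) / 4 \<le> real (a j) * sqrt j"
proof (rule ccontr)
  assume small: "\<not> ?thesis"
  define t where "t = real N powr (2/3)"
  have t: "t > 0"
    using \<open>0 < N\<close> by (simp add: t_def)
  have "real (a j) \<le> t / 4 * (1 / sqrt j)" if "j \<in> {1..k}" for j
  proof -
    have "real (a j) * sqrt j \<le> t / 4"
      using small that by (auto simp: t_def not_le intro: less_imp_le)
    then show ?thesis
      using that by (simp add: pos_le_divide_eq)
  qed
  then have "(\<Sum>j=1..k. real (a j)) \<le> (\<Sum>j=1..k. t / 4 * (1 / sqrt j))"
    by (rule sum_mono)
  also have "\<dots> = t / 4 * (\<Sum>j=1..k. 1 / sqrt j)"
    by (simp only: sum_distrib_left)
  also have "\<dots> \<le> t / 4 * (2 * sqrt k)"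
    using t by (intro mult_left_mono sum_inverse_sqrt_le) auto
  finally have "real N \<le> t * sqrt k"
    using N by (simp flip: of_nat_sum)
  also have "\<dots> < t * sqrt t"
    using k t by (simp add: t_def)
  also have "t * sqrt t = t powr 1 * t powr (1/2)"
    using t by (simp add: powr_half_sqrt)
  also have "\<dots> = t powr (3/2)"
    unfolding powr_add[symmetric] by simp
  also have "\<dots> = real N"
    using \<open>0 < N\<close> by (simp add: t_def powr_powr)
  finally show False
    by simp
qed

locale uniform_set = plane_form w11 w12 w21 w22 \<epsilon> for w11 w12 w21 w22 \<epsilon> :: "'f::field" +
  fixes U :: "'f vec2 set" and k :: nat
  assumes infinite_field: "infinite (UNIV :: 'f set)" and char: "15 \<le> CHAR('f)"
    and finite_U: "finite U" and zero_notin: "0 \<notin> U"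
    and fibre: "d \<in> direction ` U \<Longrightarrow> card {s \<in> U. direction s = d} = k"
    and directions: "2 \<le> card (direction ` U)" "card (direction ` U) \<le> CHAR('f)"
begin

definition D where "D = card (direction ` U)"
definition N where "N = card U"

lemma nonzero: "s \<in> U \<Longrightarrow> s \<noteq> 0"
  using zero_notin by auto

lemma N_eq: "N = D * k"
  using sum_over_fibres[OF finite_U, of "\<lambda>_. 1" direction] fibre by (simp add: N_def D_def)

lemma N_pos: "0 < N"
proof -
  have "U \<noteq> {}"
    using directions(1) by auto
  then show ?thesis
    using finite_U by (simp add: N_def card_gt_0_iff)
qed

lemma k_pos: "0 < k" and D_pos: "0 < D"
  using N_pos by (simp_all add: N_eq)

definition normalize_pair :: "'f vec2 \<times> 'f vec2 \<Rightarrow> 'f vec2 \<times> 'f vec2" where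
  "normalize_pair q = (direction (fst q), scale2 (inverse (leading (fst q))) (snd q))"

lemma equal_vals_normalize_pair:
  assumes "q \<in> U \<times> U" "r \<in> U \<times> U"
  shows "equal_vals (normalize_pair q) (normalize_pair r) = equal_vals q r"
proof -
  have "leading (fst q) \<noteq> 0" "leading (fst r) \<noteq> 0"
    using assms nonzero by auto
  then show ?thesis
    by (auto simp: equal_vals_def normalize_pair_def direction_def)
qed

lemma card_normalize_pair_fibre_le:
  assumes "r \<in> normalize_pair ` (U \<times> U)"
  shows "card {q \<in> U \<times> U. normalize_pair q = r} \<le> k"
proof -
  have "inj_on fst {q \<in> U \<times> U. normalize_pair q = r}"
  proof (rule inj_onI)
    fix q q'
    assume q: "q \<in> {q \<in> U \<times> U. normalize_pair q = r}" and q': "q' \<in> {q \<in> U \<times> U. normalize_pair q = r}"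
      and eq: "fst q = fst q'"
    have "leading (fst q) \<noteq> 0"
      using q nonzero by auto
    moreover have "normalize_pair q = normalize_pair q'"
      using q q' by simp
    ultimately have "snd q = snd q'"
      by (auto simp: normalize_pair_def eq)
    then show "q = q'"
      using eq by (simp add: prod_eq_iff)
  qed
  moreover have "fst ` {q \<in> U \<times> U. normalize_pair q = r} \<subseteq> {s \<in> U. direction s = fst r}"
    by (auto simp: normalize_pair_def)
  moreover have "finite {s \<in> U. direction s = fst r}"
    using finite_U by simp
  ultimately have "card {q \<in> U \<times> U. normalize_pair q = r} \<le> card {s \<in> U. direction s = fst r}"
    by (rule card_inj_on_le)
  also have "\<dots> = k"
    using assms by (intro fibre) (auto simp: normalize_pair_def)
  finally show ?thesis .
qed

lemma popular_normalize_pair_subset: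
  "popular normalize_pair (U \<times> U) i \<subseteq> normalized_pairs (direction ` U)"
proof
  fix r
  assume "r \<in> popular normalize_pair (U \<times> U) i"
  then obtain s t where st: "s \<in> U" "t \<in> U" "r = normalize_pair (s, t)"
    by (auto simp: popular_def)
  have "s \<noteq> 0" "t \<noteq> 0"
    using st nonzero by auto
  then show "r \<in> normalized_pairs (direction ` U)"
    using st(1,2)
    by (simp add: st(3) normalize_pair_def normalized_pairs_def leading_direction direction_scale2)
qed

lemma sum_sqrt_card_popular_le:
  "(\<Sum>i=1..k. sqrt (card (popular normalize_pair (U \<times> U) i))) \<le> real N * (2 * sqrt k)"
proof -
  define a where "a i = card (popular normalize_pair (U \<times> U) i)" for i
  have "sqrt (a i) \<le> real N * (1 / sqrt i)" if "i \<in> {1..k}" for i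
  proof -
    have "i * a i \<le> N\<^sup>2"
      using mult_card_popular_le[of "U \<times> U" i normalize_pair] finite_U
      by (simp add: a_def N_def card_cartesian_product power2_eq_square)
    then have "real i * a i \<le> (real N)\<^sup>2"
      by (simp only: of_nat_mult[symmetric] of_nat_power[symmetric] of_nat_le_iff)
    then have "sqrt (real i * a i) \<le> real N"
      by (intro real_le_lsqrt) auto
    then show ?thesis
      using that by (simp add: real_sqrt_mult field_simps)
  qed
  then have "(\<Sum>i=1..k. sqrt (a i)) \<le> (\<Sum>i=1..k. real N * (1 / sqrt i))"
    by (rule sum_mono)
  also have "\<dots> = real N * (\<Sum>i=1..k. 1 / sqrt i)"
    by (simp only: sum_distrib_left)
  also have "\<dots> \<le> real N * (2 * sqrt k)"
    by (rule mult_left_mono[OF sum_inverse_sqrt_le]) simp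
  finally show ?thesis
    by (simp add: a_def)
qed

lemma edges_equal_vals_upper:
  "real (edges equal_vals (U \<times> U) (U \<times> U)) \<le> 244 * (real N ^ 3 * sqrt k) + 1400 * real N ^ 4 / CHAR('f)"
proof -
  define L where "L i = popular normalize_pair (U \<times> U) i" for i
  define a where "a i = real (card (L i))" for i
  have finite: "finite (L i)" for i
    using finite_U by (simp add: L_def finite_popular)
  have sub: "L i \<subseteq> normalized_pairs (direction ` U)" for i
    unfolding L_def by (rule popular_normalize_pair_subset)
  have "(\<Sum>i=1..k. card (L i)) = N\<^sup>2"
    unfolding L_def using finite_U card_normalize_pair_fibre_le
    by (subst sum_card_popular) (auto simp: N_def card_cartesian_product power2_eq_square)
  then have sum_a: "sum a {1..k} = (real N)\<^sup>2"
    by (simp add: a_def flip: of_nat_sum)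
  have "edges equal_vals (U \<times> U) (U \<times> U) = (\<Sum>i=1..k. \<Sum>j=1..k. edges equal_vals (L i) (L j))"
    unfolding L_def using finite_U equal_vals_normalize_pair card_normalize_pair_fibre_le
    by (intro edges_popular) auto
  then have "real (edges equal_vals (U \<times> U) (U \<times> U))
    = (\<Sum>i=1..k. \<Sum>j=1..k. real (edges equal_vals (L i) (L j)))"
    by simp
  also have "\<dots> \<le> (\<Sum>i=1..k. \<Sum>j=1..k. 60 * (a j * sqrt (a i) + a i * sqrt (a j)) + 2 * real D * (a i + a j)
      + 1400 * (a i * a j) / CHAR('f))"
    unfolding a_def D_def
    using edges_equal_vals_bound[OF infinite_field finite_imageI[OF finite_U] finite finite sub sub directions(2) char]
    by (intro sum_mono) simp
  also have "\<dots> = 120 * (sum a {1..k} * (\<Sum>i=1..k. sqrt (a i))) + 4 * real D * real (card {1..k}) * sum a {1..k}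
      + 1400 * (sum a {1..k})\<^sup>2 / CHAR('f)"
    by (rule double_sum_bound_terms)
  also have "\<dots>
    \<le> 120 * ((real N)\<^sup>2 * (real N * (2 * sqrt k))) + 4 * real N ^ 3 + 1400 * ((real N)\<^sup>2)\<^sup>2 / CHAR('f)"
  proof -
    have "4 * real D * real (card {1..k}) * (real N)\<^sup>2 = 4 * real N ^ 3"
      by (simp add: N_eq power2_eq_square power3_eq_cube)
    moreover have "(real N)\<^sup>2 * (\<Sum>i=1..k. sqrt (a i)) \<le> (real N)\<^sup>2 * (real N * (2 * sqrt k))"
      using sum_sqrt_card_popular_le by (intro mult_left_mono) (simp_all add: a_def L_def)
    ultimately show ?thesis
      unfolding sum_a by linarith
  qed
  also have "\<dots> \<le> 244 * (real N ^ 3 * sqrt k) + 1400 * real N ^ 4 / CHAR('f)"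
  proof -
    have "1 \<le> sqrt k"
      using k_pos by simp
    then have "real N ^ 3 \<le> real N ^ 3 * sqrt k"
      using mult_left_mono[of 1 "sqrt k" "real N ^ 3"] by simp
    then show ?thesis
      by (simp add: power2_eq_square power3_eq_cube power4_eq_xxxx algebra_simps)
  qed
  finally show ?thesis .
qed

lemma card_nonorthogonal:
  assumes s: "s \<in> U"
  shows "N \<le> 2 * card {t \<in> U. form s t \<noteq> 0}"
proof -
  have "card {t \<in> U. form s t = 0} \<le> k"
  proof (cases "{t \<in> U. form s t = 0} = {}")
    case True
    then show ?thesis
      by (simp only: card.empty)
  next
    case False
    then obtain t0 where t0: "t0 \<in> U" "form s t0 = 0"
      by blast
    have "direction t = direction t0" if "t \<in> U" "form s t = 0" for t
      using parallel2_if_form_eq_0'[OF that(2) t0(2) nonzero[OF s]]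
      by (simp add: direction_eq_iff_parallel2 nonzero that(1) t0(1))
    then have "card {t \<in> U. form s t = 0} \<le> card {t \<in> U. direction t = direction t0}"
      using finite_U by (intro card_mono) auto
    also have "\<dots> = k"
      using t0 by (intro fibre) auto
    finally show ?thesis .
  qed
  moreover have "2 * k \<le> N"
    unfolding N_eq using directions(1) by (intro mult_le_mono1) (simp add: D_def)
  moreover have "N = card ({t \<in> U. form s t = 0} \<union> {t \<in> U. form s t \<noteq> 0})"
    unfolding N_def by (rule arg_cong[of _ _ card]) auto
  then have "N \<le> card {t \<in> U. form s t = 0} + card {t \<in> U. form s t \<noteq> 0}"
    using card_Un_le[of "{t \<in> U. form s t = 0}" "{t \<in> U. form s t \<noteq> 0}"] by (rule ord_eq_le_trans)
  ultimately show ?thesis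
    by linarith
qed

lemma edges_equal_vals_lower: "N ^ 4 \<le> 4 * (card (vals U) * edges equal_vals (U \<times> U) (U \<times> U))"
proof -
  define Z where "Z = {z \<in> U \<times> U. form (fst z) (snd z) \<noteq> 0}"
  define E where "E = (\<lambda>x y. form (fst x) (snd x) = form (fst y) (snd y))"
  have Z: "finite Z" "card Z = edges (\<lambda>s t. form s t \<noteq> 0) U U"
    using finite_U by (simp_all add: Z_def edges_eq_card)
  have "(\<Sum>s\<in>U. N) \<le> (\<Sum>s\<in>U. 2 * card {t \<in> U. form s t \<noteq> 0})"
    by (rule sum_mono) (rule card_nonorthogonal)
  then have "N\<^sup>2 \<le> 2 * card Z"
    by (simp add: Z(2) edges_def sum_distrib_left N_def power2_eq_square)
  then have "(N\<^sup>2)\<^sup>2 \<le> (2 * card Z)\<^sup>2"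
    by (rule power_mono) simp
  also have "\<dots> = 4 * (card Z)\<^sup>2"
    by (simp add: power_mult_distrib)
  also have "(card Z)\<^sup>2 \<le> card (vals U) * edges E Z Z"
    unfolding E_def using finite_U Z(1)
    by (intro card_square_le_collisions finite_vals) (auto simp: Z_def intro: form_in_vals)
  also have "edges E Z Z \<le> edges equal_vals (U \<times> U) (U \<times> U)"
  proof -
    let ?f = "\<lambda>z. ((fst (fst z), fst (snd z)), (snd (fst z), snd (snd z)))"
    have "inj_on ?f {z \<in> Z \<times> Z. E (fst z) (snd z)}"
      by (rule inj_onI) (simp add: prod_eq_iff)
    moreover have "?f ` {z \<in> Z \<times> Z. E (fst z) (snd z)} \<subseteq> {z \<in> (U \<times> U) \<times> (U \<times> U). equal_vals (fst z) (snd z)}"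
      by (auto simp: Z_def E_def equal_vals_def)
    ultimately have "card {z \<in> Z \<times> Z. E (fst z) (snd z)}
        \<le> card {z \<in> (U \<times> U) \<times> (U \<times> U). equal_vals (fst z) (snd z)}"
      using finite_U by (intro card_inj_on_le) auto
    then show ?thesis
      using finite_U Z(1) by (simp add: edges_eq_card)
  qed
  finally show ?thesis
    by (simp flip: power_mult)
qed

lemma vals_lower_bound_uniform: "min (D * sqrt k) CHAR('f) \<le> 6576 * real (card (vals U))"
proof -
  define V where "V = real (card (vals U))"
  define p where "p = real CHAR('f)"
  define M where "M = min (D * sqrt k) p"
  have pos: "0 < sqrt k" "0 < M" "0 < p"
    using k_pos D_pos char by (simp_all add: M_def p_def)
  have N: "real N = D * sqrt k * sqrt k"
    using pos by (simp add: N_eq)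
  have "real N ^ 3 * sqrt k * M \<le> real N ^ 3 * sqrt k * (D * sqrt k)"
    using pos(1) by (intro mult_left_mono) (auto simp: M_def)
  also have "\<dots> = real N ^ 4"
    using N by (simp add: power4_eq_xxxx power3_eq_cube)
  finally have "real N ^ 3 * sqrt k \<le> real N ^ 4 / M"
    using pos(2) by (simp add: field_simps)
  moreover have "real N ^ 4 / p \<le> real N ^ 4 / M"
    using pos by (intro divide_left_mono) (auto simp: M_def)
  ultimately have "244 * (real N ^ 3 * sqrt k) + 1400 * real N ^ 4 / p \<le> 1644 * (real N ^ 4 / M)"
    by simp
  then have "real (edges equal_vals (U \<times> U) (U \<times> U)) \<le> 1644 * (real N ^ 4 / M)"
    using edges_equal_vals_upper by (simp add: p_def)
  then have upper: "4 * V * edges equal_vals (U \<times> U) (U \<times> U) \<le> 4 * V * (1644 * (real N ^ 4 / M))"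
    by (rule mult_left_mono) (simp add: V_def)
  have "real (N ^ 4) \<le> real (4 * (card (vals U) * edges equal_vals (U \<times> U) (U \<times> U)))"
    using edges_equal_vals_lower by (simp only: of_nat_le_iff)
  then have "real N ^ 4 * 1 \<le> 4 * V * edges equal_vals (U \<times> U) (U \<times> U)"
    by (simp add: V_def mult.assoc)
  also note upper
  also have "4 * V * (1644 * (real N ^ 4 / M)) = real N ^ 4 * (6576 * V / M)"
    by simp
  finally have "real N ^ 4 * 1 \<le> real N ^ 4 * (6576 * V / M)" .
  then have "1 \<le> 6576 * V / M"
    using N_pos by (subst (asm) mult_le_cancel_left_pos) auto
  then show ?thesis
    using pos(2) by (simp add: M_def p_def V_def field_simps)
qed

end

context plane_form
begin

lemma card_direction_fibre_le_vals_if_form_nonzero: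
  assumes fin: "finite S" and s: "s \<in> S" "form s d \<noteq> 0"
  shows "card {t \<in> S. direction t = d} \<le> card (vals S)"
proof -
  have "inj_on (form s) {t \<in> S. direction t = d}"
  proof (rule inj_onI)
    fix t t'
    assume t: "t \<in> {t \<in> S. direction t = d}" "t' \<in> {t \<in> S. direction t = d}" "form s t = form s t'"
    have "t = scale2 (leading t) d" "t' = scale2 (leading t') d"
      using t(1,2) scale2_leading_direction[of t] scale2_leading_direction[of t'] by auto
    moreover from this have "leading t = leading t'"
      using t(3) s(2) form_scale2(2)[of s "leading t" d] form_scale2(2)[of s "leading t'" d] by simp
    ultimately show "t = t'"
      by simp
  qed
  moreover have "form s ` {t \<in> S. direction t = d} \<subseteq> vals S"
    using s(1) form_in_vals by blast
  ultimately show ?thesis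
    using finite_vals[OF fin] card_inj_on_le by blast
qed

lemma card_direction_fibre_le_vals:
  assumes fin: "finite S" and span: "u \<in> S" "v \<in> S" "\<not> parallel2 u v" and "d \<noteq> 0"
  shows "card {t \<in> S. direction t = d} \<le> card (vals S)"
proof -
  have "form u d \<noteq> 0 \<or> form v d \<noteq> 0"
    using span(3) \<open>d \<noteq> 0\<close> parallel2_if_form_eq_0 by blast
  then show ?thesis
    using card_direction_fibre_le_vals_if_form_nonzero[OF fin] span(1,2) by blast
qed

lemma vals_lower_bound_popular:
  fixes S :: "'f vec2 set" and j :: nat
  defines "D \<equiv> card (popular direction S j)"
  assumes inf: "infinite (UNIV :: 'f set)" and char: "15 \<le> CHAR('f)"
    and S: "finite S" "0 \<notin> S" and "1 \<le> j" "2 \<le> D"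
  shows "min (D * sqrt j) CHAR('f) \<le> 6576 * real (card (vals S))"
proof -
  obtain \<Delta> where \<Delta>: "\<Delta> \<subseteq> popular direction S j" "card \<Delta> = min D CHAR('f)"
    using obtain_subset_with_card_n[of "min D CHAR('f)" "popular direction S j"] by (auto simp: D_def)
  obtain U where U: "U \<subseteq> S" "direction ` U = \<Delta>" "\<forall>d\<in>\<Delta>. card {s \<in> U. direction s = d} = j"
    using exists_subset_with_uniform_fibres[OF \<Delta>(1) \<open>1 \<le> j\<close>] by blast
  interpret U: uniform_set w11 w12 w21 w22 \<epsilon> U j
    using inf char U S \<Delta>(2) \<open>2 \<le> D\<close> finite_subset[OF U(1) S(1)] by unfold_locales auto
  have "min (min D CHAR('f) * sqrt j) CHAR('f) \<le> 6576 * real (card (vals U))"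
    using U.vals_lower_bound_uniform by (simp add: U.D_def U(2) \<Delta>(2))
  also have "\<dots> \<le> 6576 * real (card (vals S))"
    using card_vals_mono[OF S(1) U(1)] by simp
  finally have "D * sqrt j \<le> 6576 * real (card (vals S)) \<or> CHAR('f) * sqrt j \<le> 6576 * real (card (vals S))
      \<or> CHAR('f) \<le> 6576 * real (card (vals S))"
    by (auto simp: min_def split: if_splits)
  moreover have "real CHAR('f) * 1 \<le> real CHAR('f) * sqrt j"
    using \<open>1 \<le> j\<close> by (intro mult_left_mono) auto
  ultimately show ?thesis
    by linarith
qed

lemma exists_popular_directions:
  assumes fin: "finite S" and span: "u \<in> S" "v \<in> S" "\<not> parallel2 u v"
    and few_vals: "card (vals S) < card S powr (2/3)"
  shows "\<exists>j\<in>{1..card (vals S)}. card S powr (2/3) / 4 \<le> real (card (popular direction (S - {0}) j)) * sqrt j"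
proof (rule exists_large_layer)
  have "u \<noteq> v"
    using span(3) by (auto simp: parallel2_def)
  then have "2 \<le> card S"
    using span(1,2) fin card_mono[of S "{u, v}"] by simp
  then show "0 < card S"
    by simp
  have "card {s \<in> S - {0}. direction s = d} \<le> card (vals S)" if "d \<in> direction ` (S - {0})" for d
  proof -
    have "card {s \<in> S - {0}. direction s = d} \<le> card {s \<in> S. direction s = d}"
      using fin by (intro card_mono) auto
    also have "\<dots> \<le> card (vals S)"
      using that by (intro card_direction_fibre_le_vals[OF fin span]) auto
    finally show ?thesis .
  qed
  then have "(\<Sum>j=1..card (vals S). card (popular direction (S - {0}) j)) = card (S - {0})"
    using fin by (intro sum_card_popular) auto
  then show "card S \<le> 2 * (\<Sum>j=1..card (vals S). card (popular direction (S - {0}) j))"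
    using \<open>2 \<le> card S\<close> fin card_Diff_singleton_if[of S 0] by (auto split: if_splits)
qed (rule few_vals)

theorem vals_lower_bound_infinite:
  assumes inf: "infinite (UNIV :: 'f set)" and fin: "finite S"
    and span: "u \<in> S" "v \<in> S" "\<not> parallel2 u v"
  shows "min (card S powr (2/3)) CHAR('f) \<le> 30000 * real (card (vals S))"
proof (rule ccontr)
  assume contra: "\<not> ?thesis"
  define V where "V = card (vals S)"
  define t where "t = real (card S) powr (2/3)"
  have V: "30000 * real V < t" "30000 * real V < CHAR('f)"
    using contra by (auto simp: V_def t_def)
  have "1 \<le> V"
    unfolding V_def using finite_vals[OF fin] form_in_vals[OF span(1,1)]
    by (auto simp: Suc_le_eq card_gt_0_iff)
  then have char: "15 \<le> CHAR('f)"
    using V(2) by linarith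
  obtain j where j: "1 \<le> j" "j \<le> V" "t / 4 \<le> real (card (popular direction (S - {0}) j)) * sqrt j"
    using exists_popular_directions[OF fin span] V(1) by (auto simp: V_def t_def)
  define D where "D = card (popular direction (S - {0}) j)"
  have D: "t / 4 \<le> D * sqrt j"
    using j(3) by (simp add: D_def)
  show False
  proof (cases "2 \<le> D")
    case True
    have "min (D * sqrt j) CHAR('f) \<le> 6576 * real (card (vals (S - {0})))"
      unfolding D_def using inf char fin j(1) True by (intro vals_lower_bound_popular) (auto simp: D_def)
    also have "\<dots> \<le> 6576 * real V"
      using card_vals_mono[OF fin, of "S - {0}"] by (simp add: V_def)
    finally show False
      using V D by linarith
  next
    case False
    then have "D * sqrt j \<le> 1 * sqrt j"
      by (intro mult_right_mono) auto
    also have "\<dots> \<le> j"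
      using j(1) by (simp add: real_le_lsqrt power2_eq_square)
    finally show False
      using j(2) V(1) D by simp
  qed
qed

end

subsection \<open>Passing to the algebraic closure\<close>

lemma infinite_UNIV_alg_closed_field: "infinite (UNIV :: 'k::alg_closed_field set)"
proof
  assume fin: "finite (UNIV :: 'k set)"
  define q where "q = (\<Prod>a\<in>(UNIV :: 'k set). [:- a, 1:])"
  have "degree q = card (UNIV :: 'k set)"
    by (simp add: q_def degree_prod_eq_sum_degree)
  then have "degree (q + 1) > 0"
    using fin by (subst degree_add_eq_left) (auto simp: card_gt_0_iff)
  then obtain z where "poly (q + 1) z = 0"
    using alg_closed_imp_poly_has_root by blast
  moreover have "poly q z = 0"
    unfolding q_def poly_prod using fin by (intro prod_zero) auto
  ultimately show False
    by simp
qed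

lemma (in plane_form) plane_form_alg_closure:
  "plane_form (to_ac w11) (to_ac w12) (to_ac w21) (to_ac w22) (to_ac \<epsilon>)"
proof
  show "to_ac w11 * to_ac w22 - to_ac w12 * to_ac w21 \<noteq> 0"
    using det by (simp flip: to_ac_mult to_ac_diff)
qed (use eps in \<open>simp_all flip: to_ac_mult\<close>)

theorem (in plane_form) vals_lower_bound:
  assumes "finite S" and span: "u \<in> S" "v \<in> S" "\<not> parallel2 u v"
  shows "min (card S powr (2/3)) CHAR('f) \<le> 30000 * real (card (vals S))"
proof -
  interpret ac: plane_form "to_ac w11" "to_ac w12" "to_ac w21" "to_ac w22" "to_ac \<epsilon>"
    by (rule plane_form_alg_closure)
  define lift :: "'f vec2 \<Rightarrow> 'f alg_closure vec2" where "lift = map_prod to_ac to_ac"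
  have form: "ac.form (lift s) (lift t) = to_ac (form s t)" for s t
    by (simp add: ac.form_def ac.covector_def form_def covector_def lift_def)
  have "ac.vals (lift ` S) = to_ac ` vals S"
    unfolding ac.vals_def vals_def by (force simp: form)
  then have "card (ac.vals (lift ` S)) = card (vals S)"
    by (simp add: card_image inj_on_subset[OF inj_to_ac])
  moreover have "card (lift ` S) = card S"
    by (intro card_image) (auto simp: inj_on_def lift_def prod_eq_iff)
  moreover have "\<not> parallel2 (lift u) (lift v)"
    using span(3) by (simp add: parallel2_def lift_def flip: to_ac_mult)
  then have "min (card (lift ` S) powr (2/3)) CHAR('f alg_closure) \<le> 30000 * real (card (ac.vals (lift ` S)))"
    using assms
    by (intro ac.vals_lower_bound_infinite[of _ "lift u" "lift v"] infinite_UNIV_alg_closed_field) auto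
  ultimately show ?thesis
    by simp
qed

section \<open>Planes over fields with a carrier set\<close>

subsection \<open>Lines\<close>

lemma plane_simps:
  "carrier (plane F) = carrier F \<times> carrier F"
  "\<zero>\<^bsub>plane F\<^esub> = (\<zero>\<^bsub>F\<^esub>, \<zero>\<^bsub>F\<^esub>)"
  "u \<oplus>\<^bsub>plane F\<^esub> v = (fst u \<oplus>\<^bsub>F\<^esub> fst v, snd u \<oplus>\<^bsub>F\<^esub> snd v)"
  "t \<odot>\<^bsub>plane F\<^esub> u = (t \<otimes>\<^bsub>F\<^esub> fst u, t \<otimes>\<^bsub>F\<^esub> snd u)"
  by (simp_all add: plane_def split: prod.splits)

definition cross :: "('a, 'b) ring_scheme \<Rightarrow> 'a \<times> 'a \<Rightarrow> 'a \<times> 'a \<Rightarrow> 'a" where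
  "cross F u v = fst u \<otimes>\<^bsub>F\<^esub> snd v \<ominus>\<^bsub>F\<^esub> snd u \<otimes>\<^bsub>F\<^esub> fst v"

lemma (in ring_hom_cring) cross_map_prod:
  "u \<in> carrier R \<times> carrier R \<Longrightarrow> v \<in> carrier R \<times> carrier R
    \<Longrightarrow> cross S (map_prod h h u) (map_prod h h v) = h (cross R u v)"
  by (auto simp: cross_def a_minus_def)

locale field_plane = field F for F :: "'a ring" (structure)
begin

lemma cross_closed:
  "u \<in> carrier (plane F) \<Longrightarrow> v \<in> carrier (plane F) \<Longrightarrow> cross F u v \<in> carrier F"
  by (simp add: cross_def plane_simps mem_Times_iff)

lemma cross_smult:
  assumes "d \<in> carrier (plane F)" "v \<in> carrier (plane F)" "t \<in> carrier F"
  shows "cross F (t \<odot>\<^bsub>plane F\<^esub> d) v = t \<otimes> cross F d v"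
  using assms by (simp add: cross_def plane_simps mem_Times_iff) algebra

lemma cross_commute:
  assumes "u \<in> carrier (plane F)" "v \<in> carrier (plane F)"
  shows "cross F u v = \<ominus> cross F v u"
  using assms by (simp add: cross_def plane_simps mem_Times_iff) algebra

lemma cross_self: "d \<in> carrier (plane F) \<Longrightarrow> cross F d d = \<zero>"
  by (simp add: cross_def plane_simps mem_Times_iff m_comm)

lemma cross_eq_zero_iff:
  assumes u: "u \<in> carrier (plane F)" and d: "d \<in> carrier (plane F)" "d \<noteq> \<zero>\<^bsub>plane F\<^esub>"
  shows "cross F u d = \<zero> \<longleftrightarrow> (\<exists>t\<in>carrier F. u = t \<odot>\<^bsub>plane F\<^esub> d)"
proof
  obtain u1 u2 d1 d2 where eq: "u = (u1, u2)" "d = (d1, d2)"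
    by (cases u; cases d)
  have [simp]: "u1 \<in> carrier F" "u2 \<in> carrier F" "d1 \<in> carrier F" "d2 \<in> carrier F"
    using u d(1) by (simp_all add: eq plane_simps)
  assume "cross F u d = \<zero>"
  then have proportional: "u1 \<otimes> d2 = u2 \<otimes> d1"
    by (simp add: cross_def eq)
  have multiple: "x \<otimes> inv z \<otimes> w = y" if "z \<noteq> \<zero>" "x \<otimes> w = y \<otimes> z"
    "x \<in> carrier F" "y \<in> carrier F" "z \<in> carrier F" "w \<in> carrier F" for x y z w
  proof -
    have "x \<otimes> inv z \<otimes> w = (x \<otimes> w) \<otimes> inv z"
      using that(1,3-) by (simp add: field_Units m_ac)
    also have "\<dots> = y"
      using that by (simp add: field_Units m_assoc)
    finally show ?thesis .
  qed
  show "\<exists>t\<in>carrier F. u = t \<odot>\<^bsub>plane F\<^esub> d"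
  proof (cases "d1 = \<zero>")
    case True
    then have "d2 \<noteq> \<zero>"
      using d(2) by (auto simp: eq plane_simps)
    then show ?thesis
      using True proportional
      by (intro bexI[of _ "u2 \<otimes> inv d2"]) (auto simp: eq plane_simps field_Units multiple integral_iff)
  next
    case False
    then show ?thesis
      using proportional by (intro bexI[of _ "u1 \<otimes> inv d1"]) (auto simp: eq plane_simps field_Units multiple)
  qed
next
  assume "\<exists>t\<in>carrier F. u = t \<odot>\<^bsub>plane F\<^esub> d"
  then show "cross F u d = \<zero>"
    using d(1) by (auto simp: cross_smult cross_self)
qed

lemma line_eq_cross_fibre:
  assumes a: "a \<in> carrier (plane F)" and d: "d \<in> carrier (plane F)" "d \<noteq> \<zero>\<^bsub>plane F\<^esub>"
  shows "{a \<oplus>\<^bsub>plane F\<^esub> (t \<odot>\<^bsub>plane F\<^esub> d) | t. t \<in> carrier F}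
    = {u \<in> carrier (plane F). cross F u d = cross F a d}"
proof (intro equalityI subsetI)
  fix u
  assume "u \<in> {a \<oplus>\<^bsub>plane F\<^esub> (t \<odot>\<^bsub>plane F\<^esub> d) | t. t \<in> carrier F}"
  then obtain t where t: "t \<in> carrier F" "u = a \<oplus>\<^bsub>plane F\<^esub> (t \<odot>\<^bsub>plane F\<^esub> d)"
    by blast
  then have "cross F u d = cross F a d"
    using a d(1) by (simp add: cross_def plane_simps mem_Times_iff) algebra
  then show "u \<in> {u \<in> carrier (plane F). cross F u d = cross F a d}"
    using a d(1) t by (simp add: plane_simps mem_Times_iff)
next
  fix u
  assume u: "u \<in> {u \<in> carrier (plane F). cross F u d = cross F a d}"
  define v where "v = (fst u \<ominus> fst a, snd u \<ominus> snd a)"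
  have v: "v \<in> carrier (plane F)"
    using u a by (simp add: v_def plane_simps mem_Times_iff)
  have "cross F v d = cross F u d \<ominus> cross F a d"
    using a d(1) u[THEN CollectD, THEN conjunct1]
    by (simp add: v_def cross_def plane_simps mem_Times_iff) algebra
  also have "\<dots> = \<zero>"
    using u cross_closed[OF a d(1)] by simp
  finally obtain t where t: "t \<in> carrier F" "v = t \<odot>\<^bsub>plane F\<^esub> d"
    using cross_eq_zero_iff[OF v d] by blast
  have "u = a \<oplus>\<^bsub>plane F\<^esub> v"
    using a u[THEN CollectD, THEN conjunct1]
    by (simp add: v_def plane_simps mem_Times_iff prod_eq_iff) algebra
  then show "u \<in> {a \<oplus>\<^bsub>plane F\<^esub> (t \<odot>\<^bsub>plane F\<^esub> d) | t. t \<in> carrier F}"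
    using t by blast
qed

lemma exists_cross_eq:
  assumes d: "d \<in> carrier (plane F)" "d \<noteq> \<zero>\<^bsub>plane F\<^esub>" and c: "c \<in> carrier F"
  shows "\<exists>a\<in>carrier (plane F). cross F a d = c"
proof (cases "fst d = \<zero>")
  case True
  then have "snd d \<noteq> \<zero>"
    using d(2) by (auto simp: plane_simps prod_eq_iff)
  then show ?thesis
    using True d(1) c
    by (intro bexI[of _ "(c \<otimes> inv (snd d), \<zero>)"])
      (simp_all add: cross_def plane_simps mem_Times_iff field_Units m_assoc minus_eq)
next
  case False
  then show ?thesis
    using d(1) c
    by (intro bexI[of _ "(\<zero>, \<ominus> (c \<otimes> inv (fst d)))"])
      (simp_all add: cross_def plane_simps mem_Times_iff field_Units m_assoc l_minus minus_eq)
qed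

lemma plane_lines_eq_cross_fibres:
  "plane_lines F = {{u \<in> carrier (plane F). cross F u d = c} | d c.
    d \<in> carrier (plane F) \<and> d \<noteq> \<zero>\<^bsub>plane F\<^esub> \<and> c \<in> carrier F}"
proof (intro equalityI subsetI)
  fix l
  assume "l \<in> plane_lines F"
  then obtain a d where "a \<in> carrier (plane F)" "d \<in> carrier (plane F)" "d \<noteq> \<zero>\<^bsub>plane F\<^esub>"
    "l = {u \<in> carrier (plane F). cross F u d = cross F a d}"
    unfolding plane_lines_def using line_eq_cross_fibre by blast
  then show "l \<in> {{u \<in> carrier (plane F). cross F u d = c} | d c.
      d \<in> carrier (plane F) \<and> d \<noteq> \<zero>\<^bsub>plane F\<^esub> \<and> c \<in> carrier F}"
    using cross_closed by blast
next
  fix l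
  assume "l \<in> {{u \<in> carrier (plane F). cross F u d = c} | d c.
    d \<in> carrier (plane F) \<and> d \<noteq> \<zero>\<^bsub>plane F\<^esub> \<and> c \<in> carrier F}"
  then obtain a d where "a \<in> carrier (plane F)" "d \<in> carrier (plane F)" "d \<noteq> \<zero>\<^bsub>plane F\<^esub>"
    "l = {u \<in> carrier (plane F). cross F u d = cross F a d}"
    using exists_cross_eq by blast
  then show "l \<in> plane_lines F"
    unfolding plane_lines_def using line_eq_cross_fibre by blast
qed

lemma lines_through_origin_eq_cross_kernels:
  "lines_through_origin F = {{u \<in> carrier (plane F). cross F u d = \<zero>} | d.
    d \<in> carrier (plane F) \<and> d \<noteq> \<zero>\<^bsub>plane F\<^esub>}"
proof -
  have "cross F \<zero>\<^bsub>plane F\<^esub> d = \<zero>" "\<zero>\<^bsub>plane F\<^esub> \<in> carrier (plane F)" if "d \<in> carrier (plane F)" for d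
    using that by (simp_all add: cross_def plane_simps mem_Times_iff)
  then show ?thesis
    unfolding lines_through_origin_def plane_lines_eq_cross_fibres by (auto, blast)
qed

lemma cross_kernel_eq_iff:
  assumes d: "d \<in> carrier (plane F)" "d \<noteq> \<zero>\<^bsub>plane F\<^esub>" and e: "e \<in> carrier (plane F)" "e \<noteq> \<zero>\<^bsub>plane F\<^esub>"
  shows "{u \<in> carrier (plane F). cross F u d = \<zero>} = {u \<in> carrier (plane F). cross F u e = \<zero>}
    \<longleftrightarrow> cross F d e = \<zero>"
proof
  assume "{u \<in> carrier (plane F). cross F u d = \<zero>} = {u \<in> carrier (plane F). cross F u e = \<zero>}"
  then show "cross F d e = \<zero>"
    using d(1) cross_self by blast
next
  assume de: "cross F d e = \<zero>"
  then have "cross F e d = \<zero>"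
    using cross_commute[OF e(1) d(1)] by simp
  moreover have "cross F u z = \<zero>"
    if "u \<in> carrier (plane F)" "z \<in> carrier (plane F)" "y \<in> carrier (plane F)" "y \<noteq> \<zero>\<^bsub>plane F\<^esub>"
      "cross F u y = \<zero>" "cross F y z = \<zero>" for u y z
    using that cross_eq_zero_iff[of u y] by (auto simp: cross_smult)
  ultimately show "{u \<in> carrier (plane F). cross F u d = \<zero>} = {u \<in> carrier (plane F). cross F u e = \<zero>}"
    using d e de by blast
qed

lemma on_distinct_lines_through_origin_iff:
  assumes "T \<subseteq> carrier (plane F)"
  shows "on_distinct_lines_through_origin F T \<longleftrightarrow>
    (\<exists>d. (\<forall>s\<in>T. d s \<in> carrier (plane F) \<and> d s \<noteq> \<zero>\<^bsub>plane F\<^esub> \<and> cross F s (d s) = \<zero>) \<and>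
      (\<forall>s\<in>T. \<forall>t\<in>T. s \<noteq> t \<longrightarrow> cross F (d s) (d t) \<noteq> \<zero>))"
proof
  assume "on_distinct_lines_through_origin F T"
  then obtain l where l: "inj_on l T" "\<forall>s\<in>T. l s \<in> lines_through_origin F \<and> s \<in> l s"
    unfolding on_distinct_lines_through_origin_def by blast
  then have "\<forall>s\<in>T. \<exists>d. d \<in> carrier (plane F) \<and> d \<noteq> \<zero>\<^bsub>plane F\<^esub> \<and> l s
    = {u \<in> carrier (plane F). cross F u d = \<zero>}"
    unfolding lines_through_origin_eq_cross_kernels by blast
  from bchoice[OF this] obtain d where d: "\<And>s. s \<in> T \<Longrightarrow> d s \<in> carrier (plane F)"
    "\<And>s. s \<in> T \<Longrightarrow> d s \<noteq> \<zero>\<^bsub>plane F\<^esub>" "\<And>s. s \<in> T \<Longrightarrow> l s = {u \<in> carrier (plane F). cross F u (d s) = \<zero>}"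
    by blast
  have "cross F (d s) (d t) \<noteq> \<zero>" if "s \<in> T" "t \<in> T" "s \<noteq> t" for s t
  proof -
    have "l s \<noteq> l t"
      using l(1) that by (auto dest: inj_onD)
    then show ?thesis
      unfolding d(3)[OF that(1)] d(3)[OF that(2)] by (simp add: cross_kernel_eq_iff d(1,2) that)
  qed
  moreover have "cross F s (d s) = \<zero>" if "s \<in> T" for s
    using l(2) that d(3)[OF that] by blast
  ultimately show "\<exists>d. (\<forall>s\<in>T. d s \<in> carrier (plane F) \<and> d s \<noteq> \<zero>\<^bsub>plane F\<^esub> \<and> cross F s (d s) = \<zero>) \<and>
      (\<forall>s\<in>T. \<forall>t\<in>T. s \<noteq> t \<longrightarrow> cross F (d s) (d t) \<noteq> \<zero>)"
    using d(1,2) by (intro exI[of _ d]) blast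
next
  assume "\<exists>d. (\<forall>s\<in>T. d s \<in> carrier (plane F) \<and> d s \<noteq> \<zero>\<^bsub>plane F\<^esub> \<and> cross F s (d s) = \<zero>) \<and>
      (\<forall>s\<in>T. \<forall>t\<in>T. s \<noteq> t \<longrightarrow> cross F (d s) (d t) \<noteq> \<zero>)"
  then obtain d where d: "\<And>s. s \<in> T \<Longrightarrow> d s \<in> carrier (plane F) \<and> d s \<noteq> \<zero>\<^bsub>plane F\<^esub> \<and> cross F s (d s) = \<zero>"
    "\<And>s t. s \<in> T \<Longrightarrow> t \<in> T \<Longrightarrow> s \<noteq> t \<Longrightarrow> cross F (d s) (d t) \<noteq> \<zero>"
    by blast
  define l where "l s = {u \<in> carrier (plane F). cross F u (d s) = \<zero>}" for s
  have "inj_on l T"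
  proof (intro inj_onI, rule ccontr)
    fix s t
    assume "s \<in> T" "t \<in> T" "l s = l t" "s \<noteq> t"
    then show False
      using d cross_kernel_eq_iff[of "d s" "d t"] by (simp add: l_def)
  qed
  moreover have "l s \<in> lines_through_origin F \<and> s \<in> l s" if "s \<in> T" for s
    unfolding lines_through_origin_eq_cross_kernels l_def using d(1)[OF that] assms that by blast
  ultimately show "on_distinct_lines_through_origin F T"
    unfolding on_distinct_lines_through_origin_def by blast
qed

end

subsection \<open>Forms\<close>

definition admissible :: "'a ring \<Rightarrow> ('a \<times> 'a \<Rightarrow> 'a \<times> 'a \<Rightarrow> 'a) \<Rightarrow> ('a \<times> 'a) set \<Rightarrow> bool" where
  "admissible F \<omega> S \<longleftrightarrow>
    prime (characteristic F) \<and> odd (characteristic F) \<and>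
    bilinear_form F \<omega> \<and> nondegenerate_form F \<omega> \<and> (symmetric_form F \<omega> \<or> skew_symmetric_form F \<omega>) \<and>
    finite S \<and> S \<subseteq> carrier (plane F) \<and> (\<forall>l\<in>plane_lines F. \<not> S \<subseteq> l)"

lemma form_values_bound_iff:
  "form_values_bound c F \<longleftrightarrow> (\<forall>\<omega> S. admissible F \<omega> S \<longrightarrow>
    c * min (real (card S) powr (2/3)) (real (characteristic F)) \<le> real (card (form_values \<omega> S)) \<and>
    (\<forall>T\<subseteq>S. card T < characteristic F \<and> on_distinct_lines_through_origin F T \<longrightarrow>
      c * real (card T) \<le> real (card (form_values \<omega> S))))"
  unfolding form_values_bound_def admissible_def by auto

lemma bilinear_form_swap: "bilinear_form F \<omega> \<Longrightarrow> bilinear_form F (\<lambda>u v. \<omega> v u)"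
  by (simp add: bilinear_form_def)

lemma nondegenerate_form_swap: "nondegenerate_form F \<omega> \<Longrightarrow> nondegenerate_form F (\<lambda>u v. \<omega> v u)"
  by (simp add: nondegenerate_form_def)

context field_plane
begin

abbreviation axis1 :: "'a \<times> 'a" where "axis1 \<equiv> (\<one>, \<zero>)"
abbreviation axis2 :: "'a \<times> 'a" where "axis2 \<equiv> (\<zero>, \<one>)"

lemma bilinear_form_expand_right:
  assumes bil: "bilinear_form F \<omega>" and uv: "u \<in> carrier (plane F)" "v \<in> carrier (plane F)"
  shows "\<omega> u v = fst v \<otimes> \<omega> u axis1 \<oplus> snd v \<otimes> \<omega> u axis2"
proof -
  have axes: "axis1 \<in> carrier (plane F)" "axis2 \<in> carrier (plane F)"
    and v: "fst v \<in> carrier F" "snd v \<in> carrier F"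
    using uv(2) by (simp_all add: plane_simps mem_Times_iff)
  then have multiples: "fst v \<odot>\<^bsub>plane F\<^esub> axis1 \<in> carrier (plane F)"
    "snd v \<odot>\<^bsub>plane F\<^esub> axis2 \<in> carrier (plane F)"
    by (simp_all add: plane_simps)
  have "v = (fst v \<odot>\<^bsub>plane F\<^esub> axis1) \<oplus>\<^bsub>plane F\<^esub> (snd v \<odot>\<^bsub>plane F\<^esub> axis2)"
    using v by (simp add: plane_simps)
  then have "\<omega> u v = \<omega> u ((fst v \<odot>\<^bsub>plane F\<^esub> axis1) \<oplus>\<^bsub>plane F\<^esub> (snd v \<odot>\<^bsub>plane F\<^esub> axis2))"
    by (rule arg_cong)
  also have "\<dots> = \<omega> u (fst v \<odot>\<^bsub>plane F\<^esub> axis1) \<oplus> \<omega> u (snd v \<odot>\<^bsub>plane F\<^esub> axis2)"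
    using bil uv(1) multiples unfolding bilinear_form_def by blast
  also have "\<dots> = fst v \<otimes> \<omega> u axis1 \<oplus> snd v \<otimes> \<omega> u axis2"
    using bil uv(1) v axes unfolding bilinear_form_def by simp
  finally show ?thesis .
qed

lemma bilinear_form_expand_left:
  assumes "bilinear_form F \<omega>" "u \<in> carrier (plane F)" "v \<in> carrier (plane F)"
  shows "\<omega> u v = fst u \<otimes> \<omega> axis1 v \<oplus> snd u \<otimes> \<omega> axis2 v"
  using bilinear_form_expand_right[OF bilinear_form_swap[OF assms(1)] assms(3,2)] .

lemma nondegenerate_formD:
  assumes bil: "bilinear_form F \<omega>" and nondeg: "nondegenerate_form F \<omega>" and u: "u \<in> carrier (plane F)"
    and "\<omega> u axis1 = \<zero>" "\<omega> u axis2 = \<zero>"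
  shows "u = \<zero>\<^bsub>plane F\<^esub>"
proof -
  have "\<omega> u v = \<zero>" if "v \<in> carrier (plane F)" for v
    using that by (subst bilinear_form_expand_right[OF bil u])
      (simp_all add: assms(4,5) plane_simps(1) mem_Times_iff)
  then show ?thesis
    using nondeg u unfolding nondegenerate_form_def by blast
qed

lemma characteristic_dvd_iff: "characteristic F dvd n \<longleftrightarrow> [n] \<cdot> \<one> = \<zero>"
  unfolding characteristic_def add_pow_def
  using group.pow_eq_id[OF a_group, of \<one> n] by simp

end

subsection \<open>The field of a type\<close>

lemma type_ring_simps:
  "carrier ring_of_type_algebra = UNIV"
  "x \<oplus>\<^bsub>ring_of_type_algebra\<^esub> y = x + y" "x \<otimes>\<^bsub>ring_of_type_algebra\<^esub> y = x * y"
  "\<zero>\<^bsub>ring_of_type_algebra\<^esub> = 0" "\<one>\<^bsub>ring_of_type_algebra\<^esub> = 1"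
  by (simp_all add: ring_of_type_algebra_def)

lemma field_plane_type_algebra: "field_plane (ring_of_type_algebra :: 'f::field ring)"
  by (simp add: field_plane_def field_from_type_algebra)

lemma type_field_uminus: "\<ominus>\<^bsub>ring_of_type_algebra\<^esub> x = - x" for x :: "'f::field"
proof -
  interpret type_field: field_plane "ring_of_type_algebra :: 'f ring"
    by (rule field_plane_type_algebra)
  show ?thesis
    by (rule type_field.minus_equality) (simp_all add: type_ring_simps)
qed

lemma type_field_cross_eq_zero_iff:
  "cross ring_of_type_algebra u v = (0 :: 'f::field) \<longleftrightarrow> parallel2 u v"
  by (simp add: cross_def a_minus_def type_ring_simps type_field_uminus parallel2_def)

lemma characteristic_type_field: "characteristic (ring_of_type_algebra :: 'f::field ring) = CHAR('f)"
proof -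
  interpret type_field: field_plane "ring_of_type_algebra :: 'f ring"
    by (rule field_plane_type_algebra)
  have "[n] \<cdot>\<^bsub>ring_of_type_algebra\<^esub> \<one>\<^bsub>ring_of_type_algebra\<^esub> = (of_nat n :: 'f)" for n
    by (induction n) (simp_all add: add_pow_def type_ring_simps add.commute)
  then have "characteristic (ring_of_type_algebra :: 'f ring) dvd n \<longleftrightarrow> CHAR('f) dvd n" for n
    by (simp add: type_field.characteristic_dvd_iff type_ring_simps of_nat_eq_0_iff_char_dvd)
  then show ?thesis
    by (meson dvd_antisym dvd_refl)
qed

lemma plane_form_of_bilinear_form:
  fixes \<omega> :: "'f::field vec2 \<Rightarrow> 'f vec2 \<Rightarrow> 'f"
  assumes bil: "bilinear_form ring_of_type_algebra \<omega>" and nondeg: "nondegenerate_form ring_of_type_algebra \<omega>"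
    and sym: "symmetric_form ring_of_type_algebra \<omega> \<or> skew_symmetric_form ring_of_type_algebra \<omega>"
  shows "\<exists>w11 w12 w21 w22 \<epsilon>. plane_form w11 w12 w21 w22 \<epsilon> \<and> \<omega> = plane_form.form w11 w12 w21 w22"
proof -
  interpret type_field: field_plane "ring_of_type_algebra :: 'f ring"
    by (rule field_plane_type_algebra)
  define w11 w12 w21 w22
    where w: "w11 = \<omega> (1, 0) (1, 0)" "w12 = \<omega> (1, 0) (0, 1)" "w21 = \<omega> (0, 1) (1, 0)" "w22 = \<omega> (0, 1) (0, 1)"
  have plane: "u \<in> carrier (plane ring_of_type_algebra)" for u :: "'f vec2"
    by (simp add: plane_simps type_ring_simps mem_Times_iff)
  have right: "\<omega> u v = fst v * \<omega> u (1, 0) + snd v * \<omega> u (0, 1)" for u v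
    using type_field.bilinear_form_expand_right[OF bil plane plane] unfolding type_ring_simps .
  have left: "\<omega> u v = fst u * \<omega> (1, 0) v + snd u * \<omega> (0, 1) v" for u v
    using type_field.bilinear_form_expand_left[OF bil plane plane] unfolding type_ring_simps .
  have expand: "\<omega> u v = fst u * (w11 * fst v + w12 * snd v) + snd u * (w21 * fst v + w22 * snd v)" for u v
    using left[of u v] right[of "(1, 0)" v] right[of "(0, 1)" v] by (simp add: w mult.commute)
  have kernel: "u = (0, 0)" if "fst u * w11 + snd u * w21 = 0" "fst u * w12 + snd u * w22 = 0" for u
    using type_field.nondegenerate_formD[OF bil nondeg plane] that
    by (simp add: expand type_ring_simps plane_simps)
  have "w11 * w22 - w12 * w21 \<noteq> 0"
  proof
    assume "w11 * w22 - w12 * w21 = 0"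
    then have "w21 = 0 \<and> w11 = 0" "w22 = 0 \<and> w12 = 0"
      using kernel[of "(w21, - w11)"] kernel[of "(w22, - w12)"] by (simp_all add: mult.commute)
    then show False
      using kernel[of "(1, 0)"] by simp
  qed
  moreover have "(\<forall>u v. \<omega> u v = 1 * \<omega> v u) \<or> (\<forall>u v. \<omega> u v = - 1 * \<omega> v u)"
    using sym plane unfolding symmetric_form_def skew_symmetric_form_def type_field_uminus mult_1 mult_minus1
    by blast
  then obtain \<epsilon> where "\<And>u v. \<omega> u v = \<epsilon> * \<omega> v u"
    by blast
  ultimately have form: "plane_form w11 w12 w21 w22 \<epsilon>"
    unfolding w by unfold_locales
  then have "\<omega> = plane_form.form w11 w12 w21 w22"
    by (intro ext) (simp add: plane_form.form_def plane_form.covector_def expand)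
  with form show ?thesis
    by blast
qed

lemma exists_not_parallel2_if_not_collinear:
  fixes S :: "'f::field vec2 set"
  assumes "\<forall>l\<in>plane_lines ring_of_type_algebra. \<not> S \<subseteq> l"
  shows "\<exists>u\<in>S. \<exists>v\<in>S. \<not> parallel2 u v"
proof (rule ccontr)
  interpret type_field: field_plane "ring_of_type_algebra :: 'f ring"
    by (rule field_plane_type_algebra)
  assume contra: "\<not> ?thesis"
  obtain d :: "'f vec2" where d: "d \<noteq> 0" "\<forall>u\<in>S. parallel2 u d"
  proof (cases "S \<subseteq> {0}")
    case True
    then show thesis
      by (intro that[of "(1, 0)"]) (auto simp: parallel2_def zero_prod_def)
  next
    case False
    then show thesis
      using contra that by blast
  qed
  have "{u \<in> carrier (plane ring_of_type_algebra). cross ring_of_type_algebra u d = \<zero>\<^bsub>ring_of_type_algebra\<^esub>}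
      \<in> plane_lines ring_of_type_algebra"
    unfolding type_field.plane_lines_eq_cross_fibres using d(1)
    by (intro CollectI exI[of _ d] exI[of _ 0])
      (simp add: plane_simps type_ring_simps mem_Times_iff zero_prod_def)
  moreover have "S \<subseteq> {u \<in> carrier (plane ring_of_type_algebra).
      cross ring_of_type_algebra u d = \<zero>\<^bsub>ring_of_type_algebra\<^esub>}"
    using d(2) by (auto simp: plane_simps type_ring_simps type_field_cross_eq_zero_iff)
  ultimately show False
    using assms by blast
qed

lemma inj_on_direction_if_on_distinct_lines:
  fixes T :: "'f::field vec2 set"
  assumes "on_distinct_lines_through_origin ring_of_type_algebra T"
  shows "inj_on direction (T - {0})"
proof -
  interpret type_field: field_plane "ring_of_type_algebra :: 'f ring"
    by (rule field_plane_type_algebra)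
  have "T \<subseteq> carrier (plane ring_of_type_algebra)"
    by (auto simp: plane_simps type_ring_simps)
  then obtain d where d: "\<forall>s\<in>T. d s \<noteq> 0 \<and> parallel2 s (d s)"
    and distinct: "\<forall>s\<in>T. \<forall>t\<in>T. s \<noteq> t \<longrightarrow> \<not> parallel2 (d s) (d t)"
    using assms by (auto simp: type_field.on_distinct_lines_through_origin_iff type_ring_simps plane_simps(2)
        type_field_cross_eq_zero_iff simp flip: zero_prod_def)
  have direction: "direction s = direction (d s)" if "s \<in> T - {0}" for s
    using that d direction_eq_iff_parallel2[of s "d s"] by blast
  show ?thesis
  proof (rule inj_onI)
    fix s t
    assume "s \<in> T - {0}" "t \<in> T - {0}" "direction s = direction t"
    then have "parallel2 (d s) (d t)" "s \<in> T" "t \<in> T"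
      using d by (simp_all add: direction flip: direction_eq_iff_parallel2)
    then show "s = t"
      using distinct by blast
  qed
qed

lemma (in plane_form) card_le_thrice_vals:
  assumes fin: "finite T" and inj: "inj_on direction (T - {0})"
  shows "card T \<le> 3 * card (vals T)"
proof (cases "T = {}")
  case False
  then have "1 \<le> card (vals T)"
    using finite_vals[OF fin] by (auto simp: vals_def Suc_le_eq card_gt_0_iff)
  moreover have "card T \<le> card (T - {0}) + 1"
    by (metis card_Diff1_le card_Diff_singleton_if diff_le_self fin le_diff_conv order_refl)
  moreover have "card (T - {0}) \<le> 2 * card (vals (T - {0}))"
    using fin inj by (intro card_le_twice_vals) auto
  moreover have "card (vals (T - {0})) \<le> card (vals T)"
    using fin by (intro card_vals_mono) auto
  ultimately show ?thesis
    by linarith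
qed simp

lemma form_values_bound_type_field: "form_values_bound (1 / 30000) (ring_of_type_algebra :: 'f::field ring)"
  unfolding form_values_bound_iff
proof (intro allI impI conjI)
  fix \<omega> :: "'f vec2 \<Rightarrow> 'f vec2 \<Rightarrow> 'f" and S
  assume "admissible ring_of_type_algebra \<omega> S"
  then have bilinear: "bilinear_form ring_of_type_algebra \<omega>" "nondegenerate_form ring_of_type_algebra \<omega>"
      "symmetric_form ring_of_type_algebra \<omega> \<or> skew_symmetric_form ring_of_type_algebra \<omega>"
    and fin: "finite S" and not_collinear: "\<forall>l\<in>plane_lines ring_of_type_algebra. \<not> S \<subseteq> l"
    unfolding admissible_def by simp_all
  obtain w11 w12 w21 w22 \<epsilon> where plane_form: "plane_form w11 w12 w21 w22 \<epsilon>"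
    and \<omega>: "\<omega> = plane_form.form w11 w12 w21 w22"
    using plane_form_of_bilinear_form[OF bilinear] by (elim exE conjE)
  interpret plane_form w11 w12 w21 w22 \<epsilon>
    by (rule plane_form)
  have vals: "form_values \<omega> T = vals T" for T
    unfolding form_values_def vals_def \<omega> by auto
  obtain u v where "u \<in> S" "v \<in> S" "\<not> parallel2 u v"
    using exists_not_parallel2_if_not_collinear[OF not_collinear] by blast
  then have "min (card S powr (2/3)) CHAR('f) \<le> 30000 * real (card (vals S))"
    by (rule vals_lower_bound[OF fin])
  then show "1 / 30000 * min (real (card S) powr (2/3)) (real (characteristic (ring_of_type_algebra :: 'f ring)))
      \<le> real (card (form_values \<omega> S))"
    by (simp add: vals characteristic_type_field)
  fix T
  assume T: "T \<subseteq> S" "card T < characteristic (ring_of_type_algebra :: 'f ring) \<and>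
    on_distinct_lines_through_origin ring_of_type_algebra T"
  have "card T \<le> 3 * card (vals T)"
    using finite_subset[OF T(1) fin] T(2)
    by (intro card_le_thrice_vals inj_on_direction_if_on_distinct_lines) simp_all
  moreover have "card (vals T) \<le> card (vals S)"
    by (rule card_vals_mono[OF fin T(1)])
  ultimately show "1 / 30000 * real (card T) \<le> real (card (form_values \<omega> S))"
    by (simp add: vals)
qed

subsection \<open>Embeddings of fields\<close>

locale field_embedding = G: field_plane G + F: field_plane F + ring_hom_cring G F h
  for G :: "'g ring" and F :: "'a ring" and h
begin

definition lift :: "'g \<times> 'g \<Rightarrow> 'a \<times> 'a" where
  "lift = map_prod h h"

lemma inj_on_hom: "inj_on h (carrier G)"
  by (rule non_trivial_field_hom_is_inj[OF homh G.field_axioms F.field_axioms])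

lemma hom_eq_iff: "x \<in> carrier G \<Longrightarrow> y \<in> carrier G \<Longrightarrow> h x = h y \<longleftrightarrow> x = y"
  by (rule inj_on_eq_iff[OF inj_on_hom])

lemma hom_eq_zero_iff: "x \<in> carrier G \<Longrightarrow> h x = \<zero>\<^bsub>F\<^esub> \<longleftrightarrow> x = \<zero>\<^bsub>G\<^esub>"
  using hom_eq_iff[of x "\<zero>\<^bsub>G\<^esub>"] by simp

lemma characteristic_eq: "characteristic G = characteristic F"
proof -
  have "h ([n] \<cdot>\<^bsub>G\<^esub> \<one>\<^bsub>G\<^esub>) = [n] \<cdot>\<^bsub>F\<^esub> \<one>\<^bsub>F\<^esub>" for n :: nat
    by (induction n) simp_all
  then have "characteristic G dvd n \<longleftrightarrow> characteristic F dvd n" for n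
    using hom_eq_zero_iff[of "[n] \<cdot>\<^bsub>G\<^esub> \<one>\<^bsub>G\<^esub>"] by (simp add: G.characteristic_dvd_iff F.characteristic_dvd_iff)
  then show ?thesis
    by (meson dvd_antisym dvd_refl)
qed

lemma lift_closed: "u \<in> carrier (plane G) \<Longrightarrow> lift u \<in> carrier (plane F)"
  by (auto simp: lift_def plane_simps)

lemma lift_add:
  "u \<in> carrier (plane G) \<Longrightarrow> v \<in> carrier (plane G) \<Longrightarrow> lift (u \<oplus>\<^bsub>plane G\<^esub> v) = lift u \<oplus>\<^bsub>plane F\<^esub> lift v"
  by (auto simp: lift_def plane_simps)

lemma lift_smult:
  "t \<in> carrier G \<Longrightarrow> u \<in> carrier (plane G) \<Longrightarrow> lift (t \<odot>\<^bsub>plane G\<^esub> u) = h t \<odot>\<^bsub>plane F\<^esub> lift u"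
  by (auto simp: lift_def plane_simps)

lemma lift_eq_iff: "u \<in> carrier (plane G) \<Longrightarrow> v \<in> carrier (plane G) \<Longrightarrow> lift u = lift v \<longleftrightarrow> u = v"
  by (auto simp: lift_def plane_simps hom_eq_iff)

lemma lift_eq_zero_iff: "u \<in> carrier (plane G) \<Longrightarrow> lift u = \<zero>\<^bsub>plane F\<^esub> \<longleftrightarrow> u = \<zero>\<^bsub>plane G\<^esub>"
  by (auto simp: lift_def plane_simps hom_eq_zero_iff)

lemma inj_on_lift: "inj_on lift (carrier (plane G))"
  by (intro inj_onI) (simp add: lift_eq_iff)

lemma card_lift: "S \<subseteq> carrier (plane G) \<Longrightarrow> card (lift ` S) = card S"
  by (intro card_image inj_on_subset[OF inj_on_lift])

lemma cross_lift:
  "u \<in> carrier (plane G) \<Longrightarrow> v \<in> carrier (plane G) \<Longrightarrow> cross F (lift u) (lift v) = h (cross G u v)"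
  unfolding lift_def by (rule cross_map_prod) (simp_all add: plane_simps(1))

lemma cross_lift_eq_zero_iff:
  "u \<in> carrier (plane G) \<Longrightarrow> v \<in> carrier (plane G) \<Longrightarrow> cross F (lift u) (lift v) = \<zero>\<^bsub>F\<^esub> \<longleftrightarrow> cross G u v = \<zero>\<^bsub>G\<^esub>"
  using hom_eq_zero_iff[OF G.cross_closed] by (simp add: cross_lift)

lemma lift_line:
  assumes "l \<in> plane_lines G"
  shows "\<exists>l'\<in>plane_lines F. lift ` l \<subseteq> l'"
proof -
  obtain d c where d: "d \<in> carrier (plane G)" "d \<noteq> \<zero>\<^bsub>plane G\<^esub>" and c: "c \<in> carrier G"
    and l: "l = {u \<in> carrier (plane G). cross G u d = c}"
    using assms unfolding G.plane_lines_eq_cross_fibres by blast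
  define l' where "l' = {u \<in> carrier (plane F). cross F u (lift d) = h c}"
  have "l' \<in> plane_lines F"
    unfolding F.plane_lines_eq_cross_fibres l'_def using d c lift_closed lift_eq_zero_iff hom_closed by blast
  moreover have "lift ` l \<subseteq> l'"
    unfolding l l'_def by (auto simp: lift_closed cross_lift d(1))
  ultimately show ?thesis
    by blast
qed

lemma on_distinct_lines_through_origin_if_lift:
  assumes T: "T \<subseteq> carrier (plane G)" and d: "\<forall>s\<in>T. d (lift s) \<in> lift ` carrier (plane G)"
    "\<forall>s\<in>lift ` T. d s \<noteq> \<zero>\<^bsub>plane F\<^esub> \<and> cross F s (d s) = \<zero>\<^bsub>F\<^esub>"
    "\<forall>s\<in>lift ` T. \<forall>t\<in>lift ` T. s \<noteq> t \<longrightarrow> cross F (d s) (d t) \<noteq> \<zero>\<^bsub>F\<^esub>"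
  shows "on_distinct_lines_through_origin G T"
proof -
  obtain e where e: "\<And>s. s \<in> T \<Longrightarrow> e s \<in> carrier (plane G)" "\<And>s. s \<in> T \<Longrightarrow> d (lift s) = lift (e s)"
    using bchoice[of T "\<lambda>s u. u \<in> carrier (plane G) \<and> d (lift s) = lift u"] d(1)
    by (auto simp: image_iff Bex_def)
  have "e s \<noteq> \<zero>\<^bsub>plane G\<^esub>" "cross G s (e s) = \<zero>\<^bsub>G\<^esub>" if "s \<in> T" for s
    using subsetD[OF T that] bspec[OF d(2) imageI[OF that]] e[OF that]
    by (simp_all flip: lift_eq_zero_iff cross_lift_eq_zero_iff)
  moreover have "cross G (e s) (e t) \<noteq> \<zero>\<^bsub>G\<^esub>" if "s \<in> T" "t \<in> T" "s \<noteq> t" for s t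
  proof -
    have "lift s \<noteq> lift t"
      using that T lift_eq_iff by blast
    then show ?thesis
      using that d(3) e by (auto simp flip: cross_lift_eq_zero_iff)
  qed
  ultimately show ?thesis
    unfolding G.on_distinct_lines_through_origin_iff[OF T] using e(1) by (intro exI[of _ e]) blast
qed

end

lemma form_values_eq_UN: "form_values \<omega> S = (\<Union>s\<in>S. \<omega> s ` S)"
  unfolding form_values_def by blast

locale form_embedding = field_embedding +
  fixes \<omega> :: "'b \<times> 'b \<Rightarrow> 'b \<times> 'b \<Rightarrow> 'b"
  assumes bilinear: "bilinear_form F \<omega>"
    and defined: "u \<in> carrier (plane G) \<Longrightarrow> v \<in> carrier (plane G) \<Longrightarrow> \<omega> (lift u) (lift v) \<in> h ` carrier G"
begin

definition pullback :: "'a \<times> 'a \<Rightarrow> 'a \<times> 'a \<Rightarrow> 'a" where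
  "pullback u v = inv_into (carrier G) h (\<omega> (lift u) (lift v))"

lemma pullback_closed: "u \<in> carrier (plane G) \<Longrightarrow> v \<in> carrier (plane G) \<Longrightarrow> pullback u v \<in> carrier G"
  unfolding pullback_def by (intro inv_into_into defined)

lemma hom_pullback:
  "u \<in> carrier (plane G) \<Longrightarrow> v \<in> carrier (plane G) \<Longrightarrow> h (pullback u v) = \<omega> (lift u) (lift v)"
  unfolding pullback_def by (intro f_inv_into_f defined)

lemma pullback_eqI:
  assumes "u \<in> carrier (plane G)" "v \<in> carrier (plane G)" "x \<in> carrier G" "\<omega> (lift u) (lift v) = h x"
  shows "pullback u v = x"
  using hom_eq_iff[OF pullback_closed assms(3)] assms by (simp only: hom_pullback)

lemma bilinear_form_pullback: "bilinear_form G pullback"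
proof -
  have add: "\<omega> (lift (u \<oplus>\<^bsub>plane G\<^esub> v)) (lift w) = \<omega> (lift u) (lift w) \<oplus>\<^bsub>F\<^esub> \<omega> (lift v) (lift w)"
    "\<omega> (lift w) (lift (u \<oplus>\<^bsub>plane G\<^esub> v)) = \<omega> (lift w) (lift u) \<oplus>\<^bsub>F\<^esub> \<omega> (lift w) (lift v)"
    if "u \<in> carrier (plane G)" "v \<in> carrier (plane G)" "w \<in> carrier (plane G)" for u v w
    using bilinear that[THEN lift_closed] unfolding lift_add[OF that(1,2)] bilinear_form_def by blast+
  have smult: "\<omega> (lift (t \<odot>\<^bsub>plane G\<^esub> u)) (lift v) = h t \<otimes>\<^bsub>F\<^esub> \<omega> (lift u) (lift v)"
    "\<omega> (lift u) (lift (t \<odot>\<^bsub>plane G\<^esub> v)) = h t \<otimes>\<^bsub>F\<^esub> \<omega> (lift u) (lift v)"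
    if "t \<in> carrier G" "u \<in> carrier (plane G)" "v \<in> carrier (plane G)" for t u v
    using bilinear hom_closed[OF that(1)] that(2,3)[THEN lift_closed]
    unfolding lift_smult[OF that(1,2)] lift_smult[OF that(1,3)] bilinear_form_def by blast+
  have plane: "u \<in> carrier (plane G) \<Longrightarrow> v \<in> carrier (plane G) \<Longrightarrow> u \<oplus>\<^bsub>plane G\<^esub> v \<in> carrier (plane G)"
    "t \<in> carrier G \<Longrightarrow> u \<in> carrier (plane G) \<Longrightarrow> t \<odot>\<^bsub>plane G\<^esub> u \<in> carrier (plane G)" for u v t
    by (simp_all add: plane_simps mem_Times_iff)
  show ?thesis
    unfolding bilinear_form_def
    by (intro conjI ballI pullback_closed pullback_eqI)
      (simp_all add: plane pullback_closed hom_pullback add smult)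
qed

lemma nondegenerate_form_pullback:
  assumes nondeg: "nondegenerate_form F \<omega>"
  shows "nondegenerate_form G pullback"
proof -
  have axes: "G.axis1 \<in> carrier (plane G)" "G.axis2 \<in> carrier (plane G)" "lift G.axis1 = F.axis1"
    "lift G.axis2 = F.axis2"
    by (simp_all add: lift_def plane_simps)
  have "u = \<zero>\<^bsub>plane G\<^esub>" if u: "u \<in> carrier (plane G)" and "\<forall>v\<in>carrier (plane G). pullback u v = \<zero>\<^bsub>G\<^esub>" for u
  proof -
    have "\<omega> (lift u) F.axis1 = \<zero>\<^bsub>F\<^esub>" "\<omega> (lift u) F.axis2 = \<zero>\<^bsub>F\<^esub>"
      using that axes(1,2) by (simp_all flip: axes(3,4) hom_pullback)
    then have "lift u = \<zero>\<^bsub>plane F\<^esub>"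
      by (rule F.nondegenerate_formD[OF bilinear nondeg lift_closed[OF u]])
    then show ?thesis
      by (simp add: lift_eq_zero_iff u)
  qed
  moreover have "v = \<zero>\<^bsub>plane G\<^esub>" if v: "v \<in> carrier (plane G)"
    and "\<forall>u\<in>carrier (plane G). pullback u v = \<zero>\<^bsub>G\<^esub>" for v
  proof -
    have "\<omega> F.axis1 (lift v) = \<zero>\<^bsub>F\<^esub>" "\<omega> F.axis2 (lift v) = \<zero>\<^bsub>F\<^esub>"
      using that axes(1,2) by (simp_all flip: axes(3,4) hom_pullback)
    then have "lift v = \<zero>\<^bsub>plane F\<^esub>"
      by (rule F.nondegenerate_formD[OF bilinear_form_swap[OF bilinear] nondegenerate_form_swap[OF nondeg] lift_closed[OF v]])
    then show ?thesis
      by (simp add: lift_eq_zero_iff v)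
  qed
  ultimately show ?thesis
    unfolding nondegenerate_form_def by blast
qed

lemma symmetric_form_pullback: "symmetric_form F \<omega> \<Longrightarrow> symmetric_form G pullback"
  unfolding symmetric_form_def pullback_def by (metis lift_closed)

lemma skew_symmetric_form_pullback:
  assumes "skew_symmetric_form F \<omega>"
  shows "skew_symmetric_form G pullback"
  unfolding skew_symmetric_form_def
proof (intro ballI pullback_eqI)
  fix u v
  assume uv: "u \<in> carrier (plane G)" "v \<in> carrier (plane G)"
  have "h (\<ominus>\<^bsub>G\<^esub> pullback v u) = \<ominus>\<^bsub>F\<^esub> \<omega> (lift v) (lift u)"
    by (simp add: pullback_closed hom_pullback uv)
  then show "\<omega> (lift u) (lift v) = h (\<ominus>\<^bsub>G\<^esub> pullback v u)"
    using assms uv[THEN lift_closed] unfolding skew_symmetric_form_def by metis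
qed (simp_all add: pullback_closed)

lemma admissible_pullback:
  assumes adm: "admissible F \<omega> (lift ` S)" and S: "S \<subseteq> carrier (plane G)"
  shows "admissible G pullback S"
proof -
  have "finite S"
    using adm finite_imageD[OF _ inj_on_subset[OF inj_on_lift S]] unfolding admissible_def by blast
  moreover have "\<not> S \<subseteq> l" if "l \<in> plane_lines G" for l
    using adm lift_line[OF that] unfolding admissible_def by (meson image_mono subset_trans)
  ultimately show ?thesis
    using adm S bilinear_form_pullback nondegenerate_form_pullback symmetric_form_pullback skew_symmetric_form_pullback
    unfolding admissible_def characteristic_eq by blast
qed

lemma card_form_values_lift:
  assumes S: "S \<subseteq> carrier (plane G)"
  shows "card (form_values \<omega> (lift ` S)) = card (form_values pullback S)"
proof -
  have "form_values \<omega> (lift ` S) = (\<Union>s\<in>S. (\<lambda>t. \<omega> (lift s) (lift t)) ` S)"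
    by (simp add: form_values_eq_UN image_image)
  also have "\<dots> = (\<Union>s\<in>S. (\<lambda>t. h (pullback s t)) ` S)"
    by (intro SUP_cong image_cong refl) (simp add: hom_pullback subsetD[OF S])
  also have "\<dots> = h ` form_values pullback S"
    by (simp add: form_values_eq_UN image_UN image_image)
  finally have "form_values \<omega> (lift ` S) = h ` form_values pullback S" .
  moreover have "form_values pullback S \<subseteq> carrier G"
    using S pullback_closed unfolding form_values_eq_UN by blast
  ultimately show ?thesis
    by (simp add: card_image inj_on_subset[OF inj_on_hom])
qed

lemma form_values_lower_bounds:
  assumes "form_values_bound c G" "S \<subseteq> carrier (plane G)" "admissible F \<omega> (lift ` S)"
  shows "c * min (real (card (lift ` S)) powr (2/3)) (real (characteristic F))
    \<le> real (card (form_values \<omega> (lift ` S)))"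
    and "T \<subseteq> S \<Longrightarrow> card T < characteristic F \<Longrightarrow> on_distinct_lines_through_origin G T
      \<Longrightarrow> c * real (card T) \<le> real (card (form_values \<omega> (lift ` S)))"
proof -
  have "c * min (real (card S) powr (2/3)) (real (characteristic G)) \<le> real (card (form_values pullback S)) \<and>
    (\<forall>T\<subseteq>S. card T < characteristic G \<and> on_distinct_lines_through_origin G T \<longrightarrow>
      c * real (card T) \<le> real (card (form_values pullback S)))"
    using assms(1) admissible_pullback[OF assms(3,2)] unfolding form_values_bound_iff by (elim allE impE)
  then show "c * min (real (card (lift ` S)) powr (2/3)) (real (characteristic F))
    \<le> real (card (form_values \<omega> (lift ` S)))"
    and "T \<subseteq> S \<Longrightarrow> card T < characteristic F \<Longrightarrow> on_distinct_lines_through_origin G T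
      \<Longrightarrow> c * real (card T) \<le> real (card (form_values \<omega> (lift ` S)))"
    by (simp_all add: characteristic_eq card_form_values_lift[OF assms(2)] card_lift[OF assms(2)])
qed

end

lemma field_embeddingI:
  assumes "field G" "field F" "h \<in> ring_hom G F"
  shows "field_embedding G F h"
proof -
  interpret G: field G by fact
  interpret F: field F by fact
  show ?thesis
    using assms(3) by unfold_locales
qed

lemma form_values_closed:
  assumes "bilinear_form F \<omega>" "S \<subseteq> carrier (plane F)"
  shows "form_values \<omega> S \<subseteq> carrier F"
  using assms unfolding bilinear_form_def form_values_eq_UN by blast

lemma (in field_embedding) lift_image: "lift ` carrier (plane G) = h ` carrier G \<times> h ` carrier G"
  by (simp add: lift_def plane_simps map_prod_surj_on)

lemma (in field_embedding) form_embedding_if_defined_on_axes: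
  assumes bil: "bilinear_form F \<omega>" and axes: "form_values \<omega> {F.axis1, F.axis2} \<subseteq> h ` carrier G"
  shows "form_embedding G F h \<omega>"
proof
  fix u v
  assume u: "u \<in> carrier (plane G)" and v: "v \<in> carrier (plane G)"
  have plane: "F.axis1 \<in> carrier (plane F)" "F.axis2 \<in> carrier (plane F)"
    by (simp_all add: plane_simps)
  have combination: "fst (lift w) \<otimes>\<^bsub>F\<^esub> x \<oplus>\<^bsub>F\<^esub> snd (lift w) \<otimes>\<^bsub>F\<^esub> y \<in> h ` carrier G"
    if w: "w \<in> carrier (plane G)" and xy: "x \<in> h ` carrier G" "y \<in> h ` carrier G" for w x y
  proof -
    obtain a b where "a \<in> carrier G" "x = h a" "b \<in> carrier G" "y = h b"
      using xy by blast
    with w show ?thesis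
      by (intro image_eqI[of _ _ "fst w \<otimes>\<^bsub>G\<^esub> a \<oplus>\<^bsub>G\<^esub> snd w \<otimes>\<^bsub>G\<^esub> b"]) (auto simp: lift_def plane_simps)
  qed
  have "\<omega> x (lift v) \<in> h ` carrier G" if "x \<in> {F.axis1, F.axis2}" for x
  proof -
    have x: "x \<in> carrier (plane F)"
      using that plane by blast
    have "\<omega> x F.axis1 \<in> h ` carrier G" "\<omega> x F.axis2 \<in> h ` carrier G"
      using axes that unfolding form_values_eq_UN by blast+
    then show ?thesis
      unfolding F.bilinear_form_expand_right[OF bil x lift_closed[OF v]] by (rule combination[OF v])
  qed
  then show "\<omega> (lift u) (lift v) \<in> h ` carrier G"
    unfolding F.bilinear_form_expand_left[OF bil lift_closed[OF u] lift_closed[OF v]]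
    by (intro combination[OF u]) simp_all
qed (rule bil)

context form_embedding
begin

lemma form_values_lower_bound_if_covered:
  assumes "form_values_bound c G" "admissible F \<omega> S" "S \<subseteq> lift ` carrier (plane G)"
  shows "c * min (real (card S) powr (2/3)) (real (characteristic F)) \<le> real (card (form_values \<omega> S))"
proof -
  obtain S' where "S' \<subseteq> carrier (plane G)" "S = lift ` S'"
    using assms(3) by (rule subset_imageE)
  then show ?thesis
    using assms(1,2) form_values_lower_bounds(1) by blast
qed

lemma form_values_lower_bound_if_covered_lines:
  assumes bound: "form_values_bound c G" and adm: "admissible F \<omega> S" and S: "S \<subseteq> lift ` carrier (plane G)"
    and T: "T \<subseteq> S" "card T < characteristic F" and d: "d ` T \<subseteq> lift ` carrier (plane G)"
    and lines: "\<forall>s\<in>T. d s \<noteq> \<zero>\<^bsub>plane F\<^esub> \<and> cross F s (d s) = \<zero>\<^bsub>F\<^esub>"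
      "\<forall>s\<in>T. \<forall>t\<in>T. s \<noteq> t \<longrightarrow> cross F (d s) (d t) \<noteq> \<zero>\<^bsub>F\<^esub>"
  shows "c * real (card T) \<le> real (card (form_values \<omega> S))"
proof -
  obtain S' where S': "S' \<subseteq> carrier (plane G)" "S = lift ` S'"
    using S by (rule subset_imageE)
  then obtain T' where T': "T' \<subseteq> S'" "T = lift ` T'"
    using T(1) subset_imageE by metis
  have "on_distinct_lines_through_origin G T'"
    using T' S'(1) d lines by (intro on_distinct_lines_through_origin_if_lift[of T' d]) auto
  moreover have "card T = card T'"
    using T' S'(1) card_lift by blast
  ultimately show ?thesis
    using form_values_lower_bounds(2)[OF bound S'(1)] adm S'(2) T'(1) T(2) by simp
qed

end

lemma exists_form_embedding_covering:
  fixes F :: "'a ring"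
  assumes F: "field F" and embedded: "\<forall>H. finite H \<and> H \<subseteq> carrier F \<longrightarrow>
      (\<exists>(G :: 'g ring) h. field G \<and> h \<in> ring_hom G F \<and> H \<subseteq> h ` carrier G \<and> form_values_bound c G)"
    and bil: "bilinear_form F \<omega>" and P: "finite P" "P \<subseteq> carrier (plane F)"
  shows "\<exists>(G :: 'g ring) h. form_embedding G F h \<omega> \<and> form_values_bound c G \<and>
    P \<subseteq> field_embedding.lift h ` carrier (plane G)"
proof -
  interpret F: field F
    by (rule F)
  let ?axes = "{(\<one>\<^bsub>F\<^esub>, \<zero>\<^bsub>F\<^esub>), (\<zero>\<^bsub>F\<^esub>, \<one>\<^bsub>F\<^esub>)}"
  have axes: "?axes \<subseteq> carrier (plane F)"
    by (simp add: plane_simps)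
  let ?H = "fst ` P \<union> snd ` P \<union> form_values \<omega> ?axes"
  have finite: "finite ?H"
    using P(1) by (simp add: form_values_eq_UN)
  have closed: "?H \<subseteq> carrier F"
    using P(2) form_values_closed[OF bil axes] by (auto simp: plane_simps(1))
  obtain G :: "'g ring" and h where G: "field G" "h \<in> ring_hom G F" "form_values_bound c G"
    and H: "?H \<subseteq> h ` carrier G"
    using mp[OF spec[OF embedded] conjI[OF finite closed]] by (elim exE conjE)
  interpret field_embedding G F h
    by (rule field_embeddingI[OF G(1) F G(2)])
  have "form_embedding G F h \<omega>"
    using H by (intro form_embedding_if_defined_on_axes[OF bil]) simp
  moreover have "P \<subseteq> lift ` carrier (plane G)"
    using H unfolding lift_image by (auto simp: image_subset_iff)
  ultimately show ?thesis
    using G(3) by (intro exI[of _ G] exI[of _ h] conjI)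
qed

text \<open>Not only the points but also the directions of the lines have to be covered, because the point \<open>0\<close>
  does not determine the line that is assigned to it.\<close>

lemma form_values_bound_if_locally_embedded:
  fixes F :: "'a ring"
  assumes F: "field F" and embedded: "\<forall>H. finite H \<and> H \<subseteq> carrier F \<longrightarrow>
    (\<exists>(G :: 'g ring) h. field G \<and> h \<in> ring_hom G F \<and> H \<subseteq> h ` carrier G \<and> form_values_bound c G)"
  shows "form_values_bound c F"
  unfolding form_values_bound_iff
proof (intro allI impI conjI)
  fix \<omega> S
  interpret F: field_plane F
    using F by (simp add: field_plane_def)
  assume adm: "admissible F \<omega> S"
  then have S: "finite S" "S \<subseteq> carrier (plane F)" and "bilinear_form F \<omega>"
    by (simp_all add: admissible_def)
  note covering = exists_form_embedding_covering[OF F embedded \<open>bilinear_form F \<omega>\<close>]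
  show "c * min (real (card S) powr (2/3)) (real (characteristic F)) \<le> real (card (form_values \<omega> S))"
    using covering[OF S] form_embedding.form_values_lower_bound_if_covered[OF _ _ adm] by blast
  fix T
  assume T: "T \<subseteq> S" "card T < characteristic F \<and> on_distinct_lines_through_origin F T"
  then have "T \<subseteq> carrier (plane F)" "finite T"
    using S finite_subset by blast+
  then obtain d where d: "\<forall>s\<in>T. d s \<in> carrier (plane F)"
    and lines: "\<forall>s\<in>T. d s \<noteq> \<zero>\<^bsub>plane F\<^esub> \<and> cross F s (d s) = \<zero>\<^bsub>F\<^esub>"
      "\<forall>s\<in>T. \<forall>t\<in>T. s \<noteq> t \<longrightarrow> cross F (d s) (d t) \<noteq> \<zero>\<^bsub>F\<^esub>"
    using T(2) F.on_distinct_lines_through_origin_iff[of T] by blast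
  have "finite (S \<union> d ` T)" "S \<union> d ` T \<subseteq> carrier (plane F)"
    using S d \<open>finite T\<close> by auto
  from covering[OF this] obtain G :: "'g ring" and h where G: "form_embedding G F h \<omega>" "form_values_bound c G"
      and covered: "S \<union> d ` T \<subseteq> field_embedding.lift h ` carrier (plane G)"
    by (elim exE conjE)
  show "c * real (card T) \<le> real (card (form_values \<omega> S))"
    using covered T
    by (intro form_embedding.form_values_lower_bound_if_covered_lines[OF G adm _ _ _ _ lines]) simp_all
qed

subsection \<open>Finitely generated subfields are countable\<close>

datatype field_term =
  Gen nat | One | Neg field_term | Inv field_term | Add field_term field_term | Mul field_term field_term

instance field_term :: countable
  by countable_datatype

primrec field_term_val :: "'a ring \<Rightarrow> (nat \<Rightarrow> 'a) \<Rightarrow> field_term \<Rightarrow> 'a" where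
  "field_term_val F a (Gen n) = a n"
| "field_term_val F a One = \<one>\<^bsub>F\<^esub>"
| "field_term_val F a (Neg s) = \<ominus>\<^bsub>F\<^esub> field_term_val F a s"
| "field_term_val F a (Inv s) = inv\<^bsub>F\<^esub> field_term_val F a s"
| "field_term_val F a (Add s t) = field_term_val F a s \<oplus>\<^bsub>F\<^esub> field_term_val F a t"
| "field_term_val F a (Mul s t) = field_term_val F a s \<otimes>\<^bsub>F\<^esub> field_term_val F a t"

lemma countable_generate_field:
  fixes F :: "'a ring"
  assumes "countable H"
  shows "countable (generate_field F H)"
proof (rule countable_subset)
  let ?v = "field_term_val F (from_nat_into H)"
  show "generate_field F H \<subseteq> range ?v"
  proof
    fix x
    assume "x \<in> generate_field F H"
    then show "x \<in> range ?v"
    proof induction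
      case one
      show ?case
        by (rule range_eqI[of _ _ One]) simp
    next
      case (incl x)
      then obtain n where "x = ?v (Gen n)"
        using from_nat_into_surj[OF assms] by force
      then show ?case
        by blast
    next
      case (a_inv x)
      then show ?case
        by (auto simp flip: field_term_val.simps)
    next
      case (m_inv x)
      then show ?case
        by (auto simp flip: field_term_val.simps)
    next
      case (eng_add x y)
      then show ?case
        by (auto simp flip: field_term_val.simps)
    next
      case (eng_mult x y)
      then show ?case
        by (auto simp flip: field_term_val.simps)
    qed
  qed
qed simp

lemma exists_nat_field_covering:
  fixes F :: "'a ring"
  assumes "field F" "finite H" "H \<subseteq> carrier F"
  shows "\<exists>(G :: nat ring) h. field G \<and> h \<in> ring_hom G F \<and> H \<subseteq> h ` carrier G"
proof -
  interpret F: field F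
    by fact
  define K where "K = F\<lparr>carrier := generate_field F H\<rparr>"
  define e where "e = to_nat_on (generate_field F H)"
  define h where "h = inv_into (carrier K) e"
  interpret K: field K
    unfolding K_def by (rule F.generate_field_is_field[OF assms(3)])
  have e: "inj_on e (carrier K)"
    using inj_on_to_nat_on[OF countable_generate_field[OF countable_finite[OF assms(2)]], of F]
    by (simp add: e_def K_def)
  have "h \<in> ring_iso (image_ring e K) K"
    unfolding h_def by (intro ring_iso_set_sym inj_imp_image_ring_iso e) (rule K.ring_axioms)
  then have h: "h \<in> ring_hom (image_ring e K) K" "h ` carrier (image_ring e K) = carrier K"
    by (auto simp: ring_iso_def bij_betw_def)
  have "generate_field F H \<subseteq> carrier F"
    by (rule F.generate_field_incl[OF assms(3)])
  then have "h \<in> ring_hom (image_ring e K) F"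
    using h(1) by (auto simp: ring_hom_def K_def)
  moreover have "H \<subseteq> h ` carrier (image_ring e K)"
    unfolding h(2) by (auto simp: K_def intro: generate_field.incl)
  ultimately show ?thesis
    using K.inj_imp_image_ring_is_field[OF e] by blast
qed

lemma form_values_bound_of_nat_fields:
  fixes F :: "'a ring"
  assumes "\<And>G :: nat ring. field G \<Longrightarrow> form_values_bound c G" and F: "field F"
  shows "form_values_bound c F"
proof (rule form_values_bound_if_locally_embedded[OF F], intro allI impI)
  fix H
  assume "finite H \<and> H \<subseteq> carrier F"
  then show "\<exists>(G :: nat ring) h. field G \<and> h \<in> ring_hom G F \<and> H \<subseteq> h ` carrier G \<and> form_values_bound c G"
    using exists_nat_field_covering[OF F, of H] assms(1) by blast
qed

subsection \<open>A field of natural numbers as a type\<close>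

text \<open>The arguments above need a type of class \<^class>\<open>field\<close>. A type definition cannot depend on a
  variable, so it is made for a closed term: a field on the natural numbers that violates the bound,
  if there is one.\<close>

definition extremal_field :: "nat ring" where
  "extremal_field = (SOME F. field F \<and>
    (form_values_bound (1 / 30000) F \<longrightarrow> (\<forall>G :: nat ring. field G \<longrightarrow> form_values_bound (1 / 30000) G)))"

lemma extremal_field:
  "field extremal_field"
  "form_values_bound (1 / 30000) extremal_field \<Longrightarrow> field (G :: nat ring) \<Longrightarrow> form_values_bound (1 / 30000) G"
proof -
  have "field (image_ring to_nat (ring_of_type_algebra :: rat ring))"
    by (rule field.inj_imp_image_ring_is_field[OF field_from_type_algebra]) (rule
      inj_on_subset[OF inj_to_nat], simp)
  then have "\<exists>F :: nat ring. field F \<and>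
    (form_values_bound (1 / 30000) F \<longrightarrow> (\<forall>G :: nat ring. field G \<longrightarrow> form_values_bound (1 / 30000) G))"
    by blast
  from someI_ex[OF this] show "field extremal_field"
    "form_values_bound (1 / 30000) extremal_field \<Longrightarrow> field (G :: nat ring) \<Longrightarrow> form_values_bound (1 / 30000) G"
    unfolding extremal_field_def by blast+
qed

typedef extremal = "carrier extremal_field" morphisms rep_extremal abs_extremal
  using ring.ring_simprules(6)[OF cring.axioms(1)[OF fieldE(1)[OF extremal_field(1)]]] by blast

instantiation extremal :: field
begin

definition "0 = abs_extremal \<zero>\<^bsub>extremal_field\<^esub>"
definition "1 = abs_extremal \<one>\<^bsub>extremal_field\<^esub>"
definition "x + y = abs_extremal (rep_extremal x \<oplus>\<^bsub>extremal_field\<^esub> rep_extremal y)"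
definition "x * y = abs_extremal (rep_extremal x \<otimes>\<^bsub>extremal_field\<^esub> rep_extremal y)"
definition "- x = abs_extremal (\<ominus>\<^bsub>extremal_field\<^esub> rep_extremal x)"
definition "x - y = x + (- y)" for x y :: extremal
definition "inverse x = (if x = 0 then 0 else abs_extremal (inv\<^bsub>extremal_field\<^esub> rep_extremal x))"
definition "x div y = x * inverse y" for x y :: extremal

lemma rep_extremal_closed [simp]: "rep_extremal x \<in> carrier extremal_field"
  by (rule rep_extremal)

lemma rep_extremal_simps [simp]:
  "rep_extremal 0 = \<zero>\<^bsub>extremal_field\<^esub>" "rep_extremal 1 = \<one>\<^bsub>extremal_field\<^esub>"
  "rep_extremal (x + y) = rep_extremal x \<oplus>\<^bsub>extremal_field\<^esub> rep_extremal y"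
  "rep_extremal (x * y) = rep_extremal x \<otimes>\<^bsub>extremal_field\<^esub> rep_extremal y"
  "rep_extremal (- x) = \<ominus>\<^bsub>extremal_field\<^esub> rep_extremal x"
proof -
  interpret X: field extremal_field
    by (rule extremal_field(1))
  show "rep_extremal 0 = \<zero>\<^bsub>extremal_field\<^esub>" "rep_extremal 1 = \<one>\<^bsub>extremal_field\<^esub>"
    "rep_extremal (x + y) = rep_extremal x \<oplus>\<^bsub>extremal_field\<^esub> rep_extremal y"
    "rep_extremal (x * y) = rep_extremal x \<otimes>\<^bsub>extremal_field\<^esub> rep_extremal y"
    "rep_extremal (- x) = \<ominus>\<^bsub>extremal_field\<^esub> rep_extremal x"
    by (simp_all add: zero_extremal_def one_extremal_def plus_extremal_def times_extremal_def
        uminus_extremal_def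
        abs_extremal_inverse)
qed

instance
proof
  fix x y z :: extremal
  interpret X: field extremal_field
    by (rule extremal_field(1))
  note inj = rep_extremal_inject[THEN iffD1]
  show "x + y + z = x + (y + z)"
    by (rule inj) (simp add: X.a_assoc)
  show "x + y = y + x"
    by (rule inj) (simp add: X.a_comm)
  show "0 + x = x"
    by (rule inj) simp
  show "- x + x = 0"
    by (rule inj) (simp add: X.l_neg)
  show "x - y = x + - y"
    by (simp add: minus_extremal_def)
  show "x * y * z = x * (y * z)"
    by (rule inj) (simp add: X.m_assoc)
  show "x * y = y * x"
    by (rule inj) (simp add: X.m_comm)
  show "1 * x = x"
    by (rule inj) simp
  show "(x + y) * z = x * z + y * z"
    by (rule inj) (simp add: X.l_distr)
  show "(0 :: extremal) \<noteq> 1"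
    using X.one_not_zero by (metis rep_extremal_simps(1,2))
  show "inverse x * x = 1" if "x \<noteq> 0"
  proof (rule inj)
    have "rep_extremal x \<noteq> \<zero>\<^bsub>extremal_field\<^esub>"
      using that by (metis rep_extremal_inject rep_extremal_simps(1))
    then have "rep_extremal x \<in> Units extremal_field"
      using X.field_Units rep_extremal_closed by blast
    then show "rep_extremal (inverse x * x) = rep_extremal 1"
      using that by (simp add: inverse_extremal_def abs_extremal_inverse)
  qed
  show "x div y = x * inverse y"
    by (simp add: divide_extremal_def)
  show "inverse (0 :: extremal) = 0"
    by (simp add: inverse_extremal_def)
qed

end

lemma form_values_bound_extremal: "form_values_bound (1 / 30000) extremal_field"
proof (rule form_values_bound_if_locally_embedded[OF extremal_field(1)], intro allI impI)
  fix H
  assume H: "finite H \<and> H \<subseteq> carrier extremal_field"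
  have "rep_extremal \<in> ring_hom ring_of_type_algebra extremal_field"
    by (rule ring_hom_memI) (simp_all add: type_ring_simps)
  moreover have "rep_extremal ` carrier ring_of_type_algebra = carrier extremal_field"
    using type_definition.Rep_range[OF type_definition_extremal] by (simp add: type_ring_simps)
  ultimately show "\<exists>(G :: extremal ring) h. field G \<and> h \<in> ring_hom G extremal_field \<and> H \<subseteq> h ` carrier G \<and>
      form_values_bound (1 / 30000) G"
    using H field_from_type_algebra form_values_bound_type_field
    by (intro exI[of _ ring_of_type_algebra] exI[of _ rep_extremal]) simp
qed

theorem theorem13:
  shows "0 < absolute_constant \<and>
    (\<forall>F :: 'a ring. field F \<longrightarrow> form_values_bound absolute_constant F)"
proof -
  have "\<exists>c::real. 0 < c \<and> (\<forall>F :: nat ring. field F \<longrightarrow> form_values_bound c F)"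
    using extremal_field(2)[OF form_values_bound_extremal]
    by (intro exI[of _ "1 / 30000"] conjI allI impI) simp_all
  from someI_ex[OF this]
  have "0 < absolute_constant \<and> (\<forall>F :: nat ring. field F \<longrightarrow> form_values_bound absolute_constant F)"
    unfolding absolute_constant_def .
  then show ?thesis
    using form_values_bound_of_nat_fields by blast
qed

end
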